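(* Let $p$ be a prime and let $\mathrm{SymHaar}$ be the infinite Haar random symmetric matrix over $\mathbb{Z}_p$, with top-left $n\times n$ corners $\mathrm{SymHaar}_{n,n}$. Then the process $\big(\widetilde{\ker}(\mathrm{SymHaar}_{n,n})\big)_{n\ge 1}$ is a Markov chain.
   Context: Fix a prime $p$. $\mathrm{SymHaar}=(a_{ij})_{i,j\ge 1}$ is the random infinite symmetric matrix with entries in $\mathbb{Z}_p$ such that the entries $a_{ij}$, $i\le j$, are independent and distributed according to the Haar probability measure on $\mathbb{Z}_p$, and $a_{ji}=a_{ij}$; $\mathrm{SymHaar}_{n,n}$ is its top-left $n\times n$ corner. For a symmetric $k\times k$ matrix $M$ over $\mathbb{Z}_p$, $\ker(M)$ denotes the kernel of $M:(\mathbb{Q}_p/\mathbb{Z}_p)^k\to(\mathbb{Q}_p/\mathbb{Z}_p)^k$. It carries the symmetric pairing $\ker(M)\times\ker(M)\to\mathbb{Q}_p/\mathbb{Z}_p$, $(v,w)\mapsto v^TMw \bmod \mathbb{Z}_p$ (computed with lifts of $v,w$ to $\mathbb{Q}_p^k$), which is perfect when $M$ is non-singular. $\widetilde{\ker}(M)$ denotes the group $\ker(M)$ together with this pairing, up to isomorphism (isomorphisms of groups preserving the pairings). $X_S$ denotes the set of isomorphism classes of finite abelian $p$-groups $G$ equipped with a perfect symmetric pairing $G\times G\to\mathbb{Q}_p/\mathbb{Z}_p$. Almost surely every $\mathrm{SymHaar}_{n,n}$ is non-singular, so the process takes values in the countable set $X_S$ almost surely. *)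

theory Defs
  imports
    "HOL-Probability.Probability"
    "HOL-Computational_Algebra.Computational_Algebra"
    "HOL-Algebra.Group"
    "Jordan_Normal_Form.Matrix"
    "Berlekamp_Zassenhaus.Finite_Field"
begin

section \<open>The ring of \<open>p\<close>-adic integers\<close>

text \<open>The prime is \<open>p = CARD('p)\<close> for a type \<open>'p\<close> of class \<open>prime_card\<close>.
  The ring of \<open>p\<close>-adic integers is the inverse limit of the rings \<open>\<int> / p^n\<close>: the
  \<open>n\<close>-th component of an element is its residue modulo \<open>p^n\<close>, represented
  in \<open>{0..<p^n}\<close>.\<close>

typedef (overloaded) 'p padic_int =
  "{x :: nat \<Rightarrow> int. \<forall>n. x n = x (Suc n) mod int CARD('p::prime_card) ^ n}"
  morphisms residue Abs_padic_int
  by (rule exI[of _ "\<lambda>_. 0"]) simp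

setup_lifting type_definition_padic_int

lemma mod_mod_pow: "(a mod q ^ Suc n) mod q ^ n = a mod (q ^ n :: int)"
  by (simp add: mod_mod_cancel)

lemma compatible_mod:
  fixes x :: "nat \<Rightarrow> int"
  assumes "\<forall>n. x n = x (Suc n) mod q ^ n"
  shows "x n mod q ^ n = x (Suc n) mod q ^ n"
  by (subst assms[rule_format]) (rule mod_mod_trivial)

instantiation padic_int :: (prime_card) comm_ring_1
begin

lift_definition zero_padic_int :: "'a padic_int" is "\<lambda>_. 0" by simp

lift_definition one_padic_int :: "'a padic_int" is "\<lambda>n. 1 mod int CARD('a) ^ n"
  by (simp only: mod_mod_pow)

lift_definition plus_padic_int :: "'a padic_int \<Rightarrow> 'a padic_int \<Rightarrow> 'a padic_int"
  is "\<lambda>x y n. (x n + y n) mod int CARD('a) ^ n"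
  unfolding mod_mod_pow by (intro allI mod_add_cong compatible_mod)

lift_definition uminus_padic_int :: "'a padic_int \<Rightarrow> 'a padic_int"
  is "\<lambda>x n. (- x n) mod int CARD('a) ^ n"
  unfolding mod_mod_pow by (intro allI mod_minus_cong compatible_mod)

lift_definition minus_padic_int :: "'a padic_int \<Rightarrow> 'a padic_int \<Rightarrow> 'a padic_int"
  is "\<lambda>x y n. (x n - y n) mod int CARD('a) ^ n"
  unfolding mod_mod_pow by (intro allI mod_diff_cong compatible_mod)

lift_definition times_padic_int :: "'a padic_int \<Rightarrow> 'a padic_int \<Rightarrow> 'a padic_int"
  is "\<lambda>x y n. (x n * y n) mod int CARD('a) ^ n"
  unfolding mod_mod_pow by (intro allI mod_mult_cong compatible_mod)

lemma residue_Suc: "residue (x :: 'a padic_int) n = residue x (Suc n) mod int CARD('a) ^ n"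
  using residue[of x] unfolding mem_Collect_eq by (rule spec)

lemma residue_mod: "residue (x :: 'a padic_int) n mod int CARD('a) ^ n = residue x n"
  by (subst (1 2) residue_Suc) (rule mod_mod_trivial)

instance
proof
  fix a b c :: "'a padic_int"
  note ops = zero_padic_int.rep_eq one_padic_int.rep_eq plus_padic_int.rep_eq
    uminus_padic_int.rep_eq minus_padic_int.rep_eq times_padic_int.rep_eq
  have eqI: "x = y" if "\<And>n. residue x n = residue y n" for x y :: "'a padic_int"
    using that by (simp add: residue_inject[symmetric] ext)
  show "a * b * c = a * (b * c)"
    by (rule eqI) (simp only: ops mod_mult_left_eq mod_mult_right_eq mult.assoc)
  show "a * b = b * a"
    by (rule eqI) (simp only: ops mult.commute)
  show "1 * a = a"
    by (rule eqI) (simp only: ops mod_mult_left_eq mult_1 residue_mod)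
  show "(a + b) * c = a * c + b * c"
    by (rule eqI) (simp only: ops mod_mult_left_eq mod_add_eq distrib_right)
  show "a + b + c = a + (b + c)"
    by (rule eqI) (simp only: ops mod_add_left_eq mod_add_right_eq add.assoc)
  show "a + b = b + a"
    by (rule eqI) (simp only: ops add.commute)
  show "0 + a = a"
    by (rule eqI) (simp only: ops add_0 residue_mod)
  show "- a + a = 0"
    by (rule eqI) (simp only: ops mod_add_left_eq add.left_inverse mod_0)
  show "a - b = a + - b"
    by (rule eqI) (simp only: ops mod_add_right_eq diff_conv_add_uminus)
  have "residue (0 :: 'a padic_int) 1 \<noteq> residue (1 :: 'a padic_int) 1"
    using prime_card[where 'a='a]
    by (simp add: zero_padic_int.rep_eq one_padic_int.rep_eq prime_gt_Suc_0_nat)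
  then show "(0 :: 'a padic_int) \<noteq> 1" by metis
qed

end

lemma residue_mod_le:
  "residue (x :: 'a::prime_card padic_int) (n + m) mod int CARD('a) ^ n = residue x n"
proof (induction m)
  case 0
  show ?case by (simp add: residue_mod)
next
  case (Suc m)
  have "residue x n = residue x (n + m) mod int CARD('a) ^ n"
    by (rule Suc.IH[symmetric])
  also have "\<dots> = residue x (Suc (n + m)) mod int CARD('a) ^ (n + m) mod int CARD('a) ^ n"
    by (subst residue_Suc) (rule refl)
  also have "\<dots> = residue x (n + Suc m) mod int CARD('a) ^ n"
    by (simp add: mod_mod_cancel le_imp_power_dvd)
  finally show ?case by (rule sym)
qed

instance padic_int :: (prime_card) idom
proof
  fix a b :: "'a padic_int"
  let ?p = "int CARD('a)"
  assume "a \<noteq> 0" "b \<noteq> 0"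
  then have "residue a \<noteq> (\<lambda>_. 0)" "residue b \<noteq> (\<lambda>_. 0)"
    unfolding zero_padic_int.rep_eq[where 'a='a, symmetric] residue_inject by simp_all
  then obtain n m where nz: "residue a n \<noteq> 0" "residue b m \<noteq> 0"
    unfolding fun_eq_iff by blast
  have p: "prime ?p" using prime_card[where 'a='a] by simp
  have na: "\<not> ?p ^ n dvd residue a (n + m)"
    using residue_mod_le[of a n m] nz(1) by (simp add: dvd_eq_mod_eq_0)
  have nb: "\<not> ?p ^ m dvd residue b (n + m)"
    using residue_mod_le[of b m n] nz(2) by (simp add: dvd_eq_mod_eq_0 add.commute)
  have "\<not> ?p ^ (n + m) dvd residue a (n + m) * residue b (n + m)"
  proof
    let ?x = "residue a (n + m)" and ?y = "residue b (n + m)"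
    assume d: "?p ^ (n + m) dvd ?x * ?y"
    have xy: "?x \<noteq> 0" "?y \<noteq> 0" using na nb by auto
    have "n + m \<le> multiplicity ?p (?x * ?y)"
      using d p xy by (intro multiplicity_geI) auto
    also have "\<dots> = multiplicity ?p ?x + multiplicity ?p ?y"
      using p xy by (simp add: prime_elem_multiplicity_mult_distrib)
    also have "\<dots> < n + m"
    proof -
      have "multiplicity ?p ?x < n" using na multiplicity_dvd'[of n ?p ?x] by linarith
      moreover have "multiplicity ?p ?y < m" using nb multiplicity_dvd'[of m ?p ?y] by linarith
      ultimately show ?thesis by linarith
    qed
    finally show False by simp
  qed
  then have "residue (a * b) (n + m) \<noteq> 0"
    by (simp add: times_padic_int.rep_eq dvd_eq_mod_eq_0)
  then show "a * b \<noteq> 0" by (auto simp: zero_padic_int.rep_eq)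
qed

text \<open>The \<open>p\<close>-adic topology: the balls \<open>x + p^n \<int>\<^sub>p\<close> are the basic neighbourhoods of \<open>x\<close>.\<close>

instantiation padic_int :: (prime_card) topological_space
begin

definition open_padic_int :: "'a padic_int set \<Rightarrow> bool" where
  "open_padic_int U \<longleftrightarrow> (\<forall>x\<in>U. \<exists>n. \<forall>y. residue y n = residue x n \<longrightarrow> y \<in> U)"

instance
proof
  have openD: "\<exists>n. \<forall>y. residue y n = residue x n \<longrightarrow> y \<in> U" if "open U" "x \<in> U"
    for x and U :: "'a padic_int set"
    using that unfolding open_padic_int_def by (rule bspec)
  show "open (UNIV :: 'a padic_int set)" by (simp add: open_padic_int_def)
  show "open (\<Union>K)" if K: "\<forall>S\<in>K. open S" for K :: "'a padic_int set set"
    unfolding open_padic_int_def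
  proof (rule ballI)
    fix x assume "x \<in> \<Union>K"
    then obtain S where S: "S \<in> K" "x \<in> S" by blast
    then obtain n where "\<forall>y. residue y n = residue x n \<longrightarrow> y \<in> S"
      using openD[OF bspec[OF K]] by meson
    with S(1) show "\<exists>n. \<forall>y. residue y n = residue x n \<longrightarrow> y \<in> \<Union>K"
      by (intro exI[of _ n]) auto
  qed
  show "open (S \<inter> T)" if S: "open S" and T: "open T" for S T :: "'a padic_int set"
    unfolding open_padic_int_def
  proof (rule ballI)
    fix x assume "x \<in> S \<inter> T"
    then have "x \<in> S" "x \<in> T" by simp_all
    then obtain n m where
      "\<forall>y. residue y n = residue x n \<longrightarrow> y \<in> S" "\<forall>y. residue y m = residue x m \<longrightarrow> y \<in> T"
      using openD[OF S] openD[OF T] by meson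
    then have n: "residue y n = residue x n \<Longrightarrow> y \<in> S" and m: "residue y m = residue x m \<Longrightarrow> y \<in> T" for y
      by simp_all
    have "y \<in> S \<inter> T" if y: "residue y (n + m) = residue x (n + m)" for y
    proof
      show "y \<in> S"
        by (rule n) (use y residue_mod_le[of y n m] residue_mod_le[of x n m] in simp)
      show "y \<in> T"
        by (rule m) (use y residue_mod_le[of y m n] residue_mod_le[of x m n] in \<open>simp add: add.commute\<close>)
    qed
    then show "\<exists>k. \<forall>y. residue y k = residue x k \<longrightarrow> y \<in> S \<inter> T"
      by (intro exI[of _ "n + m"]) simp
  qed
qed

end

definition haar_prob_measure :: "'p::prime_card padic_int measure \<Rightarrow> bool" where
  "haar_prob_measure \<mu> \<longleftrightarrow>
     prob_space \<mu> \<and> sets \<mu> = sets borel \<and> (\<forall>x. distr \<mu> borel (\<lambda>y. x + y) = \<mu>)"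


section \<open>The group \<open>\<rat>\<^sub>p / \<int>\<^sub>p\<close>\<close>

type_synonym 'p padic = "'p padic_int fract"

definition padic_int_cong :: "'p::prime_card padic \<Rightarrow> 'p padic \<Rightarrow> bool" where
  "padic_int_cong x y \<longleftrightarrow> x - y \<in> range to_fract"

lemma range_to_fract_closed:
  fixes x y :: "'p::prime_card padic"
  shows "0 \<in> range (to_fract :: 'p padic_int \<Rightarrow> _)"
    "x \<in> range to_fract \<Longrightarrow> y \<in> range to_fract \<Longrightarrow> x + y \<in> range to_fract"
    "x \<in> range to_fract \<Longrightarrow> - x \<in> range to_fract"
    "x \<in> range to_fract \<Longrightarrow> y \<in> range to_fract \<Longrightarrow> x * y \<in> range to_fract"
proof -
  show "0 \<in> range (to_fract :: 'p padic_int \<Rightarrow> _)"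
    by (rule range_eqI[of _ _ 0]) (rule to_fract_0[symmetric])
  show "- x \<in> range to_fract" if "x \<in> range to_fract"
    using that by (elim imageE) (simp only: to_fract_uminus[symmetric] rangeI)
  assume "x \<in> range to_fract" "y \<in> range to_fract"
  then obtain a b where "x = to_fract a" "y = to_fract b" by (elim imageE)
  then show "x + y \<in> range to_fract" "x * y \<in> range to_fract"
    by (simp_all only: to_fract_add[symmetric] to_fract_mult[symmetric] rangeI)
qed

lemma equivp_padic_int_cong: "equivp (padic_int_cong :: 'p::prime_card padic \<Rightarrow> _)"
proof (rule equivpI)
  show "reflp (padic_int_cong :: 'p padic \<Rightarrow> _)"
    by (simp add: reflp_def padic_int_cong_def range_to_fract_closed(1))
  show "symp (padic_int_cong :: 'p padic \<Rightarrow> _)"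
    unfolding symp_def padic_int_cong_def by (metis minus_diff_eq range_to_fract_closed(3))
  show "transp (padic_int_cong :: 'p padic \<Rightarrow> _)"
  proof (rule transpI, unfold padic_int_cong_def)
    fix x y z :: "'p padic"
    assume "x - y \<in> range to_fract" "y - z \<in> range to_fract"
    then have "(x - y) + (y - z) \<in> range to_fract" by (rule range_to_fract_closed(2))
    then show "x - z \<in> range to_fract" by simp
  qed
qed

quotient_type (overloaded) 'p prufer = "'p::prime_card padic" / padic_int_cong
  morphisms rep_prufer of_padic
  by (rule equivp_padic_int_cong)

instantiation prufer :: (prime_card) ab_group_add
begin

lift_definition zero_prufer :: "'a prufer" is 0 .

lift_definition plus_prufer :: "'a prufer \<Rightarrow> 'a prufer \<Rightarrow> 'a prufer" is "(+)"
  unfolding padic_int_cong_def by (metis add_diff_add range_to_fract_closed(2))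

lift_definition uminus_prufer :: "'a prufer \<Rightarrow> 'a prufer" is uminus
  unfolding padic_int_cong_def by (metis minus_diff_minus range_to_fract_closed(3))

lift_definition minus_prufer :: "'a prufer \<Rightarrow> 'a prufer \<Rightarrow> 'a prufer" is "(-)"
  unfolding padic_int_cong_def
proof -
  fix x y x' y' :: "'a padic"
  assume "x - y \<in> range to_fract" "x' - y' \<in> range to_fract"
  then have "(x - y) + - (x' - y') \<in> range to_fract"
    by (intro range_to_fract_closed(2,3))
  then show "(x - x') - (y - y') \<in> range to_fract" by (simp add: algebra_simps)
qed

instance
proof
  fix a b c :: "'a prufer"
  have refl: "padic_int_cong x x" for x :: "'a padic"
    by (simp add: padic_int_cong_def range_to_fract_closed(1))
  show "a + b + c = a + (b + c)" by transfer (simp add: add.assoc refl)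
  show "a + b = b + a" by transfer (simp add: add.commute refl)
  show "0 + a = a" by transfer (simp add: refl)
  show "- a + a = 0" by transfer (simp add: refl)
  show "a - b = a + - b" by transfer (simp add: refl)
qed

end

text \<open>The lift to \<open>\<rat>\<^sub>p\<close> chosen by \<open>rep_prufer\<close> is irrelevant
  (lemma \<open>scale_prufer_of_padic\<close>).\<close>

definition scale_prufer :: "'p::prime_card padic_int \<Rightarrow> 'p prufer \<Rightarrow> 'p prufer" where
  "scale_prufer a q = of_padic (to_fract a * rep_prufer q)"

lemma of_padic_eq_iff: "of_padic x = of_padic y \<longleftrightarrow> x - y \<in> range to_fract"
  unfolding prufer.abs_eq_iff padic_int_cong_def ..

lemma of_padic_rep_prufer: "of_padic (rep_prufer q) = q"
  using Quotient3_abs_rep[OF Quotient3_prufer] .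

lemma scale_prufer_of_padic: "scale_prufer a (of_padic x) = of_padic (to_fract a * x)"
proof -
  have "rep_prufer (of_padic x) - x \<in> range to_fract"
    using of_padic_rep_prufer of_padic_eq_iff by blast
  then show ?thesis unfolding scale_prufer_def of_padic_eq_iff
    by (metis right_diff_distrib range_to_fract_closed(4) rangeI)
qed

definition prufer_group :: "'p::prime_card prufer monoid" where
  "prufer_group = \<lparr>carrier = UNIV, mult = (+), one = 0\<rparr>"


section \<open>Groups with a pairing\<close>

record ('a, 'p) pairing_group = "'a monoid" +
  pairing :: "'a \<Rightarrow> 'a \<Rightarrow> 'p prufer"

definition symmetric_pairing :: "('a, 'p::prime_card) pairing_group \<Rightarrow> bool" where
  "symmetric_pairing G \<longleftrightarrow>
     (\<forall>x\<in>carrier G. pairing G x \<in> hom G prufer_group) \<and>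
     (\<forall>x\<in>carrier G. \<forall>y\<in>carrier G. pairing G x y = pairing G y x)"

text \<open>Homomorphisms are identified when they agree on the carrier, hence the restriction.\<close>

definition perfect_pairing :: "('a, 'p::prime_card) pairing_group \<Rightarrow> bool" where
  "perfect_pairing G \<longleftrightarrow>
     bij_betw (\<lambda>x. restrict (pairing G x) (carrier G)) (carrier G)
       (hom G prufer_group \<inter> extensional (carrier G))"

definition finite_abelian_p_group :: "('a, 'p::prime_card) pairing_group \<Rightarrow> bool" where
  "finite_abelian_p_group G \<longleftrightarrow>
     comm_group G \<and> finite (carrier G) \<and> (\<exists>k. order G = CARD('p) ^ k)"

definition pairing_iso ::
    "('a, 'p::prime_card) pairing_group \<Rightarrow> ('b, 'p) pairing_group \<Rightarrow> bool" where
  "pairing_iso G H \<longleftrightarrow>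
     (\<exists>h\<in>iso G H. \<forall>x\<in>carrier G. \<forall>y\<in>carrier G. pairing H (h x) (h y) = pairing G x y)"

text \<open>Isomorphism classes are formed within the groups whose carrier is a set of natural
  numbers. Every countable group has isomorphic copies of this kind, so that two countable
  abelian groups with pairing have the same class iff they are isomorphic. The condition
  \<open>comm_group H\<close> excludes records with a wrong neutral element, which \<open>iso\<close> ignores.\<close>

definition iso_class ::
    "('a, 'p::prime_card) pairing_group \<Rightarrow> (nat, 'p) pairing_group set" where
  "iso_class G = {H. comm_group H \<and> pairing_iso G H}"

definition perfect_symmetric_p_groups :: "(nat, 'p::prime_card) pairing_group set set" where
  "perfect_symmetric_p_groups =
     {iso_class G | G :: (nat, 'p) pairing_group.
        finite_abelian_p_group G \<and> symmetric_pairing G \<and> perfect_pairing G}"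


section \<open>The kernel of a symmetric matrix\<close>

definition kernel_carrier :: "'p::prime_card padic_int mat \<Rightarrow> 'p prufer Matrix.vec set" where
  "kernel_carrier A =
     {v \<in> carrier_vec (dim_col A).
        \<forall>i<dim_row A. (\<Sum>j<dim_col A. scale_prufer (A $$ (i, j)) (vec_index v j)) = 0}"

text \<open>The value \<open>v\<^sup>T A w mod \<int>\<^sub>p\<close>, computed with the lifts of \<open>v\<close> and \<open>w\<close> chosen by
  \<open>rep_prufer\<close>. For symmetric \<open>A\<close> and \<open>v\<close>, \<open>w\<close> in the kernel the choice is irrelevant
  (lemma \<open>kernel_pairing_lift\<close>).\<close>

definition kernel_pairing ::
    "'p::prime_card padic_int mat \<Rightarrow> 'p prufer Matrix.vec \<Rightarrow> 'p prufer Matrix.vec \<Rightarrow> 'p prufer" where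
  "kernel_pairing A v w =
     of_padic (scalar_prod (map_vec rep_prufer v) (map_mat to_fract A *\<^sub>v map_vec rep_prufer w))"

lemma sum_in_range_to_fract:
  "(\<And>i. i \<in> I \<Longrightarrow> f i \<in> range (to_fract :: 'p::prime_card padic_int \<Rightarrow> _)) \<Longrightarrow> sum f I \<in> range to_fract"
  by (induction I rule: infinite_finite_induct) (simp_all add: range_to_fract_closed(1,2))

lemma of_padic_sum: "of_padic (sum f I) = (\<Sum>i\<in>I. of_padic (f i))"
  by (induction I rule: infinite_finite_induct)
    (simp_all add: zero_prufer.abs_eq plus_prufer.abs_eq[symmetric])

lemma integral_mult_kernel_lift:
  fixes A :: "'p::prime_card padic_int mat"
  assumes A: "A \<in> carrier_mat k k" and x: "x \<in> carrier_vec k" and y: "y \<in> carrier_vec k"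
    and int: "\<And>i. i < k \<Longrightarrow> vec_index x i \<in> range to_fract"
    and ker: "map_vec of_padic y \<in> kernel_carrier A"
  shows "scalar_prod x (map_mat to_fract A *\<^sub>v y) \<in> range to_fract"
proof -
  have "vec_index (map_mat to_fract A *\<^sub>v y) i \<in> range to_fract" if i: "i < k" for i
  proof -
    have "of_padic (vec_index (map_mat to_fract A *\<^sub>v y) i) =
        (\<Sum>j<k. scale_prufer (A $$ (i, j)) (vec_index (map_vec of_padic y) j))"
      using A y i by (simp add: scalar_prod_def of_padic_sum scale_prufer_of_padic atLeast0LessThan)
    also have "\<dots> = of_padic 0"
      using ker A i by (simp add: kernel_carrier_def zero_prufer.abs_eq)
    finally show ?thesis by (simp add: of_padic_eq_iff)
  qed
  then show ?thesis using int A unfolding scalar_prod_def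
    by (intro sum_in_range_to_fract range_to_fract_closed(4)) auto
qed

lemma kernel_pairing_lift:
  fixes A :: "'p::prime_card padic_int mat"
  assumes A: "A \<in> carrier_mat k k" and sym: "transpose_mat A = A"
    and x: "x \<in> carrier_vec k" and y: "y \<in> carrier_vec k"
    and ker: "map_vec of_padic x \<in> kernel_carrier A" "map_vec of_padic y \<in> kernel_carrier A"
  shows "kernel_pairing A (map_vec of_padic x) (map_vec of_padic y) =
    of_padic (scalar_prod x (map_mat to_fract A *\<^sub>v y))"
proof -
  define B where "B = map_mat to_fract A"
  define x' where "x' = map_vec rep_prufer (map_vec of_padic x)"
  define y' where "y' = map_vec rep_prufer (map_vec of_padic y)"
  have B: "B \<in> carrier_mat k k" using A by (simp add: B_def)
  have symB: "transpose_mat B = B" using sym by (simp add: B_def map_mat_transpose)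
  have x': "x' \<in> carrier_vec k" and y': "y' \<in> carrier_vec k" using x y by (simp_all add: x'_def y'_def)
  have dx: "vec_index (x' - x) i \<in> range to_fract" and dy: "vec_index (y' - y) i \<in> range to_fract" if "i < k" for i
    using that x y unfolding x'_def y'_def
    by (simp_all flip: of_padic_eq_iff add: of_padic_rep_prufer)
  have "map_vec of_padic y' = map_vec of_padic y"
    unfolding y'_def by (rule eq_vecI) (simp_all add: of_padic_rep_prufer)
  then have ker': "map_vec of_padic y' \<in> kernel_carrier A" using ker(2) by simp
  have 1: "scalar_prod (x' - x) (B *\<^sub>v y') \<in> range to_fract"
    unfolding B_def by (rule integral_mult_kernel_lift[OF A _ y' dx ker']) (use x x' in simp_all)
  have 2: "scalar_prod (y' - y) (B *\<^sub>v x) \<in> range to_fract"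
    unfolding B_def by (rule integral_mult_kernel_lift[OF A _ x dy ker(1)]) (use y y' in simp_all)
  have swap: "scalar_prod x (B *\<^sub>v z) = scalar_prod z (B *\<^sub>v x)" if z: "z \<in> carrier_vec k" for z
    using transpose_vec_mult_scalar[OF B z x] symB
      comm_scalar_prod[of "B *\<^sub>v x" k z] B x z by simp
  have "scalar_prod x' (B *\<^sub>v y') - scalar_prod x (B *\<^sub>v y) =
      scalar_prod (x' - x) (B *\<^sub>v y') + scalar_prod (y' - y) (B *\<^sub>v x)"
    using x y x' y' B
    by (simp add: minus_scalar_prod_distrib[of _ k] swap[OF y] swap[OF y'])
  then have "scalar_prod x' (B *\<^sub>v y') - scalar_prod x (B *\<^sub>v y) \<in> range to_fract"
    using range_to_fract_closed(2)[OF 1 2] by simp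
  then show ?thesis
    by (simp add: kernel_pairing_def of_padic_eq_iff B_def x'_def y'_def)
qed

definition kernel_group ::
    "'p::prime_card padic_int mat \<Rightarrow> ('p prufer Matrix.vec, 'p) pairing_group" where
  "kernel_group A =
     \<lparr>carrier = kernel_carrier A, mult = (+), one = 0\<^sub>v (dim_col A), pairing = kernel_pairing A\<rparr>"


section \<open>The random matrix\<close>

text \<open>Rows and columns are indexed from \<open>0\<close>.\<close>

definition sym_haar :: "'w measure \<Rightarrow> (nat \<Rightarrow> nat \<Rightarrow> 'w \<Rightarrow> 'p::prime_card padic_int) \<Rightarrow> bool" where
  "sym_haar M a \<longleftrightarrow>
     prob_space M \<and>
     prob_space.indep_vars M (\<lambda>_. borel) (\<lambda>(i, j). a i j) {(i, j). i \<le> j} \<and>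
     (\<forall>i j. i \<le> j \<longrightarrow> haar_prob_measure (distr M borel (a i j))) \<and>
     (\<forall>i j. \<forall>\<omega>\<in>space M. a j i \<omega> = a i j \<omega>)"

definition corner :: "(nat \<Rightarrow> nat \<Rightarrow> 'w \<Rightarrow> 'r) \<Rightarrow> nat \<Rightarrow> 'w \<Rightarrow> 'r mat" where
  "corner a n \<omega> = Matrix.mat n n (\<lambda>(i, j). a i j \<omega>)"


section \<open>Markov chains\<close>

text \<open>A process \<open>(X\<^sub>n)\<close>, \<open>n \<ge> 1\<close>, almost surely with values in the countable set \<open>S\<close>. The values
  outside \<open>S\<close> taken on a null set are irrelevant. No time homogeneity is required.\<close>

definition markov_chain :: "'w measure \<Rightarrow> 's set \<Rightarrow> (nat \<Rightarrow> 'w \<Rightarrow> 's) \<Rightarrow> bool" where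
  "markov_chain M S X \<longleftrightarrow>
     prob_space M \<and> countable S \<and>
     (\<forall>n\<ge>1. \<forall>s\<in>S. {\<omega> \<in> space M. X n \<omega> = s} \<in> sets M) \<and>
     (\<forall>n\<ge>1. AE \<omega> in M. X n \<omega> \<in> S) \<and>
     (\<forall>n\<ge>1. \<forall>s. (\<forall>i\<in>{1..Suc n}. s i \<in> S) \<longrightarrow>
        \<P>(\<omega> in M. \<forall>i\<in>{1..n}. X i \<omega> = s i) > 0 \<longrightarrow>
        \<P>(\<omega> in M. X (Suc n) \<omega> = s (Suc n) \<bar> \<forall>i\<in>{1..n}. X i \<omega> = s i) =
        \<P>(\<omega> in M. X (Suc n) \<omega> = s (Suc n) \<bar> X n \<omega> = s n))"

end

theory Submission
  imports Defs "Jordan_Normal_Form.Determinant"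
begin

text \<open>Let \<open>A\<close> be a non-singular corner, bordered by the column \<open>b\<close> and the corner entry \<open>c\<close>, and let
  \<open>L = \<int>\<^sub>p\<^sup>n\<close> carry the form \<open>A\<close>. With \<open>x = A\<^sup>-\<^sup>1 b\<close> the bordered matrix is the form on \<open>L \<oplus> \<int>\<^sub>p (x + f)\<close>, where
  \<open>f\<close> is orthogonal to \<open>L\<close> and has norm \<open>d = c - x\<^sup>T A x\<close>. Hence its kernel with pairing depends, up to
  isomorphism, only on the group \<open>ker A\<close> with its pairing, on the class of \<open>x\<close> in \<open>ker A\<close>, and on \<open>d\<close>. Given \<open>A\<close>,
  this class is uniform on \<open>ker A\<close>, and given also \<open>b\<close>, the number \<open>d\<close> is Haar distributed on a coset of
  \<open>\<int>\<^sub>p\<close> which is determined by the class. So the law of the next kernel depends on \<open>A\<close> only through the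
  isomorphism class of \<open>ker A\<close>.\<close>

section \<open>Arithmetic of \<open>p\<close>-adic integers\<close>

text \<open>\<open>ker A\<close> is the discriminant group of \<open>L\<close>: its dual lattice
  modulo \<open>L\<close>, with the induced form. An isomorphism of two such groups is not assumed
  to come from an integral change of basis, so nothing is lifted: an element of the new kernel is
  written as y + t f, where y represents a class in \<open>ker A\<close>; its integrality against x
  + f involves the pairing of y with x only modulo integers, and the isomorphism moves y and keeps
  t. The pair (y, t) is ambiguous by integral multiples of (x, 1) and by \<open>L\<close>, which is
  why the classes of x must correspond.

  The class of x is uniform because b \<mapsto> A^-1 b is an additive surjection onto the finite
  group \<open>ker A\<close> and Haar measure is translation invariant. The number d can be matched
  exactly, since x^T A x modulo integers is the pairing of the class of x with itself, and an
  integral discrepancy is absorbed by translating c.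

  Singular matrices are the obstacle to measurability: the class is shown to be locally constant
  where the determinant is nonzero. All events therefore concern classes in
  \<open>perfect_symmetric_p_groups\<close>, which only non-singular matrices attain.\<close>

lemma padic_eqI:
  assumes "\<And>n. residue x n = residue y n"
  shows "x = (y :: 'p::prime_card padic_int)"
  using assms by (simp add: residue_inject[symmetric] ext)

lemma residue_bounds:
  "0 \<le> residue (x :: 'p::prime_card padic_int) n" "residue x n < int CARD('p) ^ n"
proof -
  have "int CARD('p) ^ n > 0"
    using prime_card[where 'a='p] by (simp add: prime_gt_0_nat)
  then show "0 \<le> residue x n" "residue x n < int CARD('p) ^ n"
    by (metis residue_mod pos_mod_sign, metis residue_mod pos_mod_bound)
qed

lemma residue_of_nat:
  "residue (of_nat m :: 'p::prime_card padic_int) n = int m mod int CARD('p) ^ n"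
  by (induction m)
     (simp_all add: zero_padic_int.rep_eq plus_padic_int.rep_eq one_padic_int.rep_eq mod_simps)

lemma residue_of_nat_power:
  "residue (of_nat m ^ k :: 'p::prime_card padic_int) n = int m ^ k mod int CARD('p) ^ n"
  using residue_of_nat[of "m ^ k" n] by simp

lemma residue_cong_mono:
  fixes x y :: "'p::prime_card padic_int"
  assumes "residue x N = residue y N" "n \<le> N"
  shows "residue x n = residue y n"
  using assms residue_mod_le[of x n "N - n"] residue_mod_le[of y n "N - n"] by simp

lemma residue_diff_eq_0_iff:
  "residue (x - y :: 'p::prime_card padic_int) n = 0 \<longleftrightarrow> residue x n = residue y n"
proof -
  have "residue (x - y) n = 0 \<longleftrightarrow> residue x n mod int CARD('p) ^ n = residue y n mod int CARD('p) ^ n"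
    by (simp add: minus_padic_int.rep_eq mod_eq_dvd_iff dvd_eq_mod_eq_0)
  then show ?thesis by (simp add: residue_mod)
qed

text \<open>Division by \<open>p^n\<close> costs n levels of precision: level k of the quotient is
  read off from level k + n of x.\<close>

lemma prime_power_dvd_iff_residue:
  fixes x :: "'p::prime_card padic_int"
  shows "of_nat CARD('p) ^ n dvd x \<longleftrightarrow> residue x n = 0"
proof
  assume "of_nat CARD('p) ^ n dvd x"
  then obtain y where "x = of_nat CARD('p) ^ n * y" by (rule dvdE)
  then show "residue x n = 0"
    by (simp add: times_padic_int.rep_eq residue_of_nat_power)
next
  let ?p = "int CARD('p)"
  assume x0: "residue x n = 0"
  have p0: "?p > 0" using prime_card[where 'a='p] by (simp add: prime_gt_0_nat)
  define y where "y = (\<lambda>k. residue x (k + n) div ?p ^ n)"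
  have dv: "?p ^ n dvd residue x (k + n)" for k
    using residue_mod_le[of x n k] x0 by (simp add: add.commute dvd_eq_mod_eq_0)
  have xy: "residue x (k + n) = ?p ^ n * y k" for k
    using dv[of k] by (simp add: y_def)
  have y: "y k = y (Suc k) mod ?p ^ k" for k
  proof -
    have "?p ^ n * y k = (?p ^ n * y (Suc k)) mod (?p ^ n * ?p ^ k)"
      using residue_Suc[of x "k + n"] xy[of k] xy[of "Suc k"] by (simp add: power_add mult.commute)
    also have "\<dots> = ?p ^ n * (y (Suc k) mod ?p ^ k)"
      by (rule mult_mod_right[symmetric])
    finally show ?thesis using p0 by (metis mult_left_cancel zero_less_power order_less_irrefl)
  qed
  define z :: "'p padic_int" where "z = Abs_padic_int y"
  have rz: "residue z = y" unfolding z_def by (rule Abs_padic_int_inverse) (use y in blast)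
  have "x = of_nat CARD('p) ^ n * z"
  proof (rule padic_eqI)
    fix k
    have "residue (of_nat CARD('p) ^ n * z) k = ?p ^ n * y k mod ?p ^ k"
      by (simp add: times_padic_int.rep_eq rz residue_of_nat_power mod_simps)
    also have "\<dots> = residue x (k + n) mod ?p ^ k" by (simp add: xy)
    also have "\<dots> = residue x k" by (rule residue_mod_le)
    finally show "residue x k = residue (of_nat CARD('p) ^ n * z) k" by simp
  qed
  then show "of_nat CARD('p) ^ n dvd x" by simp
qed

text \<open>Inverses modulo \<open>p^n\<close> exist at every level. Normalised to representatives
  below \<open>p^n\<close> they are unique, hence compatible, and so form a p-adic integer.\<close>

lemma unit_padic_int:
  fixes x :: "'p::prime_card padic_int"
  assumes "residue x 1 \<noteq> 0"
  shows "x dvd 1"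
proof -
  let ?p = "int CARD('p)"
  have p: "prime ?p" using prime_card[where 'a='p] by simp
  have cop: "coprime (residue x n) (?p ^ n)" for n
  proof (cases n)
    case (Suc m)
    have "\<not> ?p dvd residue x n"
      using residue_mod_le[of x 1 m] assms by (auto simp: Suc dvd_eq_mod_eq_0)
    then have "coprime ?p (residue x n)" by (rule prime_imp_coprime[OF p])
    then show ?thesis by (simp add: coprime_commute)
  qed auto
  have "\<exists>y. 0 \<le> y \<and> y < ?p ^ n \<and> (residue x n * y) mod ?p ^ n = 1 mod ?p ^ n" for n
  proof -
    obtain y where "[residue x n * y = 1] (mod ?p ^ n)"
      using cong_solve_coprime_int[OF cop] by blast
    moreover have "?p ^ n > 0" using p by (simp add: prime_gt_0_int)
    ultimately show ?thesis
      by (intro exI[of _ "y mod ?p ^ n"]) (simp add: cong_def mod_simps)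
  qed
  then obtain y where y: "\<And>n. 0 \<le> y n" "\<And>n. y n < ?p ^ n"
      "\<And>n. (residue x n * y n) mod ?p ^ n = 1 mod ?p ^ n" by metis
  have "y n = y (Suc n) mod ?p ^ n" for n
  proof -
    have "[residue x (Suc n) * y (Suc n) = 1] (mod ?p ^ n)"
      using y(3)[of "Suc n"] by (metis cong_def mod_mod_pow)
    moreover have "[residue x (Suc n) = residue x n] (mod ?p ^ n)"
      using residue_Suc[of x n] by (simp add: cong_def)
    ultimately have "[residue x n * y (Suc n) = 1] (mod ?p ^ n)"
      by (metis cong_scalar_right cong_sym cong_trans)
    moreover have "[residue x n * y n = 1] (mod ?p ^ n)"
      using y(3)[of n] by (simp add: cong_def)
    ultimately have "[residue x n * y n = residue x n * y (Suc n)] (mod ?p ^ n)"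
      by (metis cong_sym cong_trans)
    then have "[y n = y (Suc n)] (mod ?p ^ n)"
      using cop by (simp add: cong_mult_lcancel)
    then show ?thesis using y(1,2)[of n] by (simp add: cong_def)
  qed
  then have res: "residue (Abs_padic_int y :: 'p padic_int) = y"
    by (intro Abs_padic_int_inverse) blast
  have "x * Abs_padic_int y = 1"
    by (rule padic_eqI) (simp add: times_padic_int.rep_eq one_padic_int.rep_eq res y(3))
  then show ?thesis by (metis dvd_triv_left)
qed

lemma not_prime_dvd_one: "\<not> of_nat CARD('p) dvd (1 :: 'p::prime_card padic_int)"
  using prime_power_dvd_iff_residue[of 1 "1 :: 'p padic_int"] prime_card[where 'a='p]
  by (simp add: one_padic_int.rep_eq prime_gt_Suc_0_nat)

lemma of_nat_CARD_neq_0: "(of_nat CARD('p) :: 'p::prime_card padic_int) \<noteq> 0"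
proof
  assume "(of_nat CARD('p) :: 'p padic_int) = 0"
  \<comment> \<open>Level 1 does not separate p from 0, but level 2 does, because p < p^2.\<close>
  then have "residue (of_nat CARD('p) :: 'p padic_int) 2 = 0" by (simp add: zero_padic_int.rep_eq)
  then have "CARD('p) mod CARD('p) ^ 2 = 0" unfolding residue_of_nat by (metis of_nat_0_eq_iff of_nat_mod of_nat_power)
  moreover have "CARD('p) < CARD('p) ^ 2"
    using prime_card[where 'a='p] by (simp add: power2_eq_square prime_gt_Suc_0_nat prime_gt_0_nat)
  ultimately show False using prime_card[where 'a='p] by simp
qed

lemma unit_one_plus_prime_mult:
  "(1 + of_nat CARD('p) * y :: 'p::prime_card padic_int) dvd 1"
proof (rule unit_padic_int, rule notI)
  assume "residue (1 + of_nat CARD('p) * y :: 'p padic_int) 1 = 0"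
  then have "of_nat CARD('p) ^ 1 dvd (1 + of_nat CARD('p) * y)"
    unfolding prime_power_dvd_iff_residue .
  then have "of_nat CARD('p) dvd (1 :: 'p padic_int)"
    by (metis dvd_add_left_iff dvd_triv_left power_one_right)
  then show False using not_prime_dvd_one by blast
qed

text \<open>After removing the largest power of p from x a unit remains. Hence every nonzero
  determinant can serve as a denominator in the guise of a power of p.\<close>

lemma dvd_prime_power:
  fixes x :: "'p::prime_card padic_int"
  assumes "x \<noteq> 0"
  obtains k where "x dvd of_nat CARD('p) ^ k"
proof -
  let ?p = "of_nat CARD('p) :: 'p padic_int"
  have "\<exists>n. residue x n \<noteq> 0" using assms padic_eqI[of x 0] by (auto simp: zero_padic_int.rep_eq)
  then have ex: "\<exists>n. \<not> ?p ^ n dvd x" by (simp add: prime_power_dvd_iff_residue)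
  \<comment> \<open>The least exponent that fails, one more than the valuation of x.\<close>
  define k where "k = (LEAST n. \<not> ?p ^ n dvd x)"
  have k: "\<not> ?p ^ k dvd x" unfolding k_def by (rule LeastI_ex[OF ex])
  then obtain m where m: "k = Suc m" by (cases k) auto
  have "?p ^ m dvd x" using not_less_Least[of m "\<lambda>n. \<not> ?p ^ n dvd x"] m k_def by auto
  then obtain u where u: "x = ?p ^ m * u" by (elim dvdE)
  have "\<not> ?p ^ 1 dvd u" using k unfolding m u by (auto simp: mult.assoc elim!: dvdE)
  then have "u dvd 1" unfolding prime_power_dvd_iff_residue by (rule unit_padic_int)
  then have "x dvd ?p ^ m * 1" unfolding u by (rule mult_dvd_mono[OF dvd_refl])
  then show ?thesis using that by simp
qed

section \<open>The group \<open>\<rat>\<^sub>p / \<int>\<^sub>p\<close> and its torsion\<close>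

abbreviation Zp :: "'p::prime_card padic set" where
  "Zp \<equiv> range to_fract"

lemma Zp_0 [simp]: "0 \<in> Zp" by (rule range_to_fract_closed)
lemma Zp_to_fract [simp]: "to_fract z \<in> Zp" by simp
lemma Zp_1 [simp]: "1 \<in> Zp"
  using Zp_to_fract[of 1] unfolding to_fract_1 .
lemma Zp_add [intro]: "x \<in> Zp \<Longrightarrow> y \<in> Zp \<Longrightarrow> x + y \<in> Zp" by (rule range_to_fract_closed)
lemma Zp_minus [intro]: "x \<in> Zp \<Longrightarrow> - x \<in> Zp" by (rule range_to_fract_closed)
lemma Zp_mult [intro]: "x \<in> Zp \<Longrightarrow> y \<in> Zp \<Longrightarrow> x * y \<in> Zp" by (rule range_to_fract_closed)
lemma Zp_sum [intro]: "(\<And>i. i \<in> I \<Longrightarrow> f i \<in> Zp) \<Longrightarrow> sum f I \<in> Zp" by (rule sum_in_range_to_fract)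
lemma Zp_diff [intro]: "x \<in> Zp \<Longrightarrow> y \<in> Zp \<Longrightarrow> x - y \<in> Zp"
  using Zp_add[OF _ Zp_minus, of x y] by simp

lemma Zp_cong:
  assumes "x - y \<in> Zp"
  shows "x \<in> Zp \<longleftrightarrow> y \<in> Zp"
proof
  show "y \<in> Zp" if "x \<in> Zp" using Zp_diff[OF that assms] by simp
  show "x \<in> Zp" if "y \<in> Zp" using Zp_add[OF assms that] by simp
qed

lemma of_padic_0 [simp]: "of_padic 0 = 0" by (simp add: zero_prufer.abs_eq)
lemma of_padic_add: "of_padic (x + y) = of_padic x + of_padic y" by (simp add: plus_prufer.abs_eq)
lemma of_padic_diff: "of_padic (x - y) = of_padic x - of_padic y" by (simp add: minus_prufer.abs_eq)
lemma of_padic_eq_0_iff: "of_padic x = 0 \<longleftrightarrow> x \<in> Zp"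
  using of_padic_eq_iff[of x 0] by simp

lemma of_padic_cases: obtains x where "q = of_padic x"
  using of_padic_rep_prufer[of q] by metis

lemma scale_prufer_add_left: "scale_prufer (a + b) q = scale_prufer a q + scale_prufer b q"
  by (simp add: scale_prufer_def of_padic_add[symmetric] distrib_right)

lemma scale_prufer_add_right: "scale_prufer a (q + r) = scale_prufer a q + scale_prufer a r"
proof -
  obtain x y where "q = of_padic x" "r = of_padic y" by (metis of_padic_cases)
  then show ?thesis by (simp add: of_padic_add[symmetric] scale_prufer_of_padic distrib_left)
qed

lemma scale_prufer_mult: "scale_prufer (a * b) q = scale_prufer a (scale_prufer b q)"
proof -
  obtain x where "q = of_padic x" by (rule of_padic_cases)
  then show ?thesis by (simp add: scale_prufer_of_padic mult.assoc)
qed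

lemma scale_prufer_0 [simp]: "scale_prufer 0 q = 0" "scale_prufer a 0 = 0"
  using scale_prufer_add_left[of 0 0 q] scale_prufer_add_right[of a 0 0] by simp_all

lemma scale_prufer_1 [simp]: "scale_prufer 1 q = q"
  by (simp add: scale_prufer_def of_padic_rep_prufer)

lemma padic_denominator:
  fixes x :: "'p::prime_card padic"
  obtains k where "to_fract (of_nat CARD('p) ^ k) * x \<in> Zp"
proof -
  obtain a b where x: "x = Fract a b" and b: "b \<noteq> 0" by (rule Fract_cases)
  obtain k c where "of_nat CARD('p) ^ k = b * c" using dvd_prime_power[OF b] by (metis dvdE)
  then have "to_fract (of_nat CARD('p) ^ k) * x = to_fract (c * a)"
    using b by (simp add: x Fract_conv_to_fract)
  then have "to_fract (of_nat CARD('p) ^ k) * x \<in> Zp" by (simp only: rangeI)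
  then show ?thesis by (rule that)
qed

abbreviation prime_power_torsion :: "nat \<Rightarrow> 'p::prime_card prufer set" where
  "prime_power_torsion k \<equiv> {q. scale_prufer (of_nat CARD('p) ^ k) q = 0}"

lemma residue_approx:
  fixes z :: "'p::prime_card padic_int"
  obtains c where "z = of_nat (nat (residue z k)) + c * of_nat CARD('p) ^ k"
proof -
  have "residue (of_nat (nat (residue z k)) :: 'p padic_int) k = residue z k"
    unfolding residue_of_nat using residue_bounds(1)[of z k] by (simp add: residue_mod)
  then have "of_nat CARD('p) ^ k dvd z - of_nat (nat (residue z k))"
    by (simp add: prime_power_dvd_iff_residue residue_diff_eq_0_iff)
  then obtain c where "z - of_nat (nat (residue z k)) = of_nat CARD('p) ^ k * c" by (rule dvdE)
  then show ?thesis by (intro that[of c]) (simp add: algebra_simps)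
qed

lemma scale_prufer_residue:
  fixes q :: "'p::prime_card prufer"
  assumes "scale_prufer (of_nat CARD('p) ^ k) q = 0"
  shows "scale_prufer z q = scale_prufer (of_nat (nat (residue z k))) q"
proof -
  obtain c where c: "z = of_nat (nat (residue z k)) + c * of_nat CARD('p) ^ k"
    by (rule residue_approx)
  show ?thesis
    by (subst c) (simp add: scale_prufer_add_left scale_prufer_mult assms)
qed

text \<open>Multiplication by \<open>p^k\<close> turns a lift of a torsion class into a p-adic
  integer, and the residue of that integer modulo \<open>p^k\<close> is the numerator.\<close>

lemma bij_betw_prime_power_torsion:
  "bij_betw (\<lambda>m. of_padic (to_fract (of_nat m) / to_fract (of_nat CARD('p) ^ k)))
     {..<CARD('p) ^ k} (prime_power_torsion k :: 'p::prime_card prufer set)"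
proof (rule bij_betw_imageI)
  let ?P = "to_fract (of_nat CARD('p) ^ k) :: 'p padic"
  have P0: "?P \<noteq> 0" using of_nat_CARD_neq_0[where 'p='p] by (simp del: of_nat_power)
  show "inj_on (\<lambda>m. of_padic (to_fract (of_nat m) / ?P)) {..<CARD('p) ^ k}"
  proof (rule inj_onI)
    fix m l assume ml: "m \<in> {..<CARD('p) ^ k}" "l \<in> {..<CARD('p) ^ k}"
      and "of_padic (to_fract (of_nat m) / ?P) = of_padic (to_fract (of_nat l) / ?P)"
    then obtain z where "to_fract (of_nat m) / ?P - to_fract (of_nat l) / ?P = to_fract z"
      by (auto simp: of_padic_eq_iff)
    then have "(to_fract (of_nat m) - to_fract (of_nat l)) / ?P = to_fract z"
      by (simp only: diff_divide_distrib)
    then have "to_fract (of_nat m) - to_fract (of_nat l) = ?P * to_fract z"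
      using P0 by (metis nonzero_mult_div_cancel_left times_divide_eq_right)
    then have "to_fract (of_nat m - of_nat l) = to_fract (of_nat CARD('p) ^ k * z)"
      by (simp only: to_fract_diff to_fract_mult)
    then have "(of_nat m - of_nat l :: 'p padic_int) = of_nat CARD('p) ^ k * z"
      by (simp only: to_fract_eq_iff)
    then have "of_nat CARD('p) ^ k dvd (of_nat m - of_nat l :: 'p padic_int)" by simp
    then have "int m mod int (CARD('p) ^ k) = int l mod int (CARD('p) ^ k)"
      by (simp add: prime_power_dvd_iff_residue residue_diff_eq_0_iff residue_of_nat)
    then show "m = l" using ml by (metis lessThan_iff mod_less of_nat_eq_iff of_nat_mod)
  qed
  show "(\<lambda>m. of_padic (to_fract (of_nat m) / ?P)) ` {..<CARD('p) ^ k} = prime_power_torsion k"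
  proof (intro equalityI subsetI)
    fix q assume "q \<in> (\<lambda>m. of_padic (to_fract (of_nat m) / ?P)) ` {..<CARD('p) ^ k}"
    then obtain m where q: "q = of_padic (to_fract (of_nat m) / ?P)" by blast
    have "?P * (to_fract (of_nat m) / ?P) \<in> Zp" using P0 by simp
    then show "q \<in> prime_power_torsion k"
      unfolding q by (simp only: mem_Collect_eq scale_prufer_of_padic of_padic_eq_0_iff)
  next
    fix q :: "'p prufer" assume "q \<in> prime_power_torsion k"
    then obtain z where z: "?P * rep_prufer q = to_fract z"
      unfolding mem_Collect_eq scale_prufer_def of_padic_eq_0_iff by blast
    obtain c where c: "z = of_nat (nat (residue z k)) + c * of_nat CARD('p) ^ k"
      by (rule residue_approx)
    let ?m = "nat (residue z k)"
    have "rep_prufer q = to_fract z / ?P" using z P0 by (metis nonzero_mult_div_cancel_left)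
    also have "to_fract z = to_fract (of_nat ?m) + to_fract c * ?P"
      using c by (metis to_fract_add to_fract_mult)
    also have "\<dots> / ?P = to_fract (of_nat ?m) / ?P + to_fract c"
      unfolding add_divide_distrib using P0 by (subst nonzero_mult_div_cancel_right) auto
    finally have "rep_prufer q = to_fract (of_nat ?m) / ?P + to_fract c" .
    then have "of_padic (rep_prufer q) = of_padic (to_fract (of_nat ?m) / ?P)"
      by (simp add: of_padic_eq_iff)
    moreover have "?m < CARD('p) ^ k"
      using residue_bounds[of z k] by (simp add: nat_less_iff)
    ultimately show "q \<in> (\<lambda>m. of_padic (to_fract (of_nat m) / ?P)) ` {..<CARD('p) ^ k}"
      unfolding of_padic_rep_prufer by blast
  qed
qed

lemma card_prime_power_torsion:
  "card (prime_power_torsion k :: 'p::prime_card prufer set) = CARD('p) ^ k"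
  using bij_betw_same_card[OF bij_betw_prime_power_torsion[where 'p='p, of k]] by simp

lemma finite_prime_power_torsion: "finite (prime_power_torsion k :: 'p::prime_card prufer set)"
  using bij_betw_finite[OF bij_betw_prime_power_torsion[where 'p='p, of k]] by simp

text \<open>Every p-adic number has a power of p as denominator, so the finite torsion subgroups
  exhaust the group. Countability makes the tables of pairing values on finite groups countable in
  number.\<close>

lemma countable_prufer: "countable (UNIV :: 'p::prime_card prufer set)"
proof -
  have "(UNIV :: 'p prufer set) = (\<Union>k. prime_power_torsion k)"
  proof (intro equalityI subsetI)
    fix q :: "'p prufer"
    obtain k where "to_fract (of_nat CARD('p) ^ k) * rep_prufer q \<in> Zp"
      by (rule padic_denominator)
    then have "q \<in> prime_power_torsion k"
      unfolding mem_Collect_eq scale_prufer_def of_padic_eq_0_iff .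
    then show "q \<in> (\<Union>k. prime_power_torsion k)" by blast
  qed simp
  moreover have "countable (\<Union>k. prime_power_torsion k :: 'p prufer set)"
    by (intro countable_UN countable_finite[OF finite_prime_power_torsion]) simp
  ultimately show ?thesis by simp
qed

section \<open>Kernels in terms of lifts\<close>

text \<open>Lifts to \<open>\<rat>\<^sub>p\<^sup>n\<close> are kept as functions on all of nat of
  which only the first n values count, which spares dimension conditions in \<open>lin\<close> and
  \<open>bil\<close>.\<close>

definition kvec :: "nat \<Rightarrow> (nat \<Rightarrow> 'p::prime_card padic) \<Rightarrow> 'p prufer Matrix.vec" where
  "kvec n x = Matrix.vec n (\<lambda>i. of_padic (x i))"

definition lin :: "nat \<Rightarrow> (nat \<Rightarrow> nat \<Rightarrow> 'p::prime_card padic_int) \<Rightarrow> (nat \<Rightarrow> 'p padic) \<Rightarrow> nat \<Rightarrow> 'p padic" where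
  "lin n A x i = (\<Sum>j<n. to_fract (A i j) * x j)"

definition bil :: "nat \<Rightarrow> (nat \<Rightarrow> nat \<Rightarrow> 'p::prime_card padic_int) \<Rightarrow> (nat \<Rightarrow> 'p padic) \<Rightarrow> (nat \<Rightarrow> 'p padic) \<Rightarrow> 'p padic" where
  "bil n A x y = (\<Sum>i<n. x i * lin n A y i)"

abbreviation sqmat :: "nat \<Rightarrow> (nat \<Rightarrow> nat \<Rightarrow> 'a) \<Rightarrow> 'a mat" where
  "sqmat n A \<equiv> Matrix.mat n n (\<lambda>(i, j). A i j)"

abbreviation ker_grp :: "nat \<Rightarrow> (nat \<Rightarrow> nat \<Rightarrow> 'p::prime_card padic_int) \<Rightarrow> ('p prufer Matrix.vec, 'p) pairing_group" where
  "ker_grp n A \<equiv> kernel_group (sqmat n A)"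

lemma kvec_carrier [simp]: "kvec n x \<in> carrier_vec n" "dim_vec (kvec n x) = n"
  by (simp_all add: kvec_def)

lemma kvec_index [simp]: "i < n \<Longrightarrow> vec_index (kvec n x) i = of_padic (x i)"
  by (simp add: kvec_def)

lemma kvec_rep_prufer:
  assumes "v \<in> carrier_vec n"
  shows "kvec n (\<lambda>i. rep_prufer (vec_index v i)) = v"
  using assms by (intro eq_vecI) (simp_all add: of_padic_rep_prufer)

lemma kvec_cases:
  assumes "v \<in> carrier_vec n"
  obtains x where "v = kvec n x"
  using kvec_rep_prufer[OF assms] by metis

lemma kvec_eq_iff: "kvec n x = kvec n y \<longleftrightarrow> (\<forall>i<n. x i - y i \<in> Zp)"
  by (auto simp: vec_eq_iff of_padic_eq_iff)

lemma kvec_add: "kvec n x + kvec n y = kvec n (\<lambda>i. x i + y i)"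
  by (intro eq_vecI) (simp_all add: of_padic_add)

lemma kvec_diff: "kvec n x - kvec n y = kvec n (\<lambda>i. x i - y i)"
  by (intro eq_vecI) (simp_all add: of_padic_diff)

lemma kvec_0: "0\<^sub>v n = kvec n (\<lambda>_. 0)"
  by (intro eq_vecI) simp_all

lemma map_scale_kvec: "map_vec (scale_prufer z) (kvec n x) = kvec n (\<lambda>i. to_fract z * x i)"
  by (intro eq_vecI) (simp_all add: scale_prufer_of_padic)

lemma lin_add: "lin n A (\<lambda>i. x i + y i) k = lin n A x k + lin n A y k"
  by (simp add: lin_def distrib_left sum.distrib)

lemma lin_diff: "lin n A (\<lambda>i. x i - y i) k = lin n A x k - lin n A y k"
  by (simp add: lin_def right_diff_distrib sum_subtractf)

lemma lin_scale: "lin n A (\<lambda>i. c * x i) k = c * lin n A x k"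
  by (simp add: lin_def sum_distrib_left mult.left_commute)

lemma lin_cong: "(\<And>i. i < n \<Longrightarrow> x i = y i) \<Longrightarrow> lin n A x k = lin n A y k"
  by (simp add: lin_def)

lemma bil_add_right: "bil n A z (\<lambda>i. x i + y i) = bil n A z x + bil n A z y"
  by (simp add: bil_def lin_add distrib_left sum.distrib)

lemma bil_diff_left: "bil n A (\<lambda>i. x i - y i) z = bil n A x z - bil n A y z"
  by (simp add: bil_def left_diff_distrib sum_subtractf)

lemma bil_diff_right: "bil n A z (\<lambda>i. x i - y i) = bil n A z x - bil n A z y"
  by (simp add: bil_def lin_diff right_diff_distrib sum_subtractf)

lemma bil_scale_left: "bil n A (\<lambda>i. c * x i) z = c * bil n A x z"
  by (simp add: bil_def sum_distrib_left mult.assoc)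

lemma bil_scale_right: "bil n A z (\<lambda>i. c * x i) = c * bil n A z x"
  by (simp add: bil_def lin_scale sum_distrib_left mult.left_commute)

lemma bil_cong: "(\<And>i. i < n \<Longrightarrow> x i = x' i) \<Longrightarrow> (\<And>i. i < n \<Longrightarrow> y i = y' i) \<Longrightarrow> bil n A x y = bil n A x' y'"
  by (simp add: bil_def cong: lin_cong)

lemma bil_commute:
  assumes "\<And>i j. A i j = A j i"
  shows "bil n A x y = bil n A y x"
proof -
  have "bil n A x y = (\<Sum>i<n. \<Sum>j<n. x i * (to_fract (A i j) * y j))"
    by (simp add: bil_def lin_def sum_distrib_left)
  also have "\<dots> = (\<Sum>j<n. \<Sum>i<n. x i * (to_fract (A i j) * y j))" by (rule sum.swap)
  also have "\<dots> = (\<Sum>j<n. \<Sum>i<n. y j * (to_fract (A j i) * x i))"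
    by (intro sum.cong refl, subst assms) (simp add: mult_ac)
  also have "\<dots> = bil n A y x" by (simp add: bil_def lin_def sum_distrib_left)
  finally show ?thesis .
qed

lemma kernel_group_simps:
  "carrier (kernel_group A) = kernel_carrier A" "mult (kernel_group A) = (+)"
  "one (kernel_group A) = 0\<^sub>v (dim_col A)" "pairing (kernel_group A) = kernel_pairing A"
  by (simp_all add: kernel_group_def)

lemma kvec_in_kernel_iff:
  "kvec n x \<in> kernel_carrier (sqmat n A) \<longleftrightarrow> (\<forall>i<n. lin n A x i \<in> Zp)"
proof -
  have "(\<Sum>j<n. scale_prufer (sqmat n A $$ (i, j)) (vec_index (kvec n x) j)) = of_padic (lin n A x i)" if "i < n" for i
    using that by (simp add: lin_def of_padic_sum scale_prufer_of_padic)
  then show ?thesis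
    by (simp add: kernel_carrier_def of_padic_eq_0_iff)
qed

lemma kernel_carrier_vec: "v \<in> kernel_carrier (sqmat n A) \<Longrightarrow> v \<in> carrier_vec n"
  by (simp add: kernel_carrier_def)

lemma kernel_cases:
  assumes "v \<in> kernel_carrier (sqmat n A)"
  obtains x where "v = kvec n x" "\<And>i. i < n \<Longrightarrow> lin n A x i \<in> Zp"
  using assms kvec_cases[OF kernel_carrier_vec[OF assms]] kvec_in_kernel_iff by metis

text \<open>From here on the pairing is computed with arbitrary lifts instead of those picked by
  \<open>rep_prufer\<close>.\<close>

lemma kernel_pairing_kvec:
  assumes "\<And>i j. A i j = A j i"
    and "kvec n x \<in> kernel_carrier (sqmat n A)" "kvec n y \<in> kernel_carrier (sqmat n A)"
  shows "kernel_pairing (sqmat n A) (kvec n x) (kvec n y) = of_padic (bil n A x y)"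
proof -
  have kv: "kvec n z = map_vec of_padic (Matrix.vec n z)" for z :: "nat \<Rightarrow> 'a padic"
    by (intro eq_vecI) simp_all
  have "kernel_pairing (sqmat n A) (kvec n x) (kvec n y) =
     of_padic (scalar_prod (Matrix.vec n x) (map_mat to_fract (sqmat n A) *\<^sub>v Matrix.vec n y))"
    unfolding kv
    by (rule kernel_pairing_lift) (use assms in \<open>auto simp: kv[symmetric] intro!: eq_matI\<close>)
  also have "scalar_prod (Matrix.vec n x) (map_mat to_fract (sqmat n A) *\<^sub>v Matrix.vec n y) = bil n A x y"
    by (simp add: scalar_prod_def bil_def lin_def atLeast0LessThan)
  finally show ?thesis .
qed

lemma kernel_closed:
  assumes "v \<in> kernel_carrier (sqmat n A)" "w \<in> kernel_carrier (sqmat n A)"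
  shows "v + w \<in> kernel_carrier (sqmat n A)" "v - w \<in> kernel_carrier (sqmat n A)"
    and "map_vec (scale_prufer z) v \<in> kernel_carrier (sqmat n A)"
proof -
  obtain x y where x: "v = kvec n x" "\<And>i. i < n \<Longrightarrow> lin n A x i \<in> Zp"
    and y: "w = kvec n y" "\<And>i. i < n \<Longrightarrow> lin n A y i \<in> Zp"
    using assms by (metis kernel_cases)
  show "v + w \<in> kernel_carrier (sqmat n A)" "v - w \<in> kernel_carrier (sqmat n A)"
    "map_vec (scale_prufer z) v \<in> kernel_carrier (sqmat n A)"
    using x y
    by (auto simp: kvec_add kvec_diff map_scale_kvec kvec_in_kernel_iff lin_add lin_diff lin_scale
        intro!: Zp_add Zp_diff Zp_mult)
qed

lemma kernel_zero: "0\<^sub>v n \<in> kernel_carrier (sqmat n A)"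
  by (simp add: kvec_0 kvec_in_kernel_iff lin_def)

lemma comm_group_ker_grp: "comm_group (ker_grp n A)"
proof (rule comm_groupI; simp only: kernel_group_simps)
  let ?K = "kernel_carrier (sqmat n A)"
  show "x + y \<in> ?K" if "x \<in> ?K" "y \<in> ?K" for x y using kernel_closed(1)[OF that] .
  show "0\<^sub>v (dim_col (sqmat n A)) \<in> ?K" by (simp add: kernel_zero)
  show "x + y + z = x + (y + z)" if "x \<in> ?K" "y \<in> ?K" "z \<in> ?K" for x y z
    using that[THEN kernel_carrier_vec] by (simp add: assoc_add_vec)
  show "x + y = y + x" if "x \<in> ?K" "y \<in> ?K" for x y
    using that[THEN kernel_carrier_vec] by (rule comm_add_vec)
  show "0\<^sub>v (dim_col (sqmat n A)) + x = x" if "x \<in> ?K" for x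
    using kernel_carrier_vec[OF that] by simp
  show "\<exists>y\<in>?K. y + x = 0\<^sub>v (dim_col (sqmat n A))" if "x \<in> ?K" for x
  proof
    show "0\<^sub>v n - x \<in> ?K" by (rule kernel_closed(2)[OF kernel_zero that])
    show "0\<^sub>v n - x + x = 0\<^sub>v (dim_col (sqmat n A))"
      using kernel_carrier_vec[OF that] by (intro eq_vecI) auto
  qed
qed

section \<open>Non-singular matrices\<close>

lemma lin_sum: "lin n A (\<lambda>k. \<Sum>j\<in>J. c j * y j k) i = (\<Sum>j\<in>J. c j * lin n A (y j) i)"
  unfolding lin_def sum_distrib_left by (subst sum.swap) (simp add: mult.left_commute)

lemma adjugate:
  fixes A :: "nat \<Rightarrow> nat \<Rightarrow> 'a::comm_ring_1"
  obtains B where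
    "\<And>i j. i < n \<Longrightarrow> j < n \<Longrightarrow> (\<Sum>k<n. A i k * B k j) = (if i = j then Determinant.det (sqmat n A) else 0)"
    "\<And>i j. i < n \<Longrightarrow> j < n \<Longrightarrow> (\<Sum>k<n. B i k * A k j) = (if i = j then Determinant.det (sqmat n A) else 0)"
proof
  have c: "sqmat n A \<in> carrier_mat n n" by simp
  note adj = adj_mat[OF c]
  fix i j assume ij: "i < n" "j < n"
  have "(sqmat n A * adj_mat (sqmat n A)) $$ (i, j) = (\<Sum>k<n. A i k * adj_mat (sqmat n A) $$ (k, j))"
    using ij adj(1) by (simp add: scalar_prod_def atLeast0LessThan)
  then show "(\<Sum>k<n. A i k * adj_mat (sqmat n A) $$ (k, j)) = (if i = j then Determinant.det (sqmat n A) else 0)"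
    using ij by (cases "i = j") (simp_all add: adj(2))
  have "(adj_mat (sqmat n A) * sqmat n A) $$ (i, j) = (\<Sum>k<n. adj_mat (sqmat n A) $$ (i, k) * A k j)"
    using ij adj(1) by (simp add: scalar_prod_def atLeast0LessThan)
  then show "(\<Sum>k<n. adj_mat (sqmat n A) $$ (i, k) * A k j) = (if i = j then Determinant.det (sqmat n A) else 0)"
    using ij by (cases "i = j") (simp_all add: adj(3))
qed

text \<open>Cramer's rule: the adjugate applied to A x gives det(A) x. Integrality of A x therefore
  bounds the denominators of x by the determinant.\<close>

lemma det_times_kernel:
  fixes A :: "nat \<Rightarrow> nat \<Rightarrow> 'p::prime_card padic_int"
  obtains B where
    "\<And>i j. i < n \<Longrightarrow> j < n \<Longrightarrow> (\<Sum>k<n. A i k * B k j) = (if i = j then Determinant.det (sqmat n A) else 0)"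
    "\<And>x i. i < n \<Longrightarrow> to_fract (Determinant.det (sqmat n A)) * x i = (\<Sum>k<n. lin n A x k * to_fract (B i k))"
proof -
  let ?D = "Determinant.det (sqmat n A)"
  obtain B where AB: "\<And>i j. i < n \<Longrightarrow> j < n \<Longrightarrow> (\<Sum>k<n. A i k * B k j) = (if i = j then ?D else 0)"
    and BA: "\<And>i j. i < n \<Longrightarrow> j < n \<Longrightarrow> (\<Sum>k<n. B i k * A k j) = (if i = j then ?D else 0)"
    by (rule adjugate[of n A]) blast
  have "to_fract ?D * x i = (\<Sum>k<n. lin n A x k * to_fract (B i k))" if i: "i < n" for x i
  proof -
    have "(\<Sum>k<n. lin n A x k * to_fract (B i k)) = (\<Sum>k<n. \<Sum>j<n. to_fract (B i k * A k j) * x j)"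
      by (simp add: lin_def sum_distrib_left mult_ac)
    also have "\<dots> = (\<Sum>j<n. to_fract (\<Sum>k<n. B i k * A k j) * x j)"
      by (subst sum.swap) (simp add: sum_distrib_right)
    also have "\<dots> = (\<Sum>j<n. to_fract (if i = j then ?D else 0) * x j)"
      using i by (intro sum.cong refl) (simp only: BA lessThan_iff)
    also have "\<dots> = (\<Sum>j<n. if i = j then to_fract ?D * x j else 0)"
      by (intro sum.cong) auto
    also have "\<dots> = to_fract ?D * x i" using i by simp
    finally show ?thesis by simp
  qed
  with AB show ?thesis by (rule that)
qed

text \<open>\<open>y j\<close> is column j of A^-1, which is the dual basis for the form A. When A x
  is integral, the second property writes x as an integral combination of it.\<close>

lemma inverse_matrix:
  fixes A :: "nat \<Rightarrow> nat \<Rightarrow> 'p::prime_card padic_int"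
  assumes D: "Determinant.det (sqmat n A) \<noteq> 0"
  obtains y where
    "\<And>i j. i < n \<Longrightarrow> j < n \<Longrightarrow> lin n A (y j) i = (if i = j then 1 else 0)"
    "\<And>x i. i < n \<Longrightarrow> x i = (\<Sum>j<n. lin n A x j * y j i)"
proof -
  let ?D = "Determinant.det (sqmat n A)"
  obtain B where AB: "\<And>i j. i < n \<Longrightarrow> j < n \<Longrightarrow> (\<Sum>k<n. A i k * B k j) = (if i = j then ?D else 0)"
    and BA: "\<And>x i. i < n \<Longrightarrow> to_fract ?D * x i = (\<Sum>k<n. lin n A x k * to_fract (B i k))"
    by (rule det_times_kernel[of n A]) blast
  define y where "y j i = to_fract (B i j) / to_fract ?D" for j i
  have D': "to_fract ?D \<noteq> 0" using D by simp
  have "lin n A (y j) i = (if i = j then 1 else 0)" if "i < n" "j < n" for i j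
  proof -
    have "lin n A (y j) i = to_fract (\<Sum>k<n. A i k * B k j) / to_fract ?D"
      by (simp add: lin_def y_def sum_divide_distrib)
    then show ?thesis using D' that by (simp only: AB) simp
  qed
  moreover have "x i = (\<Sum>j<n. lin n A x j * y j i)" if "i < n" for x i
  proof -
    have "(\<Sum>j<n. lin n A x j * y j i) = (\<Sum>k<n. lin n A x k * to_fract (B i k)) / to_fract ?D"
      by (simp add: y_def sum_divide_distrib)
    also have "\<dots> = x i" using BA[OF that, of x] D' by (metis nonzero_mult_div_cancel_left)
    finally show ?thesis by simp
  qed
  ultimately show ?thesis by (rule that)
qed

lemma linear_solve:
  fixes A :: "nat \<Rightarrow> nat \<Rightarrow> 'p::prime_card padic_int"
  assumes D: "Determinant.det (sqmat n A) \<noteq> 0"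
  obtains x where "\<And>i. i < n \<Longrightarrow> lin n A x i = b i"
proof -
  obtain y where y: "\<And>i j. i < n \<Longrightarrow> j < n \<Longrightarrow> lin n A (y j) i = (if i = j then 1 else 0)"
    by (rule inverse_matrix[OF D]) blast
  have "lin n A (\<lambda>k. \<Sum>j<n. b j * y j k) i = b i" if "i < n" for i
  proof -
    have "lin n A (\<lambda>k. \<Sum>j<n. b j * y j k) i = (\<Sum>j<n. if i = j then b j else 0)"
      unfolding lin_sum using that by (intro sum.cong) (auto simp: y)
    then show ?thesis using that by simp
  qed
  then show ?thesis by (rule that)
qed

lemma kernel_det_integral:
  fixes A :: "nat \<Rightarrow> nat \<Rightarrow> 'p::prime_card padic_int"
  assumes "\<And>i. i < n \<Longrightarrow> lin n A x i \<in> Zp" "i < n"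
  shows "to_fract (Determinant.det (sqmat n A)) * x i \<in> Zp"
proof -
  obtain B where "\<And>x i. i < n \<Longrightarrow> to_fract (Determinant.det (sqmat n A)) * x i = (\<Sum>k<n. lin n A x k * to_fract (B i k))"
    by (rule det_times_kernel[of n A]) blast
  then show ?thesis using assms by (auto intro!: Zp_sum Zp_mult)
qed

lemma kernel_torsion:
  fixes A :: "nat \<Rightarrow> nat \<Rightarrow> 'p::prime_card padic_int"
  assumes "Determinant.det (sqmat n A) \<noteq> 0"
  obtains k where "\<And>x i. \<lbrakk>\<And>i. i < n \<Longrightarrow> lin n A x i \<in> Zp; i < n\<rbrakk> \<Longrightarrow> to_fract (of_nat CARD('p) ^ k) * x i \<in> Zp"
proof -
  obtain k c where k: "of_nat CARD('p) ^ k = Determinant.det (sqmat n A) * c"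
    using dvd_prime_power[OF assms] by (metis dvdE)
  have "to_fract (of_nat CARD('p) ^ k) * x i \<in> Zp" if "\<And>i. i < n \<Longrightarrow> lin n A x i \<in> Zp" "i < n" for x i
  proof -
    have "to_fract (of_nat CARD('p) ^ k) * x i = to_fract c * (to_fract (Determinant.det (sqmat n A)) * x i)"
      unfolding k by simp
    also have "\<dots> \<in> Zp" by (rule Zp_mult[OF Zp_to_fract kernel_det_integral[OF that]])
    finally show ?thesis .
  qed
  then show ?thesis by (rule that)
qed

text \<open>The kernel is torsion, so an element of \<open>\<int>\<^sub>p\<close> acts on it like a natural number.\<close>

lemma additive_scale:
  fixes A :: "nat \<Rightarrow> nat \<Rightarrow> 'p::prime_card padic_int" and h :: "_ \<Rightarrow> 'p prufer"
  assumes D: "Determinant.det (sqmat n A) \<noteq> 0"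
    and add: "\<And>v w. v \<in> kernel_carrier (sqmat n A) \<Longrightarrow> w \<in> kernel_carrier (sqmat n A) \<Longrightarrow> h (v + w) = h v + h w"
    and v: "v \<in> kernel_carrier (sqmat n A)"
  shows "h (map_vec (scale_prufer z) v) = scale_prufer z (h v)"
proof -
  have dim: "dim_vec v = n" using kernel_carrier_vec[OF v] by simp
  have "h (0\<^sub>v n + 0\<^sub>v n) = h (0\<^sub>v n) + h (0\<^sub>v n)" by (intro add kernel_zero)
  then have zero: "h (0\<^sub>v n) = 0" by simp
  have nat: "h (map_vec (scale_prufer (of_nat m)) v) = scale_prufer (of_nat m) (h v)" for m
  proof (induction m)
    case 0
    have "map_vec (scale_prufer (of_nat 0)) v = 0\<^sub>v n" using dim by (intro eq_vecI) auto
    then show ?case using zero by (metis of_nat_0 scale_prufer_0(1))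
  next
    case (Suc m)
    have eq: "map_vec (scale_prufer (of_nat (Suc m))) v = v + map_vec (scale_prufer (of_nat m)) v"
      using dim by (intro eq_vecI) (auto simp: scale_prufer_add_left)
    show ?case unfolding eq
      by (simp add: add[OF v kernel_closed(3)[OF v v]] Suc.IH scale_prufer_add_left)
  qed
  obtain x where x: "v = kvec n x" "\<And>i. i < n \<Longrightarrow> lin n A x i \<in> Zp" by (rule kernel_cases[OF v]) blast
  obtain k where k: "\<And>i. i < n \<Longrightarrow> to_fract (of_nat CARD('p) ^ k) * x i \<in> Zp"
    by (rule kernel_torsion[OF D]) (use x(2) in blast)
  have tors: "scale_prufer (of_nat CARD('p) ^ k) (vec_index v i) = 0" if "i < n" for i
    using k[OF that] that by (simp add: x(1) scale_prufer_of_padic of_padic_eq_0_iff del: of_nat_power)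
  then have "map_vec (scale_prufer (of_nat (CARD('p) ^ k))) v = 0\<^sub>v n"
    using dim by (intro eq_vecI) auto
  then have "scale_prufer (of_nat CARD('p) ^ k) (h v) = 0"
    using nat[of "CARD('p) ^ k"] zero by simp
  then have "scale_prufer z (h v) = scale_prufer (of_nat (nat (residue z k))) (h v)"
    by (rule scale_prufer_residue)
  also have "\<dots> = h (map_vec (scale_prufer (of_nat (nat (residue z k)))) v)" by (rule nat[symmetric])
  also have "map_vec (scale_prufer (of_nat (nat (residue z k)))) v = map_vec (scale_prufer z) v"
    using dim scale_prufer_residue[OF tors, of _ z] by (intro eq_vecI) simp_all
  finally show ?thesis by simp
qed

text \<open>Each coordinate of \<phi> is an additive map into
  \<open>\<rat>\<^sub>p / \<int>\<^sub>p\<close>, so \<open>additive_scale\<close> applies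
  coordinatewise. Group homomorphisms between kernels are thus linear over
  \<open>\<int>\<^sub>p\<close>.\<close>

lemma kernel_hom_scale:
  fixes A :: "nat \<Rightarrow> nat \<Rightarrow> 'p::prime_card padic_int"
  assumes D: "Determinant.det (sqmat n A) \<noteq> 0"
    and \<phi>: "\<phi> \<in> hom (ker_grp n A) (ker_grp m A')"
    and v: "v \<in> kernel_carrier (sqmat n A)"
  shows "\<phi> (map_vec (scale_prufer z) v) = map_vec (scale_prufer z) (\<phi> v)"
proof -
  have car: "\<phi> w \<in> carrier_vec m" if "w \<in> kernel_carrier (sqmat n A)" for w
    using \<phi> that by (auto simp: hom_def kernel_group_simps intro: kernel_carrier_vec)
  have "vec_index (\<phi> (map_vec (scale_prufer z) v)) i = scale_prufer z (vec_index (\<phi> v) i)" if "i < m" for i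
  proof (rule additive_scale[OF D _ v])
    fix v w assume vw: "v \<in> kernel_carrier (sqmat n A)" "w \<in> kernel_carrier (sqmat n A)"
    then have "\<phi> (v + w) = \<phi> v + \<phi> w" using \<phi> by (simp add: hom_def kernel_group_simps)
    then show "vec_index (\<phi> (v + w)) i = vec_index (\<phi> v) i + vec_index (\<phi> w) i"
      using that car[OF vw(1)] car[OF vw(2)] by simp
  qed
  then show ?thesis
    using car[OF v] car[OF kernel_closed(3)[OF v v, of z]] by (intro eq_vecI) simp_all
qed

section \<open>Isomorphisms of groups with pairing\<close>

lemma pairing_isoI:
  assumes "h \<in> iso G H" "\<And>x y. x \<in> carrier G \<Longrightarrow> y \<in> carrier G \<Longrightarrow> pairing H (h x) (h y) = pairing G x y"
  shows "pairing_iso G H"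
  using assms by (auto simp: pairing_iso_def)

lemma pairing_iso_refl: "pairing_iso G G"
  by (rule pairing_isoI[of "\<lambda>x. x"]) (auto intro: iso_set_refl)

lemma pairing_iso_inverse:
  assumes "group G" "h \<in> iso G H" "\<And>x y. x \<in> carrier G \<Longrightarrow> y \<in> carrier G \<Longrightarrow> pairing H (h x) (h y) = pairing G x y"
    and "x \<in> carrier H" "y \<in> carrier H"
  shows "pairing G (inv_into (carrier G) h x) (inv_into (carrier G) h y) = pairing H x y"
proof -
  have "h ` carrier G = carrier H" using assms(2) by (auto simp: iso_def bij_betw_def)
  then show ?thesis
    using assms(3)[of "inv_into (carrier G) h x" "inv_into (carrier G) h y"] assms(4,5)
    by (simp add: f_inv_into_f inv_into_into)
qed

lemma pairing_iso_sym:
  assumes "group G" "pairing_iso G H"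
  shows "pairing_iso H G"
proof -
  obtain h where "h \<in> iso G H" "\<And>x y. x \<in> carrier G \<Longrightarrow> y \<in> carrier G \<Longrightarrow> pairing H (h x) (h y) = pairing G x y"
    using assms(2) unfolding pairing_iso_def by blast
  note h = this
  show ?thesis
    by (rule pairing_isoI[OF group.iso_set_sym[OF assms(1) h(1)] pairing_iso_inverse[OF assms(1) h]])
qed

lemma pairing_iso_trans:
  assumes "pairing_iso G H" "pairing_iso H K"
  shows "pairing_iso G K"
proof -
  obtain h where h: "h \<in> iso G H" "\<And>x y. x \<in> carrier G \<Longrightarrow> y \<in> carrier G \<Longrightarrow> pairing H (h x) (h y) = pairing G x y"
    using assms(1) unfolding pairing_iso_def by blast
  obtain g where g: "g \<in> iso H K" "\<And>x y. x \<in> carrier H \<Longrightarrow> y \<in> carrier H \<Longrightarrow> pairing K (g x) (g y) = pairing H x y"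
    using assms(2) unfolding pairing_iso_def by blast
  have "h x \<in> carrier H" if "x \<in> carrier G" for x
    using h(1) that by (auto simp: iso_def bij_betw_def)
  then show ?thesis
    using h(2) g(2) by (intro pairing_isoI[OF iso_set_trans[OF h(1) g(1)]]) (simp add: compose_def)
qed

text \<open>An isomorphism described on lifts is at first only a relation between classes. Here
  single-valuedness and injectivity become separate obligations and no normal form of lifts is
  needed.\<close>

lemma pairing_iso_of_relation:
  assumes tot: "\<And>v. v \<in> carrier G \<Longrightarrow> \<exists>w. R v w" and onto: "\<And>w. w \<in> carrier H \<Longrightarrow> \<exists>v. R v w"
    and dom: "\<And>v w. R v w \<Longrightarrow> v \<in> carrier G" and cod: "\<And>v w. R v w \<Longrightarrow> w \<in> carrier H"
    and mult: "\<And>v w v' w'. R v w \<Longrightarrow> R v' w' \<Longrightarrow> R (v \<otimes>\<^bsub>G\<^esub> v') (w \<otimes>\<^bsub>H\<^esub> w')"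
    and unique: "\<And>v w w'. R v w \<Longrightarrow> R v w' \<Longrightarrow> w = w'"
    and inj: "\<And>v v' w. R v w \<Longrightarrow> R v' w \<Longrightarrow> v = v'"
    and pair: "\<And>v w v' w'. R v w \<Longrightarrow> R v' w' \<Longrightarrow> pairing H w w' = pairing G v v'"
  shows "pairing_iso G H"
proof -
  define h where "h v = (SOME w. R v w)" for v
  have h: "R v (h v)" if "v \<in> carrier G" for v
    unfolding h_def by (rule someI_ex[OF tot[OF that]])
  have hI: "h v = w" if "R v w" for v w
    using unique[OF h[OF dom[OF that]] that] .
  show ?thesis
  proof (rule pairing_isoI)
    show "pairing H (h x) (h y) = pairing G x y" if "x \<in> carrier G" "y \<in> carrier G" for x y
      using that h pair by blast
    have "h \<in> hom G H"
      unfolding hom_def using h cod mult hI by blast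
    moreover have "bij_betw h (carrier G) (carrier H)"
    proof (rule bij_betw_imageI)
      show "inj_on h (carrier G)"
      proof (rule inj_onI)
        fix u v assume "u \<in> carrier G" "v \<in> carrier G" "h u = h v"
        then show "u = v" using h[of u] h[of v] by (simp add: inj)
      qed
      show "h ` carrier G = carrier H"
      proof (intro equalityI subsetI)
        show "w \<in> carrier H" if "w \<in> h ` carrier G" for w using that h cod by blast
        fix w assume "w \<in> carrier H"
        then obtain v where "R v w" using onto by blast
        then show "w \<in> h ` carrier G" using dom hI by blast
      qed
    qed
    ultimately show "h \<in> iso G H" by (simp add: iso_def)
  qed
qed

section \<open>Adding a row and a column\<close>

text \<open>Coordinates of \<open>y + t f\<close> with respect to the old basis and \<open>x + f\<close>.\<close>

definition glue :: "nat \<Rightarrow> (nat \<Rightarrow> 'p::prime_card padic) \<Rightarrow> (nat \<Rightarrow> 'p padic) \<Rightarrow> 'p padic \<Rightarrow> nat \<Rightarrow> 'p padic" where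
  "glue n x y t i = (if i < n then y i - t * x i else t)"

lemma lin_Suc: "lin (Suc n) A u i = lin n A u i + to_fract (A i n) * u n"
  by (simp add: lin_def)

lemma lin_glue: "lin n A (glue n x y t) i = lin n A y i - t * lin n A x i"
  by (simp add: lin_diff[symmetric] lin_scale[symmetric] glue_def cong: lin_cong)

lemma bil_glue:
  "bil n A (glue n x y t) (glue n x z s) =
     bil n A y z - s * bil n A y x - t * bil n A x z + t * s * bil n A x x"
proof -
  have "bil n A (glue n x y t) (glue n x z s) = bil n A (\<lambda>i. y i - t * x i) (\<lambda>i. z i - s * x i)"
    by (rule bil_cong) (simp_all add: glue_def)
  then show ?thesis
    by (simp add: bil_diff_left bil_diff_right bil_scale_left bil_scale_right algebra_simps)
qed

context
  fixes n :: nat and A :: "nat \<Rightarrow> nat \<Rightarrow> 'p::prime_card padic_int" and x :: "nat \<Rightarrow> 'p padic" and d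
  assumes sym: "\<And>i j. A i j = A j i"
    and x: "\<forall>i<n. lin n A x i = to_fract (A i n)"
    and d: "d = to_fract (A n n) - bil n A x x"
begin

text \<open>By symmetry the new row equals the new column, which is A x on the first n
  coordinates.\<close>

lemma lin_last_row: "lin n A u n = bil n A x u"
proof -
  have "lin n A u n = (\<Sum>j<n. u j * lin n A x j)"
    unfolding lin_def[of n A u n] by (intro sum.cong refl) (simp add: x sym[of n] mult.commute)
  also have "\<dots> = bil n A u x" by (simp add: bil_def)
  also have "\<dots> = bil n A x u" by (rule bil_commute[OF sym])
  finally show ?thesis .
qed

text \<open>These are the values of the form on y + t f against the basis: f is orthogonal to the
  old basis vectors, while the new one, x + f, sees both y and t.\<close>

lemma lin_Suc_glue:
  "i < n \<Longrightarrow> lin (Suc n) A (glue n x y t) i = lin n A y i"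
  "lin (Suc n) A (glue n x y t) n = bil n A x y + t * d"
  by (simp_all add: lin_Suc lin_glue x lin_last_row d glue_def algebra_simps)

lemma bil_Suc_glue:
  "bil (Suc n) A (glue n x y t) (glue n x z s) = bil n A y z + t * s * d"
proof -
  have "bil (Suc n) A (glue n x y t) (glue n x z s) =
      bil n A (glue n x y t) z + t * (bil n A x z + s * d)"
    by (simp add: bil_def[of "Suc n"] lin_Suc_glue) (simp add: bil_def glue_def)
  \<comment> \<open>The case s = 0 of \<open>bil_glue\<close> expresses linearity in the left
    argument.\<close>
  also have "bil n A (glue n x y t) z = bil n A y z - t * bil n A x z"
    using bil_glue[of n A x y t z 0] by (simp add: glue_def bil_def cong: lin_cong)
  finally show ?thesis by (simp add: algebra_simps)
qed

lemma kvec_glue_in_kernel_iff: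
  "kvec (Suc n) (glue n x y t) \<in> kernel_carrier (sqmat (Suc n) A) \<longleftrightarrow>
     kvec n y \<in> kernel_carrier (sqmat n A) \<and> bil n A x y + t * d \<in> Zp"
  by (auto simp: kvec_in_kernel_iff less_Suc_eq lin_Suc_glue)

end

lemma kvec_glue_add:
  "kvec (Suc n) (glue n x y t) + kvec (Suc n) (glue n x z s) =
     kvec (Suc n) (glue n x (\<lambda>i. y i + z i) (t + s))"
  by (intro eq_vecI) (auto simp: glue_def of_padic_add[symmetric] algebra_simps)

text \<open>The change of coordinates is invertible over \<open>\<rat>\<^sub>p\<close>: t is the
  last coordinate, and y is recovered by adding t x.\<close>

lemma kvec_glue_cases:
  assumes "v \<in> carrier_vec (Suc n)"
  obtains y t where "v = kvec (Suc n) (glue n x y t)"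
proof -
  obtain u where "v = kvec (Suc n) u" using kvec_cases[OF assms] by metis
  also have "\<dots> = kvec (Suc n) (glue n x (\<lambda>i. u i + u n * x i) (u n))"
    by (auto simp: kvec_eq_iff glue_def less_Suc_eq)
  finally show ?thesis by (rule that)
qed

text \<open>Two pairs (y, t) and (z, s) give the same class only if t = s + c with c integral and y
  agrees with z + c x modulo integral vectors. A map that is linear over
  \<open>\<int>\<^sub>p\<close> and sends the class of x to that of x' preserves this
  relation.\<close>

lemma kvec_glue_transfer:
  fixes A :: "nat \<Rightarrow> nat \<Rightarrow> 'p::prime_card padic_int"
  assumes D: "Determinant.det (sqmat n A) \<noteq> 0"
    and \<phi>: "\<phi> \<in> hom (ker_grp n A) (ker_grp n A')"
    and x: "kvec n x \<in> kernel_carrier (sqmat n A)" "\<phi> (kvec n x) = kvec n x'"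
    and y: "kvec n y \<in> kernel_carrier (sqmat n A)" "\<phi> (kvec n y) = kvec n y'"
    and z: "kvec n z \<in> kernel_carrier (sqmat n A)" "\<phi> (kvec n z) = kvec n z'"
    and eq: "kvec (Suc n) (glue n x y t) = kvec (Suc n) (glue n x z s)"
  shows "kvec (Suc n) (glue n x' y' t) = kvec (Suc n) (glue n x' z' s)"
proof -
  have eq': "\<And>i. i < Suc n \<Longrightarrow> glue n x y t i - glue n x z s i \<in> Zp"
    using eq unfolding kvec_eq_iff by blast
  have ts: "t - s \<in> Zp" using eq'[of n] by (simp add: glue_def)
  then obtain c where c: "t - s = to_fract c" by blast
  have t: "t = s + to_fract c" using c by (simp add: algebra_simps)
  have "kvec n y = kvec n z + map_vec (scale_prufer c) (kvec n x)"
    unfolding map_scale_kvec kvec_add kvec_eq_iff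
  proof (intro allI impI)
    fix i assume "i < n"
    then show "y i - (z i + to_fract c * x i) \<in> Zp"
      using eq'[of i] by (simp add: glue_def t algebra_simps)
  qed
  then have "\<phi> (kvec n y) = \<phi> (kvec n z) + map_vec (scale_prufer c) (\<phi> (kvec n x))"
    using \<phi> z(1) x(1) kernel_closed(3)[OF x(1) x(1), of c] kernel_hom_scale[OF D \<phi> x(1)]
    by (simp add: hom_def kernel_group_simps)
  then have *: "y' i - (z' i + to_fract c * x' i) \<in> Zp" if "i < n" for i
    using that unfolding x(2) y(2) z(2) map_scale_kvec kvec_add kvec_eq_iff by blast
  show ?thesis unfolding kvec_eq_iff
  proof (intro allI impI)
    fix i assume "i < Suc n"
    then show "glue n x' y' t i - glue n x' z' s i \<in> Zp"
      using *[of i] ts by (auto simp: glue_def t algebra_simps less_Suc_eq)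
  qed
qed

text \<open>The isomorphism replaces the class of y by its image under \<phi> and keeps t. The norms
  d must agree exactly and not only modulo integers, because the new pairing contains t s d with t
  and s possibly non-integral.\<close>

lemma pairing_iso_bordered:
  fixes A A' :: "nat \<Rightarrow> nat \<Rightarrow> 'p::prime_card padic_int"
  assumes sym: "\<And>i j. A i j = A j i" and sym': "\<And>i j. A' i j = A' j i"
    and D: "Determinant.det (sqmat n A) \<noteq> 0" and D': "Determinant.det (sqmat n A') \<noteq> 0"
    and \<phi>: "\<phi> \<in> iso (ker_grp n A) (ker_grp n A')"
    and pres: "\<And>v w. v \<in> kernel_carrier (sqmat n A) \<Longrightarrow> w \<in> kernel_carrier (sqmat n A) \<Longrightarrow>
      kernel_pairing (sqmat n A') (\<phi> v) (\<phi> w) = kernel_pairing (sqmat n A) v w"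
    and x: "\<forall>i<n. lin n A x i = to_fract (A i n)"
    and x': "\<forall>i<n. lin n A' x' i = to_fract (A' i n)"
    and \<phi>x: "\<phi> (kvec n x) = kvec n x'"
    and d: "to_fract (A n n) - bil n A x x = to_fract (A' n n) - bil n A' x' x'"
  shows "pairing_iso (ker_grp (Suc n) A) (ker_grp (Suc n) A')"
proof -
  let ?K = "kernel_carrier (sqmat n A)" and ?K' = "kernel_carrier (sqmat n A')"
  define d' where "d' = to_fract (A n n) - bil n A x x"
  note d1 = d'_def and d2 = d'_def[unfolded d]
  have hom: "\<phi> \<in> hom (ker_grp n A) (ker_grp n A')" and bij: "bij_betw \<phi> ?K ?K'"
    using \<phi> by (auto simp: iso_def kernel_group_simps)
  have xK: "kvec n x \<in> ?K" and xK': "kvec n x' \<in> ?K'"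
    using x x' by (simp_all add: kvec_in_kernel_iff)
  define \<psi> where "\<psi> = inv_into ?K \<phi>"
  have \<psi>: "\<psi> \<in> hom (ker_grp n A') (ker_grp n A)"
    using group.iso_set_sym[OF comm_group.axioms(2)[OF comm_group_ker_grp] \<phi>]
    by (simp add: \<psi>_def iso_def kernel_group_simps)
  have \<psi>\<phi>: "\<psi> (\<phi> v) = v" if "v \<in> ?K" for v
    unfolding \<psi>_def using bij that by (simp add: bij_betw_inv_into_left)
  have \<phi>\<psi>: "\<phi> (\<psi> v) = v" "\<psi> v \<in> ?K" if "v \<in> ?K'" for v
    unfolding \<psi>_def using bij that
    by (simp_all add: bij_betw_inv_into_right) (metis bij_betw_imp_surj_on inv_into_into)
  have \<phi>K: "\<phi> v \<in> ?K'" if "v \<in> ?K" for v using bij that by (auto simp: bij_betw_def)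
  have bil: "bil n A' y' z' - bil n A y z \<in> Zp"
    if "kvec n y \<in> ?K" "\<phi> (kvec n y) = kvec n y'" "kvec n z \<in> ?K" "\<phi> (kvec n z) = kvec n z'" for y y' z z'
  proof -
    have "kernel_pairing (sqmat n A') (kvec n y') (kvec n z') = kernel_pairing (sqmat n A) (kvec n y) (kvec n z)"
      using pres[OF that(1,3)] that by simp
    then have "of_padic (bil n A' y' z') = of_padic (bil n A y z)"
      using that \<phi>K[OF that(1)] \<phi>K[OF that(3)] by (simp add: kernel_pairing_kvec[where A=A, OF sym] kernel_pairing_kvec[where A=A', OF sym'])
    then show ?thesis by (simp add: of_padic_eq_iff)
  qed
  \<comment> \<open>The pairing enters the membership condition only modulo integers, so
    preservation of the pairing by \<phi> suffices.\<close>
  have Zp_iff: "bil n A' x' y' + t * d' \<in> Zp \<longleftrightarrow> bil n A x y + t * d' \<in> Zp"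
    if "kvec n y \<in> ?K" "\<phi> (kvec n y) = kvec n y'" for y y' t
    by (rule Zp_cong) (use bil[OF xK \<phi>x that] in \<open>simp add: algebra_simps\<close>)
  \<comment> \<open>R relates classes through a common t. Different pairs may witness the same
    class.\<close>
  define R where "R v w \<longleftrightarrow> (\<exists>y y' t. v = kvec (Suc n) (glue n x y t) \<and> w = kvec (Suc n) (glue n x' y' t) \<and>
      kvec n y \<in> ?K \<and> \<phi> (kvec n y) = kvec n y' \<and> bil n A x y + t * d' \<in> Zp)" for v w
  show ?thesis
  proof (rule pairing_iso_of_relation[where R = R]; (simp only: kernel_group_simps)?)
    fix v assume v: "v \<in> kernel_carrier (sqmat (Suc n) A)"
    obtain y t where y: "v = kvec (Suc n) (glue n x y t)"
      using kvec_glue_cases[OF kernel_carrier_vec[OF v]] by metis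
    have y2: "kvec n y \<in> ?K \<and> bil n A x y + t * d' \<in> Zp"
      using v unfolding y kvec_glue_in_kernel_iff[where A=A and n=n and x=x and d=d', OF sym x d1] by blast
    moreover obtain y' where "\<phi> (kvec n y) = kvec n y'"
      using kvec_cases[OF kernel_carrier_vec[OF \<phi>K]] y2 by metis
    ultimately show "\<exists>w. R v w" unfolding R_def using y by blast
  next
    fix w assume w: "w \<in> kernel_carrier (sqmat (Suc n) A')"
    obtain y' t where y': "w = kvec (Suc n) (glue n x' y' t)"
      using kvec_glue_cases[OF kernel_carrier_vec[OF w]] by metis
    have y2: "kvec n y' \<in> ?K'" "bil n A' x' y' + t * d' \<in> Zp"
      using w unfolding y' kvec_glue_in_kernel_iff[where A=A' and n=n and x=x' and d=d', OF sym' x' d2] by blast+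
    obtain y where y: "\<psi> (kvec n y') = kvec n y"
      using kvec_cases[OF kernel_carrier_vec[OF \<phi>\<psi>(2)[OF y2(1)]]] by metis
    have "kvec n y \<in> ?K" "\<phi> (kvec n y) = kvec n y'"
      using \<phi>\<psi>[OF y2(1)] unfolding y by auto
    with Zp_iff[OF this] y2(2) y' show "\<exists>v. R v w" unfolding R_def by blast
  next
    fix v w assume "R v w"
    then show "v \<in> kernel_carrier (sqmat (Suc n) A)"
      unfolding R_def using kvec_glue_in_kernel_iff[where A=A and n=n and x=x and d=d', OF sym x d1] by blast
  next
    fix v w assume "R v w"
    then show "w \<in> kernel_carrier (sqmat (Suc n) A')"
      unfolding R_def using kvec_glue_in_kernel_iff[where A=A' and n=n and x=x' and d=d', OF sym' x' d2] Zp_iff \<phi>K by metis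
  next
    fix v w v2 w2 assume "R v w" "R v2 w2"
    then obtain y y' t z z' s where
      y: "v = kvec (Suc n) (glue n x y t)" "w = kvec (Suc n) (glue n x' y' t)"
        "kvec n y \<in> ?K" "\<phi> (kvec n y) = kvec n y'" "bil n A x y + t * d' \<in> Zp" and
      z: "v2 = kvec (Suc n) (glue n x z s)" "w2 = kvec (Suc n) (glue n x' z' s)"
        "kvec n z \<in> ?K" "\<phi> (kvec n z) = kvec n z'" "bil n A x z + s * d' \<in> Zp"
      unfolding R_def by blast
    have "\<phi> (kvec n y + kvec n z) = \<phi> (kvec n y) + \<phi> (kvec n z)"
      using hom y(3) z(3) by (simp add: hom_def kernel_group_simps)
    moreover have "bil n A x (\<lambda>i. y i + z i) + (t + s) * d' \<in> Zp"
      using Zp_add[OF y(5) z(5)] by (simp add: bil_add_right algebra_simps)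
    moreover have "kvec n y + kvec n z \<in> ?K" by (rule kernel_closed(1)[OF y(3) z(3)])
    ultimately show "R (v + v2) (w + w2)"
      unfolding R_def y(1,2) z(1,2) kvec_glue_add unfolding y(4) z(4) kvec_add by blast
  next
    fix v w w2 assume "R v w" "R v w2"
    then obtain y y' t z z' s where
      y: "v = kvec (Suc n) (glue n x y t)" "w = kvec (Suc n) (glue n x' y' t)"
        "kvec n y \<in> ?K" "\<phi> (kvec n y) = kvec n y'" and
      z: "v = kvec (Suc n) (glue n x z s)" "w2 = kvec (Suc n) (glue n x' z' s)"
        "kvec n z \<in> ?K" "\<phi> (kvec n z) = kvec n z'"
      unfolding R_def by blast
    show "w = w2" unfolding y(2) z(2)
      by (rule kvec_glue_transfer[OF D hom xK \<phi>x y(3,4) z(3,4) y(1)[symmetric, THEN trans[OF _ z(1)]]])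
  next
    fix v v2 w assume "R v w" "R v2 w"
    then obtain y y' t z z' s where
      y: "v = kvec (Suc n) (glue n x y t)" "w = kvec (Suc n) (glue n x' y' t)"
        "kvec n y \<in> ?K" "\<phi> (kvec n y) = kvec n y'" and
      z: "v2 = kvec (Suc n) (glue n x z s)" "w = kvec (Suc n) (glue n x' z' s)"
        "kvec n z \<in> ?K" "\<phi> (kvec n z) = kvec n z'"
      unfolding R_def by blast
    \<comment> \<open>Injectivity is single-valuedness for the inverse map, so
      \<open>kvec_glue_transfer\<close> is used again with A and A' exchanged.\<close>
    have *: "\<psi> (kvec n x') = kvec n x" "\<psi> (kvec n y') = kvec n y" "\<psi> (kvec n z') = kvec n z"
      "kvec n y' \<in> ?K'" "kvec n z' \<in> ?K'"
      using \<psi>\<phi>[OF xK] \<psi>\<phi>[OF y(3)] \<psi>\<phi>[OF z(3)] \<phi>K[OF y(3)] \<phi>K[OF z(3)] unfolding \<phi>x y(4) z(4) by auto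
    show "v = v2" unfolding y(1) z(1)
      by (rule kvec_glue_transfer[OF D' \<psi> xK' *(1) *(4,2) *(5,3) y(2)[symmetric, THEN trans[OF _ z(2)]]])
  next
    fix v w v2 w2 assume R: "R v w" "R v2 w2"
    then obtain y y' t z z' s where
      y: "v = kvec (Suc n) (glue n x y t)" "w = kvec (Suc n) (glue n x' y' t)"
        "kvec n y \<in> ?K" "\<phi> (kvec n y) = kvec n y'" "bil n A x y + t * d' \<in> Zp" and
      z: "v2 = kvec (Suc n) (glue n x z s)" "w2 = kvec (Suc n) (glue n x' z' s)"
        "kvec n z \<in> ?K" "\<phi> (kvec n z) = kvec n z'" "bil n A x z + s * d' \<in> Zp"
      unfolding R_def by blast
    have K: "v \<in> kernel_carrier (sqmat (Suc n) A)" "v2 \<in> kernel_carrier (sqmat (Suc n) A)"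
      "w \<in> kernel_carrier (sqmat (Suc n) A')" "w2 \<in> kernel_carrier (sqmat (Suc n) A')"
      unfolding y(1,2) z(1,2) kvec_glue_in_kernel_iff[where A=A and n=n and x=x and d=d', OF sym x d1] kvec_glue_in_kernel_iff[where A=A' and n=n and x=x' and d=d', OF sym' x' d2]
      using y(3-5) z(3-5) Zp_iff[OF y(3,4)] Zp_iff[OF z(3,4)] \<phi>K[OF y(3)] \<phi>K[OF z(3)] by auto
    have "kernel_pairing (sqmat (Suc n) A) v v2 = of_padic (bil n A y z + t * s * d')"
      using K unfolding y(1) z(1) by (simp only: kernel_pairing_kvec[where A=A, OF sym] bil_Suc_glue[where A=A and n=n and x=x and d=d', OF sym x d1])
    moreover have "kernel_pairing (sqmat (Suc n) A') w w2 = of_padic (bil n A' y' z' + t * s * d')"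
      using K unfolding y(2) z(2) by (simp only: kernel_pairing_kvec[where A=A', OF sym'] bil_Suc_glue[where A=A' and n=n and x=x' and d=d', OF sym' x' d2])
    ultimately show "kernel_pairing (sqmat (Suc n) A') w w2 = kernel_pairing (sqmat (Suc n) A) v v2"
      using bil[OF y(3,4) z(3,4)] by (simp add: of_padic_eq_iff)
  qed
qed

section \<open>The kernel is locally constant\<close>

lemma dvd_prod_diff:
  fixes f g :: "'b \<Rightarrow> 'a::comm_ring_1"
  assumes "\<And>i. i \<in> I \<Longrightarrow> m dvd f i - g i"
  shows "m dvd prod f I - prod g I"
  using assms
proof (induction I rule: infinite_finite_induct)
  case (insert a I)
  have "prod f (insert a I) - prod g (insert a I) = f a * (prod f I - prod g I) + (f a - g a) * prod g I"
    using insert(1,2) by (simp add: algebra_simps)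
  then show ?case using insert by (simp add: dvd_add)
qed simp_all

text \<open>By the Leibniz formula the determinant is an integer polynomial in the entries, and such
  polynomials respect congruences.\<close>

lemma dvd_det_diff:
  fixes A A' :: "nat \<Rightarrow> nat \<Rightarrow> 'a::comm_ring_1"
  assumes "\<And>i j. i < n \<Longrightarrow> j < n \<Longrightarrow> m dvd A' i j - A i j"
  shows "m dvd Determinant.det (sqmat n A') - Determinant.det (sqmat n A)"
proof -
  have "m dvd signof p * (\<Prod>i = 0..<n. sqmat n A' $$ (i, p i)) - signof p * (\<Prod>i = 0..<n. sqmat n A $$ (i, p i))"
    if "p permutes {0..<n}" for p
  proof -
    have "m dvd (\<Prod>i = 0..<n. sqmat n A' $$ (i, p i)) - (\<Prod>i = 0..<n. sqmat n A $$ (i, p i))"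
    proof (rule dvd_prod_diff)
      fix i assume "i \<in> {0..<n}"
      moreover from this have "p i < n" using permutes_in_image[OF that, of i] by simp
      ultimately show "m dvd sqmat n A' $$ (i, p i) - sqmat n A $$ (i, p i)" using assms by simp
    qed
    then show ?thesis by (simp add: right_diff_distrib[symmetric])
  qed
  moreover have "Determinant.det (sqmat n B) =
      (\<Sum>p\<in>{p. p permutes {0..<n}}. signof p * (\<Prod>i = 0..<n. sqmat n B $$ (i, p i)))" for B :: "nat \<Rightarrow> nat \<Rightarrow> 'a"
    by (rule det_def') simp
  ultimately show ?thesis
    by (simp only: sum_subtractf[symmetric]) (rule dvd_sum, simp only: mem_Collect_eq)
qed

text \<open>The determinant clears the denominators of a kernel vector, so changing A by multiples
  of it alters A x only by integral vectors.\<close>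

lemma kernel_subset:
  fixes A A' :: "nat \<Rightarrow> nat \<Rightarrow> 'p::prime_card padic_int"
  assumes "\<And>i j. i < n \<Longrightarrow> j < n \<Longrightarrow> Determinant.det (sqmat n A) dvd A' i j - A i j"
  shows "kernel_carrier (sqmat n A) \<subseteq> kernel_carrier (sqmat n A')"
proof
  let ?D = "Determinant.det (sqmat n A)"
  fix v assume "v \<in> kernel_carrier (sqmat n A)"
  then obtain x where v: "v = kvec n x" and x: "\<And>i. i < n \<Longrightarrow> lin n A x i \<in> Zp"
    by (rule kernel_cases) blast
  have "lin n A' x i \<in> Zp" if i: "i < n" for i
  proof -
    have "lin n A' x i - lin n A x i = (\<Sum>j<n. to_fract (A' i j - A i j) * x j)"
      by (simp add: lin_def sum_subtractf left_diff_distrib)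
    also have "\<dots> \<in> Zp"
    proof (rule Zp_sum)
      fix j assume "j \<in> {..<n}"
      then have j: "j < n" by simp
      obtain c where c: "A' i j - A i j = ?D * c" using assms[OF i j] by (rule dvdE)
      have "to_fract (A' i j - A i j) * x j = to_fract c * (to_fract ?D * x j)"
        unfolding c by (simp add: mult_ac)
      then show "to_fract (A' i j - A i j) * x j \<in> Zp"
        using Zp_mult[OF Zp_to_fract kernel_det_integral[OF x j]] by (simp only:)
    qed
    finally show ?thesis using Zp_cong[of "lin n A' x i" "lin n A x i"] x[OF i] by blast
  qed
  then show "v \<in> kernel_carrier (sqmat n A')" by (simp add: v kvec_in_kernel_iff)
qed

text \<open>In the modulus p D^2 with D = det(A), the two factors D clear the denominators of both
  arguments of the pairing. The factor p makes the new determinant a unit multiple of D, which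
  yields the reverse inclusion of kernels.\<close>

lemma ker_grp_perturb:
  fixes A A' :: "nat \<Rightarrow> nat \<Rightarrow> 'p::prime_card padic_int"
  assumes sym: "\<And>i j. A i j = A j i" and sym': "\<And>i j. A' i j = A' j i"
    and D0: "Determinant.det (sqmat n A) \<noteq> 0"
    and dvd: "\<And>i j. i < n \<Longrightarrow> j < n \<Longrightarrow> of_nat CARD('p) * (Determinant.det (sqmat n A))\<^sup>2 dvd A' i j - A i j"
  shows "Determinant.det (sqmat n A') \<noteq> 0" "pairing_iso (ker_grp n A) (ker_grp n A')"
proof -
  let ?D = "Determinant.det (sqmat n A)" and ?D' = "Determinant.det (sqmat n A')"
  have "of_nat CARD('p) * ?D\<^sup>2 dvd ?D' - ?D" by (rule dvd_det_diff[OF dvd])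
  then obtain t where "?D' - ?D = of_nat CARD('p) * ?D\<^sup>2 * t" by (rule dvdE)
  then have D': "?D' = ?D * (1 + of_nat CARD('p) * (?D * t))"
    by (simp add: algebra_simps power2_eq_square)
  have unit: "(1 + of_nat CARD('p) * (?D * t)) dvd 1" by (rule unit_one_plus_prime_mult)
  then show "?D' \<noteq> 0" unfolding D' using D0 by auto
  have DD: "?D\<^sup>2 dvd A' i j - A i j" if "i < n" "j < n" for i j
    using dvd[OF that] by (rule dvd_mult_right)
  have D1: "?D dvd A' i j - A i j" if "i < n" "j < n" for i j
    using DD[OF that] unfolding power2_eq_square by (rule dvd_mult_left)
  have D2: "?D' dvd A i j - A' i j" if "i < n" "j < n" for i j
  proof -
    have "?D' dvd ?D" unfolding D' using mult_dvd_mono[OF dvd_refl unit] by simp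
    also have "?D dvd A i j - A' i j" using D1[OF that] dvd_minus_iff[of ?D "A' i j - A i j"] by simp
    finally show ?thesis .
  qed
  have K: "kernel_carrier (sqmat n A) = kernel_carrier (sqmat n A')"
    by (rule equalityI; rule kernel_subset) (fact D1, fact D2)
  have pair: "kernel_pairing (sqmat n A') v w = kernel_pairing (sqmat n A) v w"
    if vw: "v \<in> kernel_carrier (sqmat n A)" "w \<in> kernel_carrier (sqmat n A)" for v w
  proof -
    obtain x where x: "v = kvec n x" "\<And>i. i < n \<Longrightarrow> lin n A x i \<in> Zp"
      using vw(1) by (rule kernel_cases) blast
    obtain y where y: "w = kvec n y" "\<And>i. i < n \<Longrightarrow> lin n A y i \<in> Zp"
      using vw(2) by (rule kernel_cases) blast
    have "bil n A' x y - bil n A x y = (\<Sum>i<n. \<Sum>j<n. x i * (to_fract (A' i j - A i j) * y j))"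
      by (simp add: bil_def lin_def sum_subtractf left_diff_distrib right_diff_distrib sum_distrib_left)
    also have "\<dots> \<in> Zp"
    proof (intro Zp_sum)
      fix i j assume "i \<in> {..<n}" "j \<in> {..<n}"
      then have ij: "i < n" "j < n" by simp_all
      obtain c where c: "A' i j - A i j = ?D\<^sup>2 * c" using DD[OF ij] by (rule dvdE)
      have eq: "x i * (to_fract (A' i j - A i j) * y j) = to_fract c * ((to_fract ?D * x i) * (to_fract ?D * y j))"
        unfolding c by (simp add: mult_ac power2_eq_square)
      show "x i * (to_fract (A' i j - A i j) * y j) \<in> Zp"
        unfolding eq by (intro Zp_mult[OF Zp_to_fract Zp_mult] kernel_det_integral x(2) y(2) ij)
    qed
    finally show ?thesis
      using vw K unfolding x(1) y(1)
      by (simp add: kernel_pairing_kvec[where A=A, OF sym] kernel_pairing_kvec[where A=A', OF sym'] of_padic_eq_iff)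
  qed
  show "pairing_iso (ker_grp n A) (ker_grp n A')"
    by (rule pairing_isoI[of "\<lambda>v. v"])
      (use K pair in \<open>simp_all add: kernel_group_simps iso_def hom_def bij_betw_def\<close>)
qed

lemma ker_grp_locally_constant:
  fixes A :: "nat \<Rightarrow> nat \<Rightarrow> 'p::prime_card padic_int"
  assumes sym: "\<And>i j. A i j = A j i" and D0: "Determinant.det (sqmat n A) \<noteq> 0"
  obtains N where "\<And>A'. \<lbrakk>\<And>i j. A' i j = A' j i; \<And>i j. i < n \<Longrightarrow> j < n \<Longrightarrow> residue (A' i j) N = residue (A i j) N\<rbrakk>
    \<Longrightarrow> Determinant.det (sqmat n A') \<noteq> 0 \<and> pairing_iso (ker_grp n A) (ker_grp n A')"
proof -
  let ?D = "Determinant.det (sqmat n A)"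
  have "of_nat CARD('p) * ?D\<^sup>2 \<noteq> 0" using D0 of_nat_CARD_neq_0[where 'p='p] by simp
  then obtain N where N: "of_nat CARD('p) * ?D\<^sup>2 dvd of_nat CARD('p) ^ N"
    by (rule dvd_prime_power)
  show ?thesis
  proof (rule that[of N])
    fix A' :: "nat \<Rightarrow> nat \<Rightarrow> 'p padic_int"
    assume sym': "\<And>i j. A' i j = A' j i"
      and res: "\<And>i j. i < n \<Longrightarrow> j < n \<Longrightarrow> residue (A' i j) N = residue (A i j) N"
    have dvd: "of_nat CARD('p) * ?D\<^sup>2 dvd A' i j - A i j" if "i < n" "j < n" for i j
    proof -
      note N
      also have "of_nat CARD('p) ^ N dvd A' i j - A i j"
        unfolding prime_power_dvd_iff_residue residue_diff_eq_0_iff by (rule res[OF that])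
      finally show ?thesis .
    qed
    show "Determinant.det (sqmat n A') \<noteq> 0 \<and> pairing_iso (ker_grp n A) (ker_grp n A')"
      using ker_grp_perturb[where A=A and A'=A', OF sym sym' D0 dvd] by blast
  qed
qed

section \<open>The kernel of a non-singular matrix is a finite group with perfect pairing\<close>

text \<open>Makes the \<open>p\<^sup>k\<close>-torsion an instance of \<open>ker_grp\<close>, so that Lagrange applies to the subgroup \<open>ker A\<close>.\<close>

lemma kernel_scalar:
  fixes n k :: nat
  defines "S \<equiv> sqmat n (\<lambda>i j. if i = j then of_nat CARD('p) ^ k else 0 :: 'p::prime_card padic_int)"
  shows "kernel_carrier S = {v \<in> carrier_vec n. \<forall>i<n. vec_index v i \<in> prime_power_torsion k}"
    and "card (kernel_carrier S) = CARD('p) ^ (k * n)"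
proof -
  have sum: "(\<Sum>j<n. scale_prufer (S $$ (i, j)) (vec_index v j)) = scale_prufer (of_nat CARD('p) ^ k) (vec_index v i)"
    if "i < n" for i v
  proof -
    have "(\<Sum>j<n. scale_prufer (S $$ (i, j)) (vec_index v j)) =
        (\<Sum>j<n. if i = j then scale_prufer (of_nat CARD('p) ^ k) (vec_index v j) else 0)"
      using that by (intro sum.cong) (auto simp: S_def)
    then show ?thesis using that by simp
  qed
  have dim: "dim_row S = n" "dim_col S = n" by (simp_all add: S_def)
  show eq: "kernel_carrier S = {v \<in> carrier_vec n. \<forall>i<n. vec_index v i \<in> prime_power_torsion k}"
    unfolding kernel_carrier_def dim by (auto simp: sum)
  have "bij_betw (\<lambda>f. Matrix.vec n f) (PiE {..<n} (\<lambda>_. prime_power_torsion k)) (kernel_carrier S)"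
  proof (rule bij_betw_byWitness[where f' = "\<lambda>v. restrict (vec_index v) {..<n}"])
    show "\<forall>f\<in>PiE {..<n} (\<lambda>_. prime_power_torsion k). restrict (vec_index (Matrix.vec n f)) {..<n} = f"
      by (auto simp: restrict_def PiE_iff extensional_def fun_eq_iff)
    show "\<forall>v\<in>kernel_carrier S. Matrix.vec n (restrict (vec_index v) {..<n}) = v"
      unfolding eq by (auto intro!: eq_vecI)
    show "Matrix.vec n ` PiE {..<n} (\<lambda>_. prime_power_torsion k) \<subseteq> kernel_carrier S"
    proof (rule image_subsetI)
      fix f :: "nat \<Rightarrow> 'p prufer" assume f: "f \<in> PiE {..<n} (\<lambda>_. prime_power_torsion k)"
      have "f i \<in> prime_power_torsion k" if "i < n" for i
        using PiE_mem[OF f, of i] that by blast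
      then show "Matrix.vec n f \<in> kernel_carrier S" unfolding eq by simp
    qed
    show "(\<lambda>v. restrict (vec_index v) {..<n}) ` kernel_carrier S \<subseteq> PiE {..<n} (\<lambda>_. prime_power_torsion k)"
      unfolding eq by (rule image_subsetI) (simp only: restrict_PiE_iff mem_Collect_eq lessThan_iff Ball_def, blast)
  qed
  then have "card (kernel_carrier S) = card (PiE {..<n} (\<lambda>_. prime_power_torsion k :: 'p prufer set))"
    by (simp add: bij_betw_same_card)
  also have "\<dots> = CARD('p) ^ (k * n)"
    by (subst card_PiE) (simp_all add: card_prime_power_torsion power_mult)
  finally show "card (kernel_carrier S) = CARD('p) ^ (k * n)" .
qed

lemma finite_abelian_p_group_ker_grp:
  fixes A :: "nat \<Rightarrow> nat \<Rightarrow> 'p::prime_card padic_int"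
  assumes D: "Determinant.det (sqmat n A) \<noteq> 0"
  shows "finite_abelian_p_group (ker_grp n A)"
proof -
  obtain k where k: "\<And>x i. \<lbrakk>\<And>i. i < n \<Longrightarrow> lin n A x i \<in> Zp; i < n\<rbrakk> \<Longrightarrow> to_fract (of_nat CARD('p) ^ k) * x i \<in> Zp"
    by (rule kernel_torsion[OF D]) blast
  define T :: "nat \<Rightarrow> nat \<Rightarrow> 'p padic_int" where "T i j = (if i = j then of_nat CARD('p) ^ k else 0)" for i j
  note kernel_scalar[where 'p='p, of n k, folded T_def]
  then have card: "card (kernel_carrier (sqmat n T)) = CARD('p) ^ (k * n)"
    and car: "kernel_carrier (sqmat n T) = {v \<in> carrier_vec n. \<forall>i<n. vec_index v i \<in> prime_power_torsion k}"
    by blast+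
  interpret T: comm_group "ker_grp n T" by (rule comm_group_ker_grp)
  have inv: "inv\<^bsub>ker_grp n T\<^esub> v = 0\<^sub>v n - v" if "v \<in> kernel_carrier (sqmat n T)" for v
    by (rule T.inv_equality)
      (use that kernel_carrier_vec[OF that] kernel_closed(2)[OF kernel_zero that] in
        \<open>auto simp: kernel_group_simps intro!: eq_vecI\<close>)
  have sub: "kernel_carrier (sqmat n A) \<subseteq> kernel_carrier (sqmat n T)"
  proof
    fix v assume v: "v \<in> kernel_carrier (sqmat n A)"
    then obtain x where x: "v = kvec n x" "\<And>i. i < n \<Longrightarrow> lin n A x i \<in> Zp"
      by (rule kernel_cases) blast
    show "v \<in> kernel_carrier (sqmat n T)"
      unfolding car using k[OF x(2)]
      by (simp add: x(1) scale_prufer_of_padic of_padic_eq_0_iff)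
  qed
  have "subgroup (kernel_carrier (sqmat n A)) (ker_grp n T)"
  proof (rule subgroup.intro)
    show "inv\<^bsub>ker_grp n T\<^esub> v \<in> kernel_carrier (sqmat n A)" if "v \<in> kernel_carrier (sqmat n A)" for v
      using inv[of v] sub that kernel_closed(2)[OF kernel_zero that] by auto
  qed (use sub kernel_closed(1) kernel_zero[of n A] in \<open>auto simp: kernel_group_simps\<close>)
  then have "card (kernel_carrier (sqmat n A)) dvd CARD('p) ^ (k * n)"
    using T.lagrange[of "kernel_carrier (sqmat n A)"] card
    by (metis order_def kernel_group_simps(1) dvd_triv_right)
  then have "\<exists>l. card (kernel_carrier (sqmat n A)) = CARD('p) ^ l"
    using prime_card[where 'a='p] by (auto simp: divides_primepow_nat)
  \<comment> \<open>\<open>card\<close> is 0 on infinite sets, so a cardinality that is a power of p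
    certifies finiteness.\<close>
  moreover have "finite (kernel_carrier (sqmat n A))"
    using sub card prime_card[where 'a='p] by (metis card.infinite finite_subset power_not_zero not_prime_0)
  ultimately show ?thesis
    by (simp add: finite_abelian_p_group_def comm_group_ker_grp order_def kernel_group_simps)
qed

section \<open>Symmetry and perfectness of the pairing on the kernel\<close>

lemma symmetric_pairing_ker_grp:
  fixes A :: "nat \<Rightarrow> nat \<Rightarrow> 'p::prime_card padic_int"
  assumes sym: "\<And>i j. A i j = A j i"
  shows "symmetric_pairing (ker_grp n A)"
  unfolding symmetric_pairing_def kernel_group_simps
proof (intro conjI ballI)
  let ?K = "kernel_carrier (sqmat n A)"
  fix v assume v: "v \<in> ?K"
  then obtain x where x: "v = kvec n x" by (rule kernel_cases) blast
  show "kernel_pairing (sqmat n A) v w = kernel_pairing (sqmat n A) w v" if w: "w \<in> ?K" for w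
  proof -
    obtain y where y: "w = kvec n y" using w by (rule kernel_cases) blast
    show ?thesis using v w unfolding x y
      by (simp add: kernel_pairing_kvec[where A=A, OF sym] bil_commute[of A n x y, OF sym])
  qed
  show "kernel_pairing (sqmat n A) v \<in> hom (ker_grp n A) prufer_group"
  proof (rule homI)
    show "kernel_pairing (sqmat n A) v w \<in> carrier prufer_group" for w by (simp add: prufer_group_def)
    fix w u assume "w \<in> carrier (ker_grp n A)" "u \<in> carrier (ker_grp n A)"
    then have wu: "w \<in> ?K" "u \<in> ?K" by (simp_all add: kernel_group_simps)
    obtain y where y: "w = kvec n y" using wu(1) by (rule kernel_cases) blast
    obtain z where z: "u = kvec n z" using wu(2) by (rule kernel_cases) blast
    have "kernel_pairing (sqmat n A) v (w + u) = kernel_pairing (sqmat n A) v w + kernel_pairing (sqmat n A) v u"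
      using v wu kernel_closed(1)[OF wu] unfolding x y z kvec_add
      by (simp add: kernel_pairing_kvec[where A=A, OF sym] bil_add_right of_padic_add)
    then show "kernel_pairing (sqmat n A) v (w \<otimes>\<^bsub>ker_grp n A\<^esub> u) =
        kernel_pairing (sqmat n A) v w \<otimes>\<^bsub>prufer_group\<^esub> kernel_pairing (sqmat n A) v u"
      by (simp add: kernel_group_simps prufer_group_def)
  qed
qed

text \<open>The classes of the dual basis generate the kernel over \<open>\<int>\<^sub>p\<close>: x
  is the combination of the \<open>y j\<close> with the integral coefficients (A x)_j. The induction
  on partial sums keeps every intermediate vector in the kernel, where h is additive.\<close>

lemma kernel_hom_dual_basis:
  fixes A :: "nat \<Rightarrow> nat \<Rightarrow> 'p::prime_card padic_int" and h :: "_ \<Rightarrow> 'p prufer"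
  assumes D: "Determinant.det (sqmat n A) \<noteq> 0"
    and add: "\<And>v w. v \<in> kernel_carrier (sqmat n A) \<Longrightarrow> w \<in> kernel_carrier (sqmat n A) \<Longrightarrow> h (v + w) = h v + h w"
    and y1: "\<And>i j. i < n \<Longrightarrow> j < n \<Longrightarrow> lin n A (y j) i = (if i = j then 1 else 0)"
    and y2: "\<And>x i. i < n \<Longrightarrow> x i = (\<Sum>j<n. lin n A x j * y j i)"
    and x: "\<And>i. i < n \<Longrightarrow> lin n A x i = to_fract (z i)"
  shows "h (kvec n x) = (\<Sum>j<n. scale_prufer (z j) (h (kvec n (y j))))"
proof -
  let ?K = "kernel_carrier (sqmat n A)"
  have yK: "kvec n (y j) \<in> ?K" if "j < n" for j
    using y1 that by (auto simp: kvec_in_kernel_iff)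
  have "h (0\<^sub>v n + 0\<^sub>v n) = h (0\<^sub>v n) + h (0\<^sub>v n)" by (intro add kernel_zero)
  then have zero: "h (0\<^sub>v n) = 0" by simp
  have "m \<le> n \<Longrightarrow> kvec n (\<lambda>i. \<Sum>j<m. to_fract (z j) * y j i) \<in> ?K \<and>
     h (kvec n (\<lambda>i. \<Sum>j<m. to_fract (z j) * y j i)) = (\<Sum>j<m. scale_prufer (z j) (h (kvec n (y j))))" for m
  proof (induction m)
    case 0
    show ?case using zero kernel_zero[of n A] by (simp add: kvec_0)
  next
    case (Suc m)
    have m: "m < n" using Suc.prems by simp
    have eq: "kvec n (\<lambda>i. \<Sum>j<Suc m. to_fract (z j) * y j i) =
       kvec n (\<lambda>i. \<Sum>j<m. to_fract (z j) * y j i) + map_vec (scale_prufer (z m)) (kvec n (y m))"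
      by (simp add: map_scale_kvec kvec_add)
    have IH: "kvec n (\<lambda>i. \<Sum>j<m. to_fract (z j) * y j i) \<in> ?K"
      "h (kvec n (\<lambda>i. \<Sum>j<m. to_fract (z j) * y j i)) = (\<Sum>j<m. scale_prufer (z j) (h (kvec n (y j))))"
      using Suc by auto
    have sK: "map_vec (scale_prufer (z m)) (kvec n (y m)) \<in> ?K"
      by (rule kernel_closed(3)[OF yK yK]) (rule m)+
    show ?case
      unfolding eq using add[OF IH(1) sK] IH kernel_closed(1)[OF IH(1) sK] additive_scale[OF D add yK[OF m], of "z m"]
      by simp
  qed
  from this[of n] have "h (kvec n (\<lambda>i. \<Sum>j<n. to_fract (z j) * y j i)) = (\<Sum>j<n. scale_prufer (z j) (h (kvec n (y j))))"
    by simp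
  moreover have "kvec n (\<lambda>i. \<Sum>j<n. to_fract (z j) * y j i) = kvec n x"
    unfolding kvec_eq_iff
  proof (intro allI impI)
    fix i assume "i < n"
    then have "x i = (\<Sum>j<n. lin n A x j * y j i)" by (rule y2)
    also have "\<dots> = (\<Sum>j<n. to_fract (z j) * y j i)" by (intro sum.cong refl) (simp add: x)
    finally show "(\<Sum>j<n. to_fract (z j) * y j i) - x i \<in> Zp" by simp
  qed
  ultimately show ?thesis by simp
qed

text \<open>Pairing with the dual basis vector \<open>y j\<close> reads off coordinate j, which
  gives injectivity. For surjectivity, lifts of the values of h on the dual basis are the
  coordinates of a vector u that represents h.\<close>

lemma perfect_pairing_ker_grp:
  fixes A :: "nat \<Rightarrow> nat \<Rightarrow> 'p::prime_card padic_int"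
  assumes sym: "\<And>i j. A i j = A j i" and D: "Determinant.det (sqmat n A) \<noteq> 0"
  shows "perfect_pairing (ker_grp n A)"
proof -
  let ?K = "kernel_carrier (sqmat n A)" and ?b = "kernel_pairing (sqmat n A)"
  obtain y where y1: "\<And>i j. i < n \<Longrightarrow> j < n \<Longrightarrow> lin n A (y j) i = (if i = j then 1 else 0)"
    and y2: "\<And>x i. i < n \<Longrightarrow> x i = (\<Sum>j<n. lin n A x j * y j i)"
    by (rule inverse_matrix[OF D]) blast
  have yK: "kvec n (y j) \<in> ?K" if "j < n" for j
    using y1 that by (auto simp: kvec_in_kernel_iff)
  have bil_y: "bil n A x (y j) = x j" if "j < n" for x j
  proof -
    have "bil n A x (y j) = (\<Sum>i<n. if i = j then x i else 0)"
      unfolding bil_def using that by (intro sum.cong) (auto simp: y1)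
    then show ?thesis using that by simp
  qed
  have "bij_betw (\<lambda>v. restrict (?b v) ?K) ?K (hom (ker_grp n A) prufer_group \<inter> extensional ?K)"
  proof (rule bij_betw_imageI)
    show "inj_on (\<lambda>v. restrict (?b v) ?K) ?K"
    proof (rule inj_onI)
      fix v w assume vw: "v \<in> ?K" "w \<in> ?K" and eq: "restrict (?b v) ?K = restrict (?b w) ?K"
      obtain x where x: "v = kvec n x" using vw(1) by (rule kernel_cases) blast
      obtain z where z: "w = kvec n z" using vw(2) by (rule kernel_cases) blast
      have "x j - z j \<in> Zp" if "j < n" for j
      proof -
        have "?b v (kvec n (y j)) = ?b w (kvec n (y j))"
          using fun_cong[OF eq, of "kvec n (y j)"] yK[OF that] by simp
        then show ?thesis using vw yK[OF that] unfolding x z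
          by (simp add: kernel_pairing_kvec[where A=A, OF sym] bil_y[OF that] of_padic_eq_iff)
      qed
      then show "v = w" by (simp add: x z kvec_eq_iff)
    qed
    show "(\<lambda>v. restrict (?b v) ?K) ` ?K = hom (ker_grp n A) prufer_group \<inter> extensional ?K"
    proof (intro equalityI subsetI)
      fix f :: "'p prufer Matrix.vec \<Rightarrow> 'p prufer"
      assume "f \<in> (\<lambda>v. restrict (?b v) ?K) ` ?K"
      then obtain v where v: "v \<in> ?K" "f = restrict (?b v) ?K" by blast
      have "?b v \<in> hom (ker_grp n A) prufer_group"
        using symmetric_pairing_ker_grp[where A=A and n=n, OF sym] v(1)
        by (simp add: symmetric_pairing_def kernel_group_simps)
      then show "f \<in> hom (ker_grp n A) prufer_group \<inter> extensional ?K"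
        unfolding v(2) by (auto simp: hom_def kernel_group_simps kernel_closed(1))
    next
      fix h :: "'p prufer Matrix.vec \<Rightarrow> 'p prufer"
      assume h: "h \<in> hom (ker_grp n A) prufer_group \<inter> extensional ?K"
      have add: "h (v + w) = h v + h w" if "v \<in> ?K" "w \<in> ?K" for v w
        using h that by (auto simp: hom_def kernel_group_simps prufer_group_def)
      define u where "u j = rep_prufer (h (kvec n (y j)))" for j
      have hu: "h (kvec n x) = of_padic (\<Sum>j<n. to_fract (z j) * u j)"
        if "\<And>i. i < n \<Longrightarrow> lin n A x i = to_fract (z i)" for x z
        using kernel_hom_dual_basis[where h=h and x=x and z=z, OF D add y1 y2 that]
        by (simp add: of_padic_sum scale_prufer_def u_def)
      have uK: "kvec n u \<in> ?K" unfolding kvec_in_kernel_iff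
      proof (intro allI impI)
        fix i assume i: "i < n"
        \<comment> \<open>The unit vector e has class 0, so h vanishes on it, while the formula for
          h gives coordinate i of A u. Hence A u is integral.\<close>
        define e :: "nat \<Rightarrow> 'p padic" where "e k = (if k = i then 1 else 0)" for k
        have "lin n A e k = to_fract (A k i)" for k
        proof -
          have "lin n A e k = (\<Sum>j<n. if j = i then to_fract (A k j) else 0)"
            unfolding lin_def by (intro sum.cong) (auto simp: e_def)
          then show ?thesis using i by simp
        qed
        then have "h (kvec n e) = of_padic (\<Sum>j<n. to_fract (A j i) * u j)" by (rule hu)
        also have "(\<Sum>j<n. to_fract (A j i) * u j) = lin n A u i"
          unfolding lin_def by (intro sum.cong refl, subst sym) simp
        finally have "of_padic (lin n A u i) = h (kvec n e)" ..
        also have "kvec n e = kvec n (\<lambda>_. 0)" by (simp add: kvec_eq_iff e_def)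
        also have "h (kvec n (\<lambda>_. 0)) = of_padic (\<Sum>j<n. to_fract 0 * u j)"
          by (rule hu) (simp add: lin_def)
        finally show "lin n A u i \<in> Zp" by (simp add: of_padic_eq_0_iff)
      qed
      have "h = restrict (?b (kvec n u)) ?K"
      proof (rule extensionalityI[of _ ?K])
        fix w assume w: "w \<in> ?K"
        then obtain x where x: "w = kvec n x" "\<And>i. i < n \<Longrightarrow> lin n A x i \<in> Zp" by (rule kernel_cases) blast
        then have "\<forall>i. \<exists>c. i < n \<longrightarrow> lin n A x i = to_fract c" by blast
        then obtain z where z: "\<And>i. i < n \<Longrightarrow> lin n A x i = to_fract (z i)" by metis
        have "h w = of_padic (\<Sum>j<n. to_fract (z j) * u j)" unfolding x(1) by (rule hu[OF z])
        also have "(\<Sum>j<n. to_fract (z j) * u j) = bil n A u x"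
          unfolding bil_def by (intro sum.cong refl) (simp add: z mult.commute)
        also have "of_padic (bil n A u x) = ?b (kvec n u) w"
          using w uK unfolding x(1) by (simp add: kernel_pairing_kvec[where A=A, OF sym])
        finally show "h w = restrict (?b (kvec n u)) ?K w" using w by simp
      qed (use h in auto)
      then show "h \<in> (\<lambda>v. restrict (?b v) ?K) ` ?K" using uK by blast
    qed
  qed
  then show ?thesis by (simp add: perfect_pairing_def kernel_group_simps)
qed

section \<open>Finite kernels belong to non-singular matrices only\<close>

lemma of_nat_padic_int_neq_0:
  assumes "m \<noteq> 0"
  shows "(of_nat m :: 'p::prime_card padic_int) \<noteq> 0"
proof
  assume "(of_nat m :: 'p padic_int) = 0"
  \<comment> \<open>Level m is fine enough because m < p^m.\<close>
  then have "residue (of_nat m :: 'p padic_int) m = 0" by (simp add: zero_padic_int.rep_eq)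
  then have "int m mod int (CARD('p) ^ m) = 0" unfolding residue_of_nat by simp
  then have "m mod CARD('p) ^ m = 0" by (metis of_nat_0_eq_iff of_nat_mod)
  moreover have "m < CARD('p) ^ m"
    using prime_card[where 'a='p] by (intro power_gt_expt) (simp add: prime_gt_Suc_0_nat)
  ultimately show False using assms by simp
qed

text \<open>A singular matrix has a line in its kernel, and its points are not killed by any positive integer.\<close>

lemma det_neq_0_if_finite_kernel:
  fixes A :: "nat \<Rightarrow> nat \<Rightarrow> 'p::prime_card padic_int"
  assumes fin: "finite (kernel_carrier (sqmat n A))"
  shows "Determinant.det (sqmat n A) \<noteq> 0"
proof
  assume "Determinant.det (sqmat n A) = 0"
  then obtain v where v: "v \<in> carrier_vec n" "v \<noteq> 0\<^sub>v n" "sqmat n A *\<^sub>v v = 0\<^sub>v n"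
    using det_0_iff_vec_prod_zero[of "sqmat n A" n] by auto
  define x where "x i = to_fract (vec_index v i)" for i
  have Ax: "lin n A x i = 0" if "i < n" for i
  proof -
    have "lin n A x i = to_fract (vec_index (sqmat n A *\<^sub>v v) i)"
      using that v(1) by (simp add: lin_def x_def scalar_prod_def atLeast0LessThan)
    then show ?thesis using that by (simp add: v(3))
  qed
  obtain i where i: "i < n" "vec_index v i \<noteq> 0" using v(1,2) by (auto simp: vec_eq_iff)
  interpret G: comm_group "ker_grp n A" by (rule comm_group_ker_grp)
  define m where "m = card (kernel_carrier (sqmat n A))"
  have "m \<noteq> 0" using fin kernel_zero[of n A] by (auto simp: m_def)
  then have m0: "to_fract (of_nat m :: 'p padic_int) \<noteq> 0" using of_nat_padic_int_neq_0 by simp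
  have p0: "to_fract (of_nat CARD('p) :: 'p padic_int) \<noteq> 0" using of_nat_CARD_neq_0[where 'p='p] by simp
  have x0: "x i \<noteq> 0" using i(2) by (simp add: x_def)
  have pow: "kvec n u [^]\<^bsub>ker_grp n A\<^esub> (l :: nat) = kvec n (\<lambda>i. to_fract (of_nat l) * u i)" for l u
    by (induction l) (simp_all add: kernel_group_simps nat_pow_def kvec_0 kvec_add algebra_simps)
  \<comment> \<open>The scale is chosen so that m times coordinate i of c x equals 1/p, which is not
    integral, although the group order m annihilates every element.\<close>
  define c where "c = 1 / (to_fract (of_nat m) * to_fract (of_nat CARD('p)) * x i)"
  have "kvec n (\<lambda>i. c * x i) \<in> carrier (ker_grp n A)"
    by (simp add: kernel_group_simps kvec_in_kernel_iff lin_scale Ax)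
  from G.pow_order_eq_1[OF this] have "kvec n (\<lambda>i. to_fract (of_nat m) * (c * x i)) = 0\<^sub>v n"
    unfolding pow by (simp add: order_def m_def kernel_group_simps)
  then have "to_fract (of_nat m) * (c * x i) \<in> Zp"
    using i(1) by (simp add: kvec_0 kvec_eq_iff)
  also have "to_fract (of_nat m) * (c * x i) = 1 / to_fract (of_nat CARD('p))"
    using m0 p0 x0 by (simp add: c_def)
  finally obtain z :: "'p padic_int" where "1 / to_fract (of_nat CARD('p)) = to_fract z" by (rule imageE)
  then have "1 = to_fract z * to_fract (of_nat CARD('p))"
    using p0 by (metis nonzero_eq_divide_eq)
  then have "to_fract 1 = to_fract (z * of_nat CARD('p))" by simp
  then have "1 = z * of_nat CARD('p)" by (simp only: to_fract_eq_iff)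
  then show False using not_prime_dvd_one[where 'p='p] by (metis dvd_triv_right)
qed

section \<open>Isomorphism classes\<close>

lemma iso_class_eq:
  fixes G :: "('a, 'p::prime_card) pairing_group" and H :: "('b, 'p) pairing_group"
  assumes "group G" "group H" "pairing_iso G H"
  shows "iso_class G = iso_class H"
proof -
  have "pairing_iso G K \<longleftrightarrow> pairing_iso H K" for K :: "(nat, 'p) pairing_group"
    using pairing_iso_trans[OF assms(3), of K] pairing_iso_trans[OF pairing_iso_sym[OF assms(1,3)], of K]
    by blast
  then show ?thesis by (simp add: iso_class_def)
qed

lemma pairing_iso_if_iso_class_eq:
  fixes H :: "(nat, 'p::prime_card) pairing_group"
  assumes "comm_group H" "iso_class G = iso_class H"
  shows "pairing_iso G H"
  using assms pairing_iso_refl[of H] unfolding iso_class_def by blast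

lemma perfect_symmetric_p_groupsE:
  assumes "s \<in> perfect_symmetric_p_groups"
  obtains H :: "(nat, 'p::prime_card) pairing_group"
  where "s = iso_class H" "comm_group H" "finite (carrier H)"
  using assms unfolding perfect_symmetric_p_groups_def finite_abelian_p_group_def by blast

text \<open>A homomorphism on H is pulled back along h, represented by an element of G, and the
  representing element is pushed forward again.\<close>

lemma perfect_pairing_transfer:
  fixes G :: "('a, 'p::prime_card) pairing_group" and H :: "('b, 'p) pairing_group"
  assumes G: "group G" and h: "h \<in> iso G H"
    and pres: "\<And>x y. x \<in> carrier G \<Longrightarrow> y \<in> carrier G \<Longrightarrow> pairing H (h x) (h y) = pairing G x y"
    and perf: "perfect_pairing G"
  shows "perfect_pairing H"
proof -
  let ?g = "inv_into (carrier G) h"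
  have hom: "h \<in> hom G H" and bij: "bij_betw h (carrier G) (carrier H)"
    using h by (auto simp: iso_def)
  have g: "?g \<in> hom H G" using group.iso_set_sym[OF G h] by (simp add: iso_def)
  have hG: "h x \<in> carrier H" if "x \<in> carrier G" for x using bij that by (auto simp: bij_betw_def)
  have gh: "?g (h x) = x" if "x \<in> carrier G" for x using bij that by (simp add: bij_betw_inv_into_left)
  have hg: "h (?g y) = y" if "y \<in> carrier H" for y using bij that by (simp add: bij_betw_inv_into_right)
  have gH: "?g y \<in> carrier G" if "y \<in> carrier H" for y
    using g that by (auto simp: hom_def)
  note perf' = perf[unfolded perfect_pairing_def]
  have homG: "pairing G x \<in> hom G prufer_group" if "x \<in> carrier G" for x
  proof -
    have "restrict (pairing G x) (carrier G) \<in> hom G prufer_group"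
      using perf' that by (auto simp: bij_betw_def)
    then show ?thesis using group.is_monoid[OF G]
      by (auto simp: hom_def monoid.m_closed prufer_group_def)
  qed
  have eq: "pairing H y z = pairing G (?g y) (?g z)" if "y \<in> carrier H" "z \<in> carrier H" for y z
    using pres[OF gH[OF that(1)] gH[OF that(2)]] that by (simp add: hg)
  show ?thesis unfolding perfect_pairing_def
  proof (rule bij_betw_imageI)
    show "inj_on (\<lambda>y. restrict (pairing H y) (carrier H)) (carrier H)"
    proof (rule inj_onI)
      fix y z assume yz: "y \<in> carrier H" "z \<in> carrier H"
        and e: "restrict (pairing H y) (carrier H) = restrict (pairing H z) (carrier H)"
      have "pairing G (?g y) x = pairing G (?g z) x" if "x \<in> carrier G" for x
        using fun_cong[OF e, of "h x"] hG[OF that] yz by (simp add: eq gh[OF that])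
      then have "restrict (pairing G (?g y)) (carrier G) = restrict (pairing G (?g z)) (carrier G)"
        by (auto simp: restrict_def)
      then have "?g y = ?g z"
        using perf' gH[OF yz(1)] gH[OF yz(2)] by (auto simp: bij_betw_def inj_on_def)
      then show "y = z" using hg yz by metis
    qed
    show "(\<lambda>y. restrict (pairing H y) (carrier H)) ` carrier H =
        hom H prufer_group \<inter> extensional (carrier H)"
    proof (intro equalityI subsetI)
      fix f :: "'b \<Rightarrow> 'p prufer" assume "f \<in> (\<lambda>y. restrict (pairing H y) (carrier H)) ` carrier H"
      then obtain y where y: "y \<in> carrier H" "f = restrict (pairing H y) (carrier H)" by blast
      have "f (u \<otimes>\<^bsub>H\<^esub> v) = f u + f v" if uv: "u \<in> carrier H" "v \<in> carrier H" for u v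
      proof -
        have "u \<otimes>\<^bsub>H\<^esub> v \<in> carrier H"
          using hg[OF uv(1)] hg[OF uv(2)] hG[of "?g u \<otimes>\<^bsub>G\<^esub> ?g v"] gH[OF uv(1)] gH[OF uv(2)]
            hom monoid.m_closed[OF group.is_monoid[OF G]] by (simp add: hom_def)
        then show ?thesis
          using uv y homG[OF gH[OF y(1)]] g gH by (simp add: eq hom_def prufer_group_def)
      qed
      then show "f \<in> hom H prufer_group \<inter> extensional (carrier H)"
        by (simp add: hom_def y(2) prufer_group_def)
    next
      fix f :: "'b \<Rightarrow> 'p prufer" assume f: "f \<in> hom H prufer_group \<inter> extensional (carrier H)"
      have "restrict (f \<circ> h) (carrier G) \<in> hom G prufer_group \<inter> extensional (carrier G)"
        using f hom group.is_monoid[OF G]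
        by (auto simp: hom_def monoid.m_closed Pi_iff)
      then obtain x where x: "x \<in> carrier G" "restrict (f \<circ> h) (carrier G) = restrict (pairing G x) (carrier G)"
        using perf' by (auto simp: bij_betw_def)
      have "f = restrict (pairing H (h x)) (carrier H)"
      proof (rule extensionalityI[of _ "carrier H"])
        fix y assume y: "y \<in> carrier H"
        have "f y = restrict (f \<circ> h) (carrier G) (?g y)" using y gH[OF y] by (simp add: hg)
        also have "\<dots> = pairing G x (?g y)" unfolding x(2) using gH[OF y] by simp
        also have "\<dots> = restrict (pairing H (h x)) (carrier H) y"
          using x(1) y hG by (simp add: eq gh)
        finally show "f y = restrict (pairing H (h x)) (carrier H) y" .
      qed (use f in auto)
      then show "f \<in> (\<lambda>y. restrict (pairing H y) (carrier H)) ` carrier H"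
        using hG[OF x(1)] by blast
    qed
  qed
qed

text \<open>Members of \<open>perfect_symmetric_p_groups\<close> are represented on natural numbers,
  so the whole structure is transported along an enumeration of the carrier.\<close>

lemma iso_class_in_perfect_symmetric_p_groups:
  fixes G :: "('a, 'p::prime_card) pairing_group"
  assumes fin: "finite_abelian_p_group G" and sym: "symmetric_pairing G" and perf: "perfect_pairing G"
  shows "iso_class G \<in> perfect_symmetric_p_groups"
proof -
  interpret G: comm_group G using fin by (simp add: finite_abelian_p_group_def)
  obtain e where e: "bij_betw e (carrier G) {0..<card (carrier G)}"
    using ex_bij_betw_finite_nat fin unfolding finite_abelian_p_group_def by blast
  define g where "g = inv_into (carrier G) e"
  define H :: "(nat, 'p) pairing_group" where
    "H = \<lparr>carrier = {0..<card (carrier G)}, mult = \<lambda>x y. e (g x \<otimes>\<^bsub>G\<^esub> g y), one = e \<one>\<^bsub>G\<^esub>,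
      pairing = \<lambda>x y. pairing G (g x) (g y)\<rparr>"
  have ge: "g (e x) = x" if "x \<in> carrier G" for x
    using e that by (simp add: g_def bij_betw_inv_into_left)
  have gH: "g y \<in> carrier G" if "y \<in> carrier H" for y
    using bij_betw_apply[OF bij_betw_inv_into[OF e]] that by (simp add: g_def H_def)
  have iso: "e \<in> iso G H"
    using e by (auto simp: iso_def hom_def H_def ge bij_betw_def)
  have pres: "pairing H (e x) (e y) = pairing G x y" if "x \<in> carrier G" "y \<in> carrier G" for x y
    using that by (simp add: H_def ge)
  \<comment> \<open>\<open>iso_imp_img_group\<close> speaks of H with its unit replaced by the image
    of the unit, which here is the unit already.\<close>
  have "H\<lparr>one := e \<one>\<^bsub>G\<^esub>\<rparr> = H" by (simp add: H_def)
  then have grp: "group H" using G.iso_imp_img_group[OF iso] by simp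
  have comm: "comm_group H"
    by (rule G.iso_imp_comm_group) (use iso grp in \<open>auto simp: is_iso_def group.is_monoid\<close>)
  have "finite_abelian_p_group H"
    using fin comm by (simp add: finite_abelian_p_group_def order_def) (simp add: H_def)
  moreover have "symmetric_pairing H"
  proof -
    have gm: "g (x \<otimes>\<^bsub>H\<^esub> y) = g x \<otimes>\<^bsub>G\<^esub> g y" if "x \<in> carrier H" "y \<in> carrier H" for x y
      using gH[OF that(1)] gH[OF that(2)] by (simp add: H_def ge)
    show ?thesis
      using sym gH gm unfolding symmetric_pairing_def
      by (simp add: hom_def prufer_group_def) (simp add: H_def)
  qed
  moreover have "perfect_pairing H"
    by (rule perfect_pairing_transfer[OF G.is_group iso pres perf])
  moreover have "iso_class G = iso_class H"
    by (rule iso_class_eq[OF G.is_group grp pairing_isoI[OF iso pres]])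
  ultimately show ?thesis unfolding perfect_symmetric_p_groups_def by blast
qed

text \<open>A finite group with pairing is determined up to isomorphism by three lists: its
  elements, its multiplication table and its table of pairing values. Decoding may pick any group
  with the given lists.\<close>

lemma countable_perfect_symmetric_p_groups:
  "countable (perfect_symmetric_p_groups :: (nat, 'p::prime_card) pairing_group set set)"
proof -
  define elems :: "(nat, 'p) pairing_group \<Rightarrow> nat list" where "elems G = sorted_list_of_set (carrier G)" for G
  define code where "code G = (elems G, map (\<lambda>(x, y). x \<otimes>\<^bsub>G\<^esub> y) (List.product (elems G) (elems G)),
    map (\<lambda>(x, y). pairing G x y) (List.product (elems G) (elems G)))" for G :: "(nat, 'p) pairing_group"
  have iso: "pairing_iso G H" if fin: "finite (carrier G)" "finite (carrier H)" and eq: "code G = code H"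
    for G H :: "(nat, 'p) pairing_group"
  proof -
    have el: "elems G = elems H" using eq by (simp add: code_def)
    have set: "set (elems G) = carrier G" "set (elems H) = carrier H" using fin by (simp_all add: elems_def)
    then have car: "carrier G = carrier H" using el by simp
    have "x \<otimes>\<^bsub>G\<^esub> y = x \<otimes>\<^bsub>H\<^esub> y \<and> pairing G x y = pairing H x y" if "x \<in> carrier G" "y \<in> carrier G" for x y
    proof -
      have "(x, y) \<in> set (List.product (elems G) (elems G))" using that set by simp
      moreover have
        "map (\<lambda>(x, y). x \<otimes>\<^bsub>G\<^esub> y) (List.product (elems G) (elems G)) = map (\<lambda>(x, y). x \<otimes>\<^bsub>H\<^esub> y) (List.product (elems G) (elems G))"
        "map (\<lambda>(x, y). pairing G x y) (List.product (elems G) (elems G)) = map (\<lambda>(x, y). pairing H x y) (List.product (elems G) (elems G))"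
        using eq el by (simp_all add: code_def)
      ultimately show ?thesis unfolding map_eq_conv by fastforce
    qed
    then show ?thesis
      by (intro pairing_isoI[of "\<lambda>x. x"]) (auto simp: iso_def hom_def bij_betw_def car[symmetric] monoid.m_closed)
  qed
  define good where "good G \<longleftrightarrow> comm_group G \<and> finite (carrier G)" for G :: "(nat, 'p) pairing_group"
  have "perfect_symmetric_p_groups \<subseteq>
      (\<lambda>c. iso_class (SOME G. good G \<and> code G = c)) ` (lists UNIV \<times> lists UNIV \<times> lists UNIV)"
  proof
    fix s :: "(nat, 'p) pairing_group set" assume "s \<in> perfect_symmetric_p_groups"
    then obtain G :: "(nat, 'p) pairing_group" where G: "s = iso_class G" "comm_group G" "finite (carrier G)"
      by (rule perfect_symmetric_p_groupsE)
    define G' where "G' = (SOME G'. good G' \<and> code G' = code G)"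
    have G': "good G' \<and> code G' = code G"
      unfolding G'_def by (rule someI[of _ G]) (use G in \<open>simp add: good_def\<close>)
    then have "iso_class G' = iso_class G"
      using G iso[of G' G] by (intro iso_class_eq) (auto simp: good_def comm_group.axioms(2))
    then show "s \<in> (\<lambda>c. iso_class (SOME G. good G \<and> code G = c)) ` (lists UNIV \<times> lists UNIV \<times> lists UNIV)"
      unfolding G(1) by (intro image_eqI[of _ _ "code G"]) (simp only: G'_def, simp add: code_def)
  qed
  moreover have "countable (lists UNIV \<times> lists UNIV \<times> lists UNIV :: (nat list \<times> nat list \<times> 'p prufer list) set)"
    by (intro countable_SIGMA countable_lists countable_prufer countableI_type)
  ultimately show ?thesis by (rule countable_subset[OF _ countable_image])
qed

section \<open>Classes of kernels\<close>

lemma group_ker_grp: "group (ker_grp n A)"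
  by (rule comm_group.axioms(2)[OF comm_group_ker_grp])

lemma iso_class_ker_grp_in:
  fixes A :: "nat \<Rightarrow> nat \<Rightarrow> 'p::prime_card padic_int"
  assumes "\<And>i j. A i j = A j i" "Determinant.det (sqmat n A) \<noteq> 0"
  shows "iso_class (ker_grp n A) \<in> perfect_symmetric_p_groups"
  using assms by (intro iso_class_in_perfect_symmetric_p_groups finite_abelian_p_group_ker_grp
      symmetric_pairing_ker_grp perfect_pairing_ker_grp)

text \<open>Members of the class are finite, hence so is the kernel. This keeps singular matrices
  out of every event that prescribes a class from \<open>perfect_symmetric_p_groups\<close>.\<close>

lemma det_neq_0_if_iso_class_in:
  fixes A :: "nat \<Rightarrow> nat \<Rightarrow> 'p::prime_card padic_int"
  assumes "iso_class (ker_grp n A) \<in> perfect_symmetric_p_groups"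
  shows "Determinant.det (sqmat n A) \<noteq> 0"
proof -
  obtain H :: "(nat, 'p) pairing_group"
    where H: "iso_class (ker_grp n A) = iso_class H" "comm_group H" "finite (carrier H)"
    using assms by (rule perfect_symmetric_p_groupsE)
  have "pairing_iso (ker_grp n A) H" by (rule pairing_iso_if_iso_class_eq[OF H(2,1)])
  then have "finite (carrier (ker_grp n A))"
    unfolding pairing_iso_def using H(3) by (auto simp: iso_def bij_betw_finite)
  then show ?thesis by (intro det_neq_0_if_finite_kernel) (simp add: kernel_group_simps)
qed

text \<open>The kernels live on vectors and are not themselves members of their classes, so a common
  representative H on natural numbers mediates.\<close>

lemma pairing_iso_ker_grp_if_iso_class_eq:
  fixes A A' :: "nat \<Rightarrow> nat \<Rightarrow> 'p::prime_card padic_int"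
  assumes "iso_class (ker_grp n A) \<in> perfect_symmetric_p_groups"
    and "iso_class (ker_grp n A) = iso_class (ker_grp n A')"
  shows "pairing_iso (ker_grp n A) (ker_grp n A')"
proof -
  obtain H :: "(nat, 'p) pairing_group" where H: "iso_class (ker_grp n A) = iso_class H" "comm_group H"
    using assms(1) by (rule perfect_symmetric_p_groupsE)
  have "pairing_iso (ker_grp n A) H" "pairing_iso (ker_grp n A') H"
    using pairing_iso_if_iso_class_eq[OF H(2)] H(1) assms(2) by auto
  then show ?thesis using pairing_iso_trans pairing_iso_sym[OF group_ker_grp] by blast
qed

section \<open>Locally constant events\<close>

text \<open>For finite K these are the open conditions on the coordinates in K. One notion provides
  measurability, dependence on K alone (\<open>open_cylinder_cong\<close>) and stability under
  freezing coordinates (\<open>open_cylinder_override_on\<close>).\<close>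

definition open_cylinder :: "'i set \<Rightarrow> (('i \<Rightarrow> 'p::prime_card padic_int) \<Rightarrow> bool) \<Rightarrow> bool" where
  "open_cylinder K Q \<longleftrightarrow> (\<forall>f. Q f \<longrightarrow> (\<exists>N. \<forall>g. (\<forall>i\<in>K. residue (g i) N = residue (f i) N) \<longrightarrow> Q g))"

lemma open_cylinderI:
  assumes "\<And>f. Q f \<Longrightarrow> \<exists>N. \<forall>g. (\<forall>i\<in>K. residue (g i) N = residue (f i) N) \<longrightarrow> Q g"
  shows "open_cylinder K Q"
  using assms by (simp add: open_cylinder_def)

lemma open_cylinderD:
  assumes "open_cylinder K Q" "Q f"
  obtains N where "\<And>g. (\<And>i. i \<in> K \<Longrightarrow> residue (g i) N = residue (f i) N) \<Longrightarrow> Q g"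
  using assms unfolding open_cylinder_def by meson

lemma open_cylinder_cong:
  assumes "open_cylinder K Q" "\<And>i. i \<in> K \<Longrightarrow> f i = g i"
  shows "Q f \<longleftrightarrow> Q g"
proof -
  have "Q g'" if "Q f'" "\<And>i. i \<in> K \<Longrightarrow> f' i = g' i" for f' g'
    using open_cylinderD[OF assms(1) that(1)] that(2) by metis
  then show ?thesis using assms(2) by metis
qed

lemma open_cylinder_mono:
  assumes "open_cylinder K Q" "K \<subseteq> L"
  shows "open_cylinder L Q"
  using assms unfolding open_cylinder_def by (meson subsetD)

lemma open_cylinder_conj:
  assumes "open_cylinder K P" "open_cylinder K Q"
  shows "open_cylinder K (\<lambda>f. P f \<and> Q f)"
proof (rule open_cylinderI)
  fix f assume f: "P f \<and> Q f"
  obtain N where N: "\<And>g. (\<And>i. i \<in> K \<Longrightarrow> residue (g i) N = residue (f i) N) \<Longrightarrow> P g"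
    using open_cylinderD[OF assms(1)] f by blast
  obtain N' where N': "\<And>g. (\<And>i. i \<in> K \<Longrightarrow> residue (g i) N' = residue (f i) N') \<Longrightarrow> Q g"
    using open_cylinderD[OF assms(2)] f by blast
  show "\<exists>N. \<forall>g. (\<forall>i\<in>K. residue (g i) N = residue (f i) N) \<longrightarrow> P g \<and> Q g"
    by (rule exI[of _ "max N N'"])
      (meson N N' residue_cong_mono max.cobounded1 max.cobounded2)
qed

lemma open_cylinder_ball_finite:
  assumes "finite I" "\<And>i. i \<in> I \<Longrightarrow> open_cylinder K (Q i)"
  shows "open_cylinder K (\<lambda>f. \<forall>i\<in>I. Q i f)"
  using assms
proof (induction I rule: finite_induct)
  case empty
  then show ?case by (simp add: open_cylinder_def)
next
  case (insert i I)
  then show ?case using open_cylinder_conj[of K "Q i" "\<lambda>f. \<forall>i\<in>I. Q i f"] by simp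
qed

lemma open_cylinder_override_on:
  assumes "open_cylinder K Q"
  shows "open_cylinder (K - A) (\<lambda>g. Q (override_on g f A))"
proof (rule open_cylinderI)
  fix g assume "Q (override_on g f A)"
  then obtain N where N: "\<And>h. (\<And>i. i \<in> K \<Longrightarrow> residue (h i) N = residue (override_on g f A i) N) \<Longrightarrow> Q h"
    using open_cylinderD[OF assms] by blast
  have "Q (override_on h f A)" if "\<forall>i\<in>K - A. residue (h i) N = residue (g i) N" for h
    by (rule N) (use that in \<open>auto simp: override_on_def\<close>)
  then show "\<exists>N. \<forall>h. (\<forall>i\<in>K - A. residue (h i) N = residue (g i) N) \<longrightarrow> Q (override_on h f A)"
    by blast
qed

lemma sets_residue_eq:
  assumes "Z \<in> measurable M (borel :: 'p::prime_card padic_int measure)"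
  shows "{\<omega> \<in> space M. residue (Z \<omega>) N = r} \<in> sets M"
proof -
  have "open {x :: 'p padic_int. residue x N = r}"
    unfolding open_padic_int_def by (auto intro!: exI[of _ N])
  then have "Z -` {x. residue x N = r} \<inter> space M \<in> sets M"
    by (intro measurable_sets[OF assms]) simp
  also have "Z -` {x. residue x N = r} \<inter> space M = {\<omega> \<in> space M. residue (Z \<omega>) N = r}" by auto
  finally show ?thesis .
qed

text \<open>There are countably many boxes given by a level N and prescribed residues on K. An open
  condition is the union of the boxes on which it holds throughout.\<close>

lemma sets_open_cylinder:
  fixes Z :: "'i \<Rightarrow> 'w \<Rightarrow> 'p::prime_card padic_int"
  assumes fin: "finite K" and Z: "\<And>i. i \<in> K \<Longrightarrow> Z i \<in> measurable M borel"
    and Q: "open_cylinder K Q"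
    and P: "\<And>\<omega>. \<omega> \<in> space M \<Longrightarrow> P \<omega> \<longleftrightarrow> Q (\<lambda>i. Z i \<omega>)"
  shows "{\<omega> \<in> space M. P \<omega>} \<in> sets M"
proof -
  define B where "B N r = {\<omega> \<in> space M. \<forall>i\<in>K. residue (Z i \<omega>) N = r i}" for N and r :: "'i \<Rightarrow> int"
  have B: "B N r \<in> sets M" for N r
    unfolding B_def using fin by (intro sets.sets_Collect_finite_All sets_residue_eq Z)
  define I where "I = {(N, r) \<in> UNIV \<times> PiE K (\<lambda>_. UNIV). \<forall>\<omega>\<in>B N r. P \<omega>}"
  have "countable (UNIV \<times> PiE K (\<lambda>_. UNIV) :: (nat \<times> ('i \<Rightarrow> int)) set)"
    using fin by (intro countable_SIGMA countable_PiE) auto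
  then have "countable I" by (rule countable_subset[rotated]) (auto simp: I_def)
  then have "(\<Union>(N, r)\<in>I. B N r) \<in> sets M" using B by (intro sets.countable_UN') auto
  also have "(\<Union>(N, r)\<in>I. B N r) = {\<omega> \<in> space M. P \<omega>}"
  proof (intro equalityI subsetI)
    fix \<omega> assume "\<omega> \<in> (\<Union>(N, r)\<in>I. B N r)"
    then show "\<omega> \<in> {\<omega> \<in> space M. P \<omega>}" by (auto simp: I_def B_def)
  next
    fix \<omega> assume "\<omega> \<in> {\<omega> \<in> space M. P \<omega>}"
    then have \<omega>: "\<omega> \<in> space M" "Q (\<lambda>i. Z i \<omega>)" using P by auto
    obtain N where N: "\<And>g. (\<And>i. i \<in> K \<Longrightarrow> residue (g i) N = residue (Z i \<omega>) N) \<Longrightarrow> Q g"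
      using open_cylinderD[OF Q \<omega>(2)] by blast
    define r where "r = (\<lambda>i\<in>K. residue (Z i \<omega>) N)"
    have "P \<omega>'" if "\<omega>' \<in> B N r" for \<omega>'
      using that N[of "\<lambda>i. Z i \<omega>'"] P[of \<omega>'] by (auto simp: B_def r_def)
    then have "(N, r) \<in> I" by (auto simp: I_def r_def)
    moreover have "\<omega> \<in> B N r" using \<omega>(1) by (simp add: B_def r_def)
    ultimately show "\<omega> \<in> (\<Union>(N, r)\<in>I. B N r)" by blast
  qed
  finally show ?thesis .
qed

section \<open>Independent Haar variables\<close>

text \<open>Fubini for the joint law, with both marginals pulled back to M, so that \<omega>' acts
  as an independent copy of \<omega>.\<close>

lemma (in prob_space) emeasure_indep_var_pair:
  assumes ind: "indep_var S X T Y" and C: "C \<in> sets (S \<Otimes>\<^sub>M T)"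
  shows "emeasure M {\<omega> \<in> space M. (X \<omega>, Y \<omega>) \<in> C} =
    (\<integral>\<^sup>+\<omega>. emeasure M {\<omega>' \<in> space M. (X \<omega>, Y \<omega>') \<in> C} \<partial>M)"
proof -
  have X: "X \<in> measurable M S" and Y: "Y \<in> measurable M T"
    and eq: "distr M S X \<Otimes>\<^sub>M distr M T Y = distr M (S \<Otimes>\<^sub>M T) (\<lambda>x. (X x, Y x))"
    using ind unfolding indep_var_distribution_eq by auto
  interpret DY: prob_space "distr M T Y" by (rule prob_space_distr[OF Y])
  have C': "C \<in> sets (distr M S X \<Otimes>\<^sub>M distr M T Y)"
    using C by (simp cong: sets_pair_measure_cong)
  have "emeasure M {\<omega> \<in> space M. (X \<omega>, Y \<omega>) \<in> C} = emeasure (distr M (S \<Otimes>\<^sub>M T) (\<lambda>x. (X x, Y x))) C"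
    using X Y C by (subst emeasure_distr) (auto intro!: arg_cong2[where f = emeasure])
  also have "\<dots> = (\<integral>\<^sup>+x. emeasure (distr M T Y) (Pair x -` C) \<partial>distr M S X)"
    unfolding eq[symmetric] by (rule DY.emeasure_pair_measure_alt[OF C'])
  also have "\<dots> = (\<integral>\<^sup>+\<omega>. emeasure (distr M T Y) (Pair (X \<omega>) -` C) \<partial>M)"
    using DY.measurable_emeasure_Pair[OF C'] X by (intro nn_integral_distr) simp_all
  also have "\<dots> = (\<integral>\<^sup>+\<omega>. emeasure M {\<omega>' \<in> space M. (X \<omega>, Y \<omega>') \<in> C} \<partial>M)"
  proof (rule nn_integral_cong)
    fix \<omega>
    have "Pair (X \<omega>) -` C \<in> sets T" using C by (rule sets_Pair1)
    then show "emeasure (distr M T Y) (Pair (X \<omega>) -` C) = emeasure M {\<omega>' \<in> space M. (X \<omega>, Y \<omega>') \<in> C}"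
      using Y by (subst emeasure_distr) (auto intro!: arg_cong2[where f = emeasure])
  qed
  finally show ?thesis .
qed

text \<open>The coordinates in A stay at \<omega> and the others are resampled from an independent
  \<omega>'. This serves as conditioning on the coordinates in A.\<close>

lemma (in prob_space) emeasure_decouple:
  fixes Z :: "'i \<Rightarrow> 'a \<Rightarrow> 'p::prime_card padic_int"
  assumes ind: "indep_vars (\<lambda>_. borel) Z (A \<union> B)" and AB: "A \<inter> B = {}" "finite A" "finite B"
    and Q: "open_cylinder (A \<union> B) Q"
  shows "emeasure M {\<omega> \<in> space M. Q (\<lambda>i. Z i \<omega>)} =
    (\<integral>\<^sup>+\<omega>. emeasure M {\<omega>' \<in> space M. Q (override_on (\<lambda>i. Z i \<omega>') (\<lambda>i. Z i \<omega>) A)} \<partial>M)"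
proof -
  let ?X = "\<lambda>\<omega>. restrict (\<lambda>i. Z i \<omega>) A" and ?Y = "\<lambda>\<omega>. restrict (\<lambda>i. Z i \<omega>) B"
  let ?PA = "PiM A (\<lambda>_. borel :: 'p padic_int measure)" and ?PB = "PiM B (\<lambda>_. borel :: 'p padic_int measure)"
  have iv: "indep_var ?PA ?X ?PB ?Y"
    by (rule indep_var_restrict[OF ind AB(1)]) auto
  define C where "C = {z \<in> space (?PA \<Otimes>\<^sub>M ?PB). Q (override_on (snd z) (fst z) A)}"
  have C: "C \<in> sets (?PA \<Otimes>\<^sub>M ?PB)"
    unfolding C_def
  proof (rule sets_open_cylinder[OF _ _ Q])
    show "finite (A \<union> B)" using AB by simp
    show "(\<lambda>z. if i \<in> A then fst z i else snd z i) \<in> measurable (?PA \<Otimes>\<^sub>M ?PB) borel" if "i \<in> A \<union> B" for i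
      using that AB(1) by (cases "i \<in> A") auto
    show "Q (override_on (snd z) (fst z) A) \<longleftrightarrow> Q (\<lambda>i. if i \<in> A then fst z i else snd z i)" for z
      by (rule arg_cong[where f = Q]) (auto simp: override_on_def)
  qed
  have mem: "(?X \<omega>, ?Y \<omega>') \<in> C \<longleftrightarrow> Q (override_on (\<lambda>i. Z i \<omega>') (\<lambda>i. Z i \<omega>) A)" for \<omega> \<omega>'
  proof -
    have "(?X \<omega>, ?Y \<omega>') \<in> space (?PA \<Otimes>\<^sub>M ?PB)" by (simp add: space_pair_measure space_PiM)
    moreover have "Q (override_on (?Y \<omega>') (?X \<omega>) A) \<longleftrightarrow> Q (override_on (\<lambda>i. Z i \<omega>') (\<lambda>i. Z i \<omega>) A)"
      by (rule open_cylinder_cong[OF Q]) (auto simp: override_on_def)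
    ultimately show ?thesis by (simp add: C_def)
  qed
  have self: "override_on (\<lambda>i. Z i \<omega>) (\<lambda>i. Z i \<omega>) A = (\<lambda>i. Z i \<omega>)" for \<omega>
    by (auto simp: override_on_def)
  show ?thesis using emeasure_indep_var_pair[OF iv C] unfolding mem self .
qed

section \<open>Translation invariance of independent Haar variables\<close>

lemma measurable_add_padic_int:
  "(\<lambda>y. x + y) \<in> measurable borel (borel :: 'p::prime_card padic_int measure)"
proof (rule borel_measurableI)
  fix U :: "'p padic_int set" assume U: "open U"
  have "open ((\<lambda>y. x + y) -` U)"
    unfolding open_padic_int_def
  proof
    fix y assume "y \<in> (\<lambda>y. x + y) -` U"
    then obtain n where n: "\<forall>z. residue z n = residue (x + y) n \<longrightarrow> z \<in> U"
      using U unfolding open_padic_int_def by auto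
    have "x + z \<in> U" if "residue z n = residue y n" for z
      using n that by (simp add: plus_padic_int.rep_eq)
    then show "\<exists>n. \<forall>z. residue z n = residue y n \<longrightarrow> z \<in> (\<lambda>y. x + y) -` U" by blast
  qed
  then show "(\<lambda>y. x + y) -` U \<inter> space borel \<in> sets borel" by simp
qed

lemma (in prob_space) emeasure_translate:
  fixes Z :: "'i \<Rightarrow> 'a \<Rightarrow> 'p::prime_card padic_int"
  assumes ind: "indep_vars (\<lambda>_. borel) Z K" and fin: "finite K"
    and haar: "\<And>i. i \<in> K \<Longrightarrow> haar_prob_measure (distr M borel (Z i))"
    and Q: "open_cylinder K Q"
  shows "emeasure M {\<omega> \<in> space M. Q (\<lambda>i. b i + Z i \<omega>)} = emeasure M {\<omega> \<in> space M. Q (\<lambda>i. Z i \<omega>)}"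
proof (cases "K = {}")
  \<comment> \<open>The characterisation of independence by the product law requires a nonempty
    index set. The empty one does occur, as the new column for n = 0.\<close>
  case True
  have "Q (\<lambda>i. b i + Z i \<omega>) \<longleftrightarrow> Q (\<lambda>i. Z i \<omega>)" for \<omega>
    by (rule open_cylinder_cong[OF Q]) (simp add: True)
  then show ?thesis by simp
next
  case False
  let ?P = "PiM K (\<lambda>_. borel :: 'p padic_int measure)"
  have Z: "Z i \<in> measurable M borel" if "i \<in> K" for i
    using ind that by (auto simp: indep_vars_def2)
  have Z': "(\<lambda>\<omega>. b i + Z i \<omega>) \<in> measurable M borel" if "i \<in> K" for i
    by (rule measurable_compose[OF Z[OF that] measurable_add_padic_int])
  have ind': "indep_vars (\<lambda>_. borel) (\<lambda>i \<omega>. b i + Z i \<omega>) K"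
    by (rule indep_vars_compose2[OF ind]) (rule measurable_add_padic_int)
  have same: "distr M borel (\<lambda>\<omega>. b i + Z i \<omega>) = distr M borel (Z i)" if "i \<in> K" for i
  proof -
    have "distr M borel (\<lambda>\<omega>. b i + Z i \<omega>) = distr (distr M borel (Z i)) borel (\<lambda>y. b i + y)"
      by (subst distr_distr[OF measurable_add_padic_int Z[OF that]]) (simp add: comp_def)
    also have "\<dots> = distr M borel (Z i)"
      using haar[OF that] by (simp add: haar_prob_measure_def)
    finally show ?thesis .
  qed
  define C where "C = {u \<in> space ?P. Q u}"
  have C: "C \<in> sets ?P"
    unfolding C_def by (rule sets_open_cylinder[OF fin _ Q, where Z = "\<lambda>i u. u i"]) auto
  have em: "emeasure M {\<omega> \<in> space M. Q (\<lambda>i. Y i \<omega>)} = emeasure (PiM K (\<lambda>i. distr M borel (Y i))) C"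
    if Y: "\<And>i. i \<in> K \<Longrightarrow> Y i \<in> measurable M borel" "indep_vars (\<lambda>_. borel) Y K" for Y :: "'i \<Rightarrow> 'a \<Rightarrow> 'p padic_int"
  proof -
    have "Q (restrict (\<lambda>i. Y i \<omega>) K) \<longleftrightarrow> Q (\<lambda>i. Y i \<omega>)" for \<omega>
      by (rule open_cylinder_cong[OF Q]) simp
    then have "{\<omega> \<in> space M. Q (\<lambda>i. Y i \<omega>)} = (\<lambda>\<omega>. restrict (\<lambda>i. Y i \<omega>) K) -` C \<inter> space M"
      by (auto simp: C_def space_PiM)
    also have "emeasure M \<dots> = emeasure (distr M ?P (\<lambda>\<omega>. restrict (\<lambda>i. Y i \<omega>) K)) C"
      using C by (intro emeasure_distr[symmetric] measurable_restrict Y(1))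
    also have "distr M ?P (\<lambda>\<omega>. restrict (\<lambda>i. Y i \<omega>) K) = PiM K (\<lambda>i. distr M borel (Y i))"
      using indep_vars_iff_distr_eq_PiM'[OF False, of Y "\<lambda>_. borel"] Y by blast
    finally show ?thesis .
  qed
  have "PiM K (\<lambda>i. distr M borel (\<lambda>\<omega>. b i + Z i \<omega>)) = PiM K (\<lambda>i. distr M borel (Z i))"
    by (rule PiM_cong) (simp_all add: same)
  then show ?thesis using em[OF Z ind] em[OF Z' ind'] by simp
qed

section \<open>Haar measure has no atoms\<close>

lemma inj_of_nat_padic_int: "inj (of_nat :: nat \<Rightarrow> 'p::prime_card padic_int)"
proof (rule injI)
  have "m = n" if "m \<le> n" "(of_nat m :: 'p padic_int) = of_nat n" for m n
    using that of_nat_padic_int_neq_0[of "n - m", where 'p='p] by (auto simp: of_nat_diff)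
  then show "m = n" if "(of_nat m :: 'p padic_int) = of_nat n" for m n
    using that by (metis nat_le_linear)
qed

lemma sets_singleton_padic_int: "{x :: 'p::prime_card padic_int} \<in> sets borel"
proof -
  have "open (- {x})"
    unfolding open_padic_int_def
  proof
    fix y assume "y \<in> - {x}"
    then obtain n where "residue y n \<noteq> residue x n" using padic_eqI[of y x] by auto
    then show "\<exists>n. \<forall>z. residue z n = residue y n \<longrightarrow> z \<in> - {x}" by (intro exI[of _ n]) auto
  qed
  then have "closed {x}" by (simp add: closed_def)
  then show ?thesis by (rule borel_closed)
qed

text \<open>By invariance all points have the same mass, and there are infinitely many of them in a
  space of mass 1.\<close>

lemma haar_prob_measure_singleton:
  fixes \<mu> :: "'p::prime_card padic_int measure"
  assumes "haar_prob_measure \<mu>"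
  shows "emeasure \<mu> {x} = 0"
proof -
  interpret prob_space \<mu> using assms by (simp add: haar_prob_measure_def)
  have s: "sets \<mu> = sets borel" and inv: "\<And>x. distr \<mu> borel (\<lambda>y. x + y) = \<mu>"
    using assms by (auto simp: haar_prob_measure_def)
  have sp: "space \<mu> = UNIV" using sets_eq_imp_space_eq[OF s] by simp
  have eq: "measure \<mu> {z} = measure \<mu> {x}" for z
  proof -
    have "measure \<mu> {z} = measure (distr \<mu> borel (\<lambda>y. (z - x) + y)) {z}" by (simp only: inv)
    also have "\<dots> = measure \<mu> ((\<lambda>y. (z - x) + y) -` {z} \<inter> space \<mu>)"
      using measurable_add_padic_int sets_singleton_padic_int
      by (intro measure_distr) (simp_all add: measurable_cong_sets[OF s refl])
    also have "(\<lambda>y. (z - x) + y) -` {z} \<inter> space \<mu> = {x}" by (auto simp: sp algebra_simps)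
    finally show ?thesis .
  qed
  have "real m * measure \<mu> {x} \<le> 1" for m
  proof -
    have "real m * measure \<mu> {x} = (\<Sum>z\<in>(of_nat ` {..<m} :: 'p padic_int set). measure \<mu> {x})"
      by (simp add: card_image inj_on_subset[OF inj_of_nat_padic_int])
    also have "\<dots> = (\<Sum>z\<in>of_nat ` {..<m}. measure \<mu> {z})"
      by (intro sum.cong refl eq[symmetric])
    also have "\<dots> = measure \<mu> (of_nat ` {..<m})"
      by (rule finite_measure_eq_sum_singleton[symmetric]) (simp_all add: s sets_singleton_padic_int)
    also have "\<dots> \<le> 1" by simp
    finally show ?thesis .
  qed
  then have "\<not> measure \<mu> {x} > 0" using reals_Archimedean3[of "measure \<mu> {x}"] by (auto simp: not_less[symmetric])
  then have "measure \<mu> {x} = 0" by (simp add: zero_less_measure_iff)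
  then show ?thesis by (simp add: emeasure_eq_measure)
qed

section \<open>Symmetric matrices from their upper triangle\<close>

definition tri :: "nat \<Rightarrow> (nat \<times> nat) set" where
  "tri n = {(i, j). i \<le> j \<and> j < n}"

definition col :: "nat \<Rightarrow> (nat \<times> nat) set" where
  "col n = {(i, j). i < n \<and> j = n}"

text \<open>Only the upper triangle is read, so the matrix is symmetric for every f and the
  independent entries can be overridden freely.\<close>

definition smat :: "(nat \<times> nat \<Rightarrow> 'a) \<Rightarrow> nat \<Rightarrow> nat \<Rightarrow> 'a" where
  "smat f i j = f (min i j, max i j)"

abbreviation sdet :: "nat \<Rightarrow> (nat \<times> nat \<Rightarrow> 'a::comm_ring_1) \<Rightarrow> 'a" where
  "sdet n f \<equiv> Determinant.det (sqmat n (smat f))"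

definition cls :: "nat \<Rightarrow> (nat \<times> nat \<Rightarrow> 'p::prime_card padic_int) \<Rightarrow> (nat, 'p) pairing_group set" where
  "cls n f = iso_class (ker_grp n (smat f))"

lemma finite_tri: "finite (tri n)"
  by (rule finite_subset[of _ "{..<n} \<times> {..<n}"]) (auto simp: tri_def)

lemma finite_col: "finite (col n)"
  by (rule finite_subset[of _ "{..<n} \<times> {n}"]) (auto simp: col_def)

lemma tri_Suc: "tri (Suc n) = tri n \<union> (col n \<union> {(n, n)})"
  by (auto simp: tri_def col_def)

lemma tri_disjoint: "tri n \<inter> (col n \<union> {(n, n)}) = {}" "col n \<inter> {(n, n)} = {}"
  by (auto simp: tri_def col_def)

lemma tri_mono: "i \<le> n \<Longrightarrow> tri i \<subseteq> tri n"
  by (auto simp: tri_def)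

lemma smat_commute: "smat f i j = smat f j i"
  by (simp add: smat_def min.commute max.commute)

lemma smat_le: "i \<le> j \<Longrightarrow> smat f i j = f (i, j)"
  by (simp add: smat_def)

lemma smat_in_tri: "i < n \<Longrightarrow> j < n \<Longrightarrow> (min i j, max i j) \<in> tri n"
  by (auto simp: tri_def)

lemma sqmat_smat_cong:
  assumes "\<And>p. p \<in> tri n \<Longrightarrow> f p = g p"
  shows "sqmat n (smat f) = sqmat n (smat g)"
  using assms smat_in_tri by (intro eq_matI) (simp_all add: smat_def)

lemma lin_smat_cong:
  assumes "\<And>p. p \<in> tri n \<Longrightarrow> f p = g p" "i < n"
  shows "lin n (smat f) x i = lin n (smat g) x i"
  unfolding lin_def by (intro sum.cong refl) (use assms smat_in_tri in \<open>auto simp: smat_def\<close>)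

lemma bil_smat_cong:
  assumes "\<And>p. p \<in> tri n \<Longrightarrow> f p = g p"
  shows "bil n (smat f) x y = bil n (smat g) x y"
  unfolding bil_def using lin_smat_cong[OF assms] by (intro sum.cong) auto

lemma cls_locally_constant:
  fixes f :: "nat \<times> nat \<Rightarrow> 'p::prime_card padic_int"
  assumes "sdet n f \<noteq> 0"
  shows "\<exists>N. \<forall>g. (\<forall>p\<in>tri n. residue (g p) N = residue (f p) N) \<longrightarrow> sdet n g \<noteq> 0 \<and> cls n g = cls n f"
proof -
  obtain N where N: "\<And>A'. \<lbrakk>\<And>i j. A' i j = A' j i; \<And>i j. i < n \<Longrightarrow> j < n \<Longrightarrow> residue (A' i j) N = residue (smat f i j) N\<rbrakk>
    \<Longrightarrow> Determinant.det (sqmat n A') \<noteq> 0 \<and> pairing_iso (ker_grp n (smat f)) (ker_grp n A')"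
    using ker_grp_locally_constant[OF smat_commute assms] by blast
  show ?thesis
  proof (intro exI allI impI)
    fix g :: "nat \<times> nat \<Rightarrow> 'p padic_int"
    assume g: "\<forall>p\<in>tri n. residue (g p) N = residue (f p) N"
    have "sdet n g \<noteq> 0 \<and> pairing_iso (ker_grp n (smat f)) (ker_grp n (smat g))"
      by (rule N[OF smat_commute]) (simp add: smat_def g smat_in_tri)
    then show "sdet n g \<noteq> 0 \<and> cls n g = cls n f"
      unfolding cls_def using iso_class_eq[OF group_ker_grp group_ker_grp] by metis
  qed
qed

lemma open_cylinder_sdet:
  "open_cylinder (tri n) (\<lambda>f :: nat \<times> nat \<Rightarrow> 'p::prime_card padic_int. sdet n f \<noteq> 0)"
proof (rule open_cylinderI)
  fix f :: "nat \<times> nat \<Rightarrow> 'p padic_int" assume "sdet n f \<noteq> 0"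
  from cls_locally_constant[OF this] show "\<exists>N. \<forall>g :: nat \<times> nat \<Rightarrow> 'p padic_int.
      (\<forall>i\<in>tri n. residue (g i) N = residue (f i) N) \<longrightarrow> sdet n g \<noteq> 0" by blast
qed

lemma sdet_neq_0_if_cls_in:
  "cls n f \<in> perfect_symmetric_p_groups \<Longrightarrow> sdet n f \<noteq> 0"
  unfolding cls_def by (rule det_neq_0_if_iso_class_in)

lemma cls_in: "sdet n f \<noteq> 0 \<Longrightarrow> cls n f \<in> perfect_symmetric_p_groups"
  unfolding cls_def by (rule iso_class_ker_grp_in[OF smat_commute])

text \<open>A class from \<open>perfect_symmetric_p_groups\<close> forces a nonzero determinant, and
  there the class is locally constant.\<close>

lemma open_cylinder_cls:
  fixes s :: "(nat, 'p::prime_card) pairing_group set"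
  assumes "s \<in> perfect_symmetric_p_groups"
  shows "open_cylinder (tri n) (\<lambda>f. cls n f = s)"
proof (rule open_cylinderI)
  fix f :: "nat \<times> nat \<Rightarrow> 'p padic_int" assume s: "cls n f = s"
  then have "sdet n f \<noteq> 0" using assms by (intro sdet_neq_0_if_cls_in) simp
  from cls_locally_constant[OF this] show "\<exists>N. \<forall>g. (\<forall>i\<in>tri n. residue (g i) N = residue (f i) N) \<longrightarrow> cls n g = s" using s by blast
qed

lemma cls_bordered:
  fixes F F' :: "nat \<times> nat \<Rightarrow> 'p::prime_card padic_int"
  assumes "sdet n F \<noteq> 0" "sdet n F' \<noteq> 0"
    and "\<phi> \<in> iso (ker_grp n (smat F)) (ker_grp n (smat F'))"
    and "\<And>v w. v \<in> kernel_carrier (sqmat n (smat F)) \<Longrightarrow> w \<in> kernel_carrier (sqmat n (smat F)) \<Longrightarrow>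
      kernel_pairing (sqmat n (smat F')) (\<phi> v) (\<phi> w) = kernel_pairing (sqmat n (smat F)) v w"
    and "\<forall>i<n. lin n (smat F) x i = to_fract (F (i, n))" "\<forall>i<n. lin n (smat F') x' i = to_fract (F' (i, n))"
    and "\<phi> (kvec n x) = kvec n x'"
    and "to_fract (F (n, n)) - bil n (smat F) x x = to_fract (F' (n, n)) - bil n (smat F') x' x'"
  shows "cls (Suc n) F = cls (Suc n) F'"
  unfolding cls_def
proof (rule iso_class_eq[OF group_ker_grp group_ker_grp])
  show "pairing_iso (ker_grp (Suc n) (smat F)) (ker_grp (Suc n) (smat F'))"
    by (rule pairing_iso_bordered[OF smat_commute smat_commute assms(1-4) _ _ assms(7)])
      (use assms(5,6,8) in \<open>simp_all add: smat_le\<close>)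
qed

section \<open>The class of the new column\<close>

text \<open>The class of \<open>A\<^sup>-\<^sup>1 b\<close> modulo \<open>\<int>\<^sub>p\<^sup>n\<close>, where \<open>A\<close> is given by \<open>f\<close> and the column \<open>b\<close> by \<open>g\<close>.\<close>

definition col_class :: "nat \<Rightarrow> (nat \<times> nat \<Rightarrow> 'p::prime_card padic_int) \<Rightarrow> (nat \<times> nat \<Rightarrow> 'p padic_int) \<Rightarrow> 'p prufer Matrix.vec" where
  "col_class n f g = kvec n (SOME x. \<forall>i<n. lin n (smat f) x i = to_fract (g (i, n)))"

context
  fixes n :: nat and f :: "nat \<times> nat \<Rightarrow> 'p::prime_card padic_int"
  assumes D: "sdet n f \<noteq> 0"
begin

lemma linear_solution_unique:
  assumes "\<And>i. i < n \<Longrightarrow> lin n (smat f) x i = lin n (smat f) y i" "i < n"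
  shows "x i = y i"
proof -
  obtain e where e: "\<And>x i. i < n \<Longrightarrow> x i = (\<Sum>j<n. lin n (smat f) x j * e j i)"
    by (rule inverse_matrix[OF D]) blast
  show ?thesis using assms e[of i x] e[of i y] by simp
qed

lemma col_class_obtain:
  obtains x where "\<forall>i<n. lin n (smat f) x i = to_fract (g (i, n))" "col_class n f g = kvec n x"
proof -
  have "\<exists>x. \<forall>i<n. lin n (smat f) x i = to_fract (g (i, n))"
    by (rule linear_solve[OF D, where b = "\<lambda>i. to_fract (g (i, n))"]) blast
  from someI_ex[OF this] show ?thesis by (rule that) (simp add: col_class_def)
qed

lemma col_class_eq:
  assumes x: "\<forall>i<n. lin n (smat f) x i = to_fract (g (i, n))"
  shows "col_class n f g = kvec n x"
proof -
  obtain y where y: "\<forall>i<n. lin n (smat f) y i = to_fract (g (i, n))" "col_class n f g = kvec n y"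
    by (rule col_class_obtain)
  have "y i = x i" if "i < n" for i
    by (rule linear_solution_unique[OF _ that]) (use x y(1) in simp)
  then show ?thesis by (simp add: y(2) kvec_eq_iff)
qed

lemma col_class_in_kernel: "col_class n f g \<in> kernel_carrier (sqmat n (smat f))"
proof -
  obtain x where x: "\<forall>i<n. lin n (smat f) x i = to_fract (g (i, n))" "col_class n f g = kvec n x"
    by (rule col_class_obtain)
  then show ?thesis by (simp add: kvec_in_kernel_iff)
qed

lemma col_class_onto:
  assumes v: "v \<in> kernel_carrier (sqmat n (smat f))"
  shows "\<exists>g. col_class n f g = v"
proof -
  obtain x where x: "v = kvec n x" "\<And>i. i < n \<Longrightarrow> lin n (smat f) x i \<in> Zp" using v by (rule kernel_cases) blast
  then have "\<forall>i. \<exists>c. i < n \<longrightarrow> lin n (smat f) x i = to_fract c" by blast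
  then obtain z where "\<And>i. i < n \<Longrightarrow> lin n (smat f) x i = to_fract (z i)" by metis
  then have "col_class n f (\<lambda>p. z (fst p)) = kvec n x" by (intro col_class_eq) simp
  then show ?thesis using x(1) by blast
qed

lemma col_class_add: "col_class n f (\<lambda>p. g p + h p) = col_class n f g + col_class n f h"
proof -
  obtain x where x: "\<forall>i<n. lin n (smat f) x i = to_fract (g (i, n))" "col_class n f g = kvec n x"
    by (rule col_class_obtain)
  obtain y where y: "\<forall>i<n. lin n (smat f) y i = to_fract (h (i, n))" "col_class n f h = kvec n y"
    by (rule col_class_obtain)
  have "col_class n f (\<lambda>p. g p + h p) = kvec n (\<lambda>i. x i + y i)"
    by (rule col_class_eq) (use x y in \<open>simp add: lin_add\<close>)
  then show ?thesis by (simp add: x y kvec_add)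
qed

text \<open>If the columns differ by det(A) times an integral vector c, then the solutions differ by
  det(A) A^-1 c, which is integral by Cramer's rule.\<close>

lemma open_cylinder_col_class: "open_cylinder (col n) (\<lambda>g. col_class n f g = v)"
proof (rule open_cylinderI)
  fix g assume g: "col_class n f g = v"
  obtain N where N: "sdet n f dvd of_nat CARD('p) ^ N" by (rule dvd_prime_power[OF D])
  obtain x where x: "\<forall>i<n. lin n (smat f) x i = to_fract (g (i, n))" "col_class n f g = kvec n x"
    by (rule col_class_obtain)
  have "col_class n f h = v" if h: "\<forall>p\<in>col n. residue (h p) N = residue (g p) N" for h
  proof -
    obtain y where y: "\<forall>i<n. lin n (smat f) y i = to_fract (h (i, n))" "col_class n f h = kvec n y"
      by (rule col_class_obtain)
    have "\<exists>c. h (i, n) - g (i, n) = sdet n f * c" if "i < n" for i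
    proof -
      note N
      also have "of_nat CARD('p) ^ N dvd h (i, n) - g (i, n)"
        using h that by (simp add: prime_power_dvd_iff_residue residue_diff_eq_0_iff col_def)
      finally show ?thesis by (auto elim: dvdE)
    qed
    then obtain c where c: "\<And>i. i < n \<Longrightarrow> h (i, n) - g (i, n) = sdet n f * c i" by metis
    define z where "z i = (y i - x i) / to_fract (sdet n f)" for i
    have D': "to_fract (sdet n f) \<noteq> 0" using D by simp
    have yx: "y i - x i = to_fract (sdet n f) * z i" for i using D' by (simp add: z_def)
    have "lin n (smat f) z i \<in> Zp" if "i < n" for i
    proof -
      have "to_fract (sdet n f) * lin n (smat f) z i = lin n (smat f) y i - lin n (smat f) x i"
        by (simp add: lin_scale[symmetric] lin_diff[symmetric] yx)
      also have "\<dots> = to_fract (sdet n f) * to_fract (c i)"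
        using x(1) y(1) that c[OF that] by (simp flip: to_fract_diff to_fract_mult)
      finally show ?thesis using D' by simp
    qed
    then have "y i - x i \<in> Zp" if "i < n" for i
      unfolding yx by (rule kernel_det_integral) (use that in auto)
    then have "kvec n y = kvec n x" by (simp add: kvec_eq_iff)
    then show ?thesis using g by (simp add: x(2) y(2))
  qed
  then show "\<exists>N. \<forall>h. (\<forall>p\<in>col n. residue (h p) N = residue (g p) N) \<longrightarrow> col_class n f h = v" by blast
qed

lemma finite_kernel: "finite (kernel_carrier (sqmat n (smat f)))"
  using finite_abelian_p_group_ker_grp[OF D] by (simp add: finite_abelian_p_group_def kernel_group_simps)

end

text \<open>Over \<open>\<rat>\<^sub>p\<close> the bordered form is the orthogonal sum of A and the
  line of norm d, so it is non-degenerate unless d = 0. For a given A and column, at most one corner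
  entry is therefore bad.\<close>

lemma sdet_Suc_eq_0:
  fixes f :: "nat \<times> nat \<Rightarrow> 'p::prime_card padic_int"
  assumes D: "sdet n f \<noteq> 0" and x: "\<forall>i<n. lin n (smat f) x i = to_fract (f (i, n))"
    and D': "sdet (Suc n) f = 0"
  shows "to_fract (f (n, n)) = bil n (smat f) x x"
proof (rule ccontr)
  assume neq: "to_fract (f (n, n)) \<noteq> bil n (smat f) x x"
  define d where "d = to_fract (smat f n n) - bil n (smat f) x x"
  have d0: "d \<noteq> 0" using neq by (simp add: d_def smat_def)
  have x': "\<forall>i<n. lin n (smat f) x i = to_fract (smat f i n)" using x by (simp add: smat_def)
  obtain v where v: "v \<in> carrier_vec (Suc n)" "v \<noteq> 0\<^sub>v (Suc n)" "sqmat (Suc n) (smat f) *\<^sub>v v = 0\<^sub>v (Suc n)"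
    using det_0_iff_vec_prod_zero[of "sqmat (Suc n) (smat f)" "Suc n"] D' by auto
  define t where "t = to_fract (vec_index v n)"
  \<comment> \<open>Chosen so that the null vector v has glue coordinates (y, t).\<close>
  define y where "y i = to_fract (vec_index v i) + t * x i" for i
  have lin0: "lin (Suc n) (smat f) (glue n x y t) i = 0" if "i < Suc n" for i
  proof -
    have "lin (Suc n) (smat f) (glue n x y t) i = to_fract (vec_index (sqmat (Suc n) (smat f) *\<^sub>v v) i)"
      using that v(1) by (simp add: lin_def scalar_prod_def glue_def y_def t_def atLeast0LessThan)
    then show ?thesis using that by (simp add: v(3))
  qed
  note glue = lin_Suc_glue[where A = "smat f" and n = n and x = x and d = d, OF smat_commute x' d_def]
  have "lin n (smat f) y i = lin n (smat f) (\<lambda>_. 0) i" if "i < n" for i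
    using lin0[of i] glue(1)[OF that, of y t] that by (simp add: lin_def)
  then have y0: "y i = 0" if "i < n" for i
    using linear_solution_unique[OF D, of y "\<lambda>_. 0" i] that by blast
  have "bil n (smat f) x y = bil n (smat f) x (\<lambda>_. 0)" by (rule bil_cong) (simp_all add: y0)
  then have "bil n (smat f) x y = 0" by (simp add: bil_def lin_def)
  then have "t = 0" using lin0[of n] glue(2)[of y t] d0 by simp
  then have "vec_index v i = 0" if "i < Suc n" for i
    using y0[of i] that unfolding y_def t_def by (cases "i = n") (auto simp: less_Suc_eq)
  then have "v = 0\<^sub>v (Suc n)" using v(1) by (intro eq_vecI) auto
  then show False using v(2) by simp
qed

section \<open>One step of the process\<close>

locale sym_haar_process = prob_space M for M :: "'w measure" +
  fixes a :: "nat \<Rightarrow> nat \<Rightarrow> 'w \<Rightarrow> 'p::prime_card padic_int"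
  assumes sym_haar: "sym_haar M a"
begin

text \<open>Written with the same \<open>case\<close> as in \<open>sym_haar\<close>, so that its
  independence assumption applies literally.\<close>

abbreviation ent :: "'w \<Rightarrow> nat \<times> nat \<Rightarrow> 'p padic_int" where
  "ent \<omega> \<equiv> \<lambda>p. (case p of (i, j) \<Rightarrow> a i j) \<omega>"

lemma indep_ent:
  assumes "K \<subseteq> {(i, j). i \<le> j}"
  shows "indep_vars (\<lambda>_. borel) (\<lambda>p. case p of (i, j) \<Rightarrow> a i j) K"
  using sym_haar assms unfolding sym_haar_def by (blast intro: indep_vars_subset)

lemma haar_ent:
  assumes "p \<in> tri n"
  shows "haar_prob_measure (distr M borel (\<lambda>\<omega>. ent \<omega> p))"
  using sym_haar assms by (auto simp: sym_haar_def tri_def)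

lemma tri_le: "tri n \<subseteq> {(i, j). i \<le> j}" "col n \<subseteq> {(i, j). i \<le> j}" "{(n, n)} \<subseteq> {(i, j). i \<le> j}"
  by (auto simp: tri_def col_def)

lemma measurable_ent:
  assumes "p \<in> tri n"
  shows "(\<lambda>\<omega>. ent \<omega> p) \<in> measurable M borel"
  using indep_ent[OF tri_le(1)] assms unfolding indep_vars_def2 by blast

lemma sets_ent:
  assumes "open_cylinder (tri n) Q"
  shows "{\<omega> \<in> space M. Q (ent \<omega>)} \<in> sets M"
  by (rule sets_open_cylinder[OF finite_tri[of n] _ assms, where Z = "\<lambda>p \<omega>. ent \<omega> p"])
    (rule measurable_ent, assumption, rule refl)

lemma smat_ent: "\<omega> \<in> space M \<Longrightarrow> smat (ent \<omega>) i j = a i j \<omega>"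
  using sym_haar by (auto simp: smat_def sym_haar_def min_def max_def)

lemma cls_ent: "\<omega> \<in> space M \<Longrightarrow> iso_class (kernel_group (corner a n \<omega>)) = cls n (ent \<omega>)"
  by (simp add: cls_def corner_def smat_ent cong: if_cong)

text \<open>Old triangle and new column are frozen, so within the next corner only the last diagonal
  entry is random.\<close>

definition hit_given_col where
  "hit_given_col n s f g = emeasure M {\<omega> \<in> space M.
     cls (Suc n) (override_on (override_on (ent \<omega>) g (col n)) f (tri n)) = s}"

text \<open>The transition probability out of the matrix f. That it depends on f only through the
  class is \<open>hit_cong\<close>.\<close>

definition hit where
  "hit n s f = emeasure M {\<omega> \<in> space M. cls (Suc n) (override_on (ent \<omega>) f (tri n)) = s}"

text \<open>Completing the square shifts the corner entry by \<open>x\<^sup>T A x - x'\<^sup>T A' x'\<close>, which is integral because the classes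
  of \<open>x\<close> and \<open>x'\<close> correspond under a pairing isomorphism.\<close>

lemma hit_given_col_eq:
  assumes s: "s \<in> perfect_symmetric_p_groups"
    and D: "sdet n f \<noteq> 0" and D': "sdet n f' \<noteq> 0"
    and \<phi>: "\<phi> \<in> iso (ker_grp n (smat f)) (ker_grp n (smat f'))"
    and pres: "\<And>v w. v \<in> kernel_carrier (sqmat n (smat f)) \<Longrightarrow> w \<in> kernel_carrier (sqmat n (smat f)) \<Longrightarrow>
      kernel_pairing (sqmat n (smat f')) (\<phi> v) (\<phi> w) = kernel_pairing (sqmat n (smat f)) v w"
    and g: "\<phi> (col_class n f g) = col_class n f' g'"
  shows "hit_given_col n s f g = hit_given_col n s f' g'"
proof -
  obtain x where x: "\<forall>i<n. lin n (smat f) x i = to_fract (g (i, n))" "col_class n f g = kvec n x"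
    by (rule col_class_obtain[OF D])
  obtain x' where x': "\<forall>i<n. lin n (smat f') x' i = to_fract (g' (i, n))" "col_class n f' g' = kvec n x'"
    by (rule col_class_obtain[OF D'])
  have K: "kvec n x \<in> kernel_carrier (sqmat n (smat f))" "kvec n x' \<in> kernel_carrier (sqmat n (smat f'))"
    using col_class_in_kernel[OF D, of g] col_class_in_kernel[OF D', of g'] by (simp_all add: x x')
  have "of_padic (bil n (smat f') x' x') = of_padic (bil n (smat f) x x)"
    using pres[OF K(1) K(1)] g K
    by (simp add: x(2) x'(2) kernel_pairing_kvec[where A = "smat f", OF smat_commute]
        kernel_pairing_kvec[where A = "smat f'", OF smat_commute])
  then obtain k where k: "bil n (smat f') x' x' - bil n (smat f) x x = to_fract k"
    by (auto simp: of_padic_eq_iff)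
  define Q where "Q u \<longleftrightarrow> cls (Suc n) (override_on (override_on u g' (col n)) f' (tri n)) = s" for u
  have "open_cylinder (tri (Suc n) - tri n - col n) Q"
    unfolding Q_def by (intro open_cylinder_override_on[where Q = "\<lambda>h. cls (Suc n) (override_on h f' (tri n)) = s"]
        open_cylinder_override_on[where Q = "\<lambda>h. cls (Suc n) h = s"] open_cylinder_cls s)
  then have Q: "open_cylinder {(n, n)} Q"
    by (rule open_cylinder_mono) (auto simp: tri_Suc)
  \<comment> \<open>The shift by k makes the norms d of the two bordered forms equal exactly, as
    \<open>cls_bordered\<close> demands. Translation invariance then removes the shift.\<close>
  have cls_eq: "cls (Suc n) (override_on (override_on u g (col n)) f (tri n)) =
      cls (Suc n) (override_on (override_on (\<lambda>p. k + u p) g' (col n)) f' (tri n))" for u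
  proof -
    define F where "F = override_on (override_on u g (col n)) f (tri n)"
    define F' where "F' = override_on (override_on (\<lambda>p. k + u p) g' (col n)) f' (tri n)"
    have tri: "F p = f p" "F' p = f' p" if "p \<in> tri n" for p using that by (simp_all add: F_def F'_def)
    have col: "F (i, n) = g (i, n)" "F' (i, n) = g' (i, n)" if "i < n" for i
      using that by (simp_all add: F_def F'_def override_on_def tri_def col_def)
    have last: "F (n, n) = u (n, n)" "F' (n, n) = k + u (n, n)"
      by (simp_all add: F_def F'_def override_on_def tri_def col_def)
    have sq: "sqmat n (smat F) = sqmat n (smat f)" "sqmat n (smat F') = sqmat n (smat f')"
      by (rule sqmat_smat_cong, simp add: tri)+
    have lin: "lin n (smat F) z i = lin n (smat f) z i" "lin n (smat F') z i = lin n (smat f') z i" if "i < n" for z i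
      by (rule lin_smat_cong[OF _ that], simp add: tri)+
    have bil: "bil n (smat F) z z = bil n (smat f) z z" "bil n (smat F') z z = bil n (smat f') z z" for z
      by (rule bil_smat_cong, simp add: tri)+
    have "cls (Suc n) F = cls (Suc n) F'"
    proof (rule cls_bordered[where n = n and \<phi> = \<phi> and x = x and x' = x'])
      show "to_fract (F (n, n)) - bil n (smat F) x x = to_fract (F' (n, n)) - bil n (smat F') x' x'"
        using k by (simp add: last bil algebra_simps)
    qed (use D D' \<phi> pres x x' g in \<open>simp_all add: sq lin col\<close>)
    then show ?thesis by (simp add: F_def F'_def)
  qed
  have "hit_given_col n s f g = emeasure M {\<omega> \<in> space M. Q (\<lambda>p. k + ent \<omega> p)}"
    by (simp add: hit_given_col_def cls_eq Q_def)
  also have "\<dots> = emeasure M {\<omega> \<in> space M. Q (ent \<omega>)}"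
    by (rule emeasure_translate[OF indep_ent[OF tri_le(3)] _ _ Q])
      (use haar_ent[of "(n, n)" "Suc n"] in \<open>simp_all add: tri_Suc\<close>)
  also have "\<dots> = hit_given_col n s f' g'" by (simp add: hit_given_col_def Q_def)
  finally show ?thesis .
qed

text \<open>Adding to the new column a fixed column of class v - u carries the event for u to the
  event for v without changing its probability. So the finitely many events, which partition the
  space, are equally likely.\<close>

lemma emeasure_col_class:
  assumes D: "sdet n f \<noteq> 0" and v: "v \<in> kernel_carrier (sqmat n (smat f))"
  shows "emeasure M {\<omega> \<in> space M. col_class n f (ent \<omega>) = v} = ennreal (1 / card (kernel_carrier (sqmat n (smat f))))"
proof -
  let ?K = "kernel_carrier (sqmat n (smat f))"
  let ?E = "\<lambda>u. {\<omega> \<in> space M. col_class n f (ent \<omega>) = u}"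
  have sets: "?E u \<in> sets M" for u
    by (rule sets_ent[where n = "Suc n", OF open_cylinder_mono[OF open_cylinder_col_class[OF D]]])
      (auto simp: tri_Suc)
  have eq: "measure M (?E u) = measure M (?E v)" if u: "u \<in> ?K" for u
  proof -
    obtain b where b: "col_class n f b = v - u" using col_class_onto[OF D kernel_closed(2)[OF v u]] by blast
    have "col_class n f (\<lambda>p. b p + ent \<omega> p) = v \<longleftrightarrow> col_class n f (ent \<omega>) = u" for \<omega>
    proof -
      obtain x where x: "u = kvec n x" using u by (rule kernel_cases) blast
      obtain y where y: "v = kvec n y" using v by (rule kernel_cases) blast
      obtain z where z: "col_class n f (ent \<omega>) = kvec n z"
        using col_class_in_kernel[OF D, of "ent \<omega>"] by (rule kernel_cases) blast
      have "y i - x i + z i - y i \<in> Zp \<longleftrightarrow> z i - x i \<in> Zp" for i by (simp add: algebra_simps)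
      then show ?thesis
        unfolding col_class_add[OF D] b by (simp add: x y z kvec_diff kvec_add kvec_eq_iff)
    qed
    then have "?E u = {\<omega> \<in> space M. col_class n f (\<lambda>p. b p + ent \<omega> p) = v}" by simp
    also have "emeasure M \<dots> = emeasure M (?E v)"
      by (rule emeasure_translate[OF indep_ent[OF tri_le(2)] finite_col _ open_cylinder_col_class[OF D]])
        (rule haar_ent[of _ "Suc n"], simp add: tri_Suc)
    finally show ?thesis by (simp add: measure_def)
  qed
  have "(\<Sum>u\<in>?K. measure M (?E u)) = measure M (\<Union>u\<in>?K. ?E u)"
    using finite_kernel[OF D] sets
    by (intro finite_measure_finite_Union[symmetric]) (auto simp: disjoint_family_on_def)
  also have "(\<Union>u\<in>?K. ?E u) = space M" using col_class_in_kernel[OF D] by auto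
  finally have "(\<Sum>u\<in>?K. measure M (?E u)) = 1" by (simp add: prob_space)
  moreover have "(\<Sum>u\<in>?K. measure M (?E u)) = (\<Sum>u\<in>?K. measure M (?E v))"
    by (rule sum.cong[OF refl eq])
  ultimately have "real (card ?K) * measure M (?E v) = 1" by simp
  moreover from this have "card ?K \<noteq> 0" by (metis mult_zero_left of_nat_0 zero_neq_one)
  ultimately have "measure M (?E v) = 1 / card ?K" by (simp add: eq_divide_eq mult.commute)
  then show ?thesis by (simp add: emeasure_eq_measure)
qed

text \<open>The assumption \<open>h\<close> says that the column matters only through its class,
  which is uniform. The integrand thus becomes a finite sum of indicators.\<close>

lemma hit_eq_sum:
  assumes s: "s \<in> perfect_symmetric_p_groups" and D: "sdet n f \<noteq> 0"
    and h: "\<And>g. hit_given_col n s f g = h (col_class n f g)"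
  shows "hit n s f = (\<Sum>v\<in>kernel_carrier (sqmat n (smat f)). h v * ennreal (1 / card (kernel_carrier (sqmat n (smat f)))))"
proof -
  let ?K = "kernel_carrier (sqmat n (smat f))"
  let ?E = "\<lambda>u. {\<omega> \<in> space M. col_class n f (ent \<omega>) = u}"
  have sets: "?E u \<in> sets M" for u
    by (rule sets_ent[where n = "Suc n", OF open_cylinder_mono[OF open_cylinder_col_class[OF D]]])
      (auto simp: tri_Suc)
  have "open_cylinder (tri (Suc n) - tri n) (\<lambda>g. cls (Suc n) (override_on g f (tri n)) = s)"
    by (intro open_cylinder_override_on[where Q = "\<lambda>h. cls (Suc n) h = s"] open_cylinder_cls s)
  then have Q: "open_cylinder (col n \<union> {(n, n)}) (\<lambda>g. cls (Suc n) (override_on g f (tri n)) = s)"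
    by (rule open_cylinder_mono) (auto simp: tri_Suc)
  have "hit n s f = (\<integral>\<^sup>+\<omega>. hit_given_col n s f (ent \<omega>) \<partial>M)"
    unfolding hit_def hit_given_col_def
    by (rule emeasure_decouple[OF indep_ent tri_disjoint(2) finite_col _ Q]) (use tri_le in auto)
  also have "\<dots> = (\<integral>\<^sup>+\<omega>. (\<Sum>v\<in>?K. h v * indicator (?E v) \<omega>) \<partial>M)"
  proof (rule nn_integral_cong)
    fix \<omega> assume \<omega>: "\<omega> \<in> space M"
    have "(\<Sum>v\<in>?K. h v * indicator (?E v) \<omega>) = (\<Sum>v\<in>?K. if v = col_class n f (ent \<omega>) then h v else 0)"
      using \<omega> by (intro sum.cong) (auto simp: indicator_def)
    also have "\<dots> = h (col_class n f (ent \<omega>))"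
      using finite_kernel[OF D] col_class_in_kernel[OF D] by simp
    finally show "hit_given_col n s f (ent \<omega>) = (\<Sum>v\<in>?K. h v * indicator (?E v) \<omega>)" by (simp add: h)
  qed
  also have "\<dots> = (\<Sum>v\<in>?K. \<integral>\<^sup>+\<omega>. h v * indicator (?E v) \<omega> \<partial>M)"
    using sets by (intro nn_integral_sum) auto
  also have "\<dots> = (\<Sum>v\<in>?K. h v * ennreal (1 / card ?K))"
    using sets by (intro sum.cong refl) (simp add: nn_integral_cmult_indicator emeasure_col_class[OF D])
  finally show ?thesis .
qed

text \<open>The isomorphism \<phi> reindexes the sum over one kernel as the sum over the other, with
  equal terms and equal weights.\<close>

lemma hit_cong:
  assumes s: "s \<in> perfect_symmetric_p_groups" and f: "cls n f \<in> perfect_symmetric_p_groups"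
    and eq: "cls n f = cls n f'"
  shows "hit n s f = hit n s f'"
proof -
  let ?K = "kernel_carrier (sqmat n (smat f))" and ?K' = "kernel_carrier (sqmat n (smat f'))"
  have D: "sdet n f \<noteq> 0" and D': "sdet n f' \<noteq> 0"
    using sdet_neq_0_if_cls_in f eq by metis+
  have "pairing_iso (ker_grp n (smat f)) (ker_grp n (smat f'))"
    by (rule pairing_iso_ker_grp_if_iso_class_eq) (use f eq in \<open>simp_all add: cls_def\<close>)
  then obtain \<phi> where \<phi>: "\<phi> \<in> iso (ker_grp n (smat f)) (ker_grp n (smat f'))"
    and pres: "\<And>v w. v \<in> ?K \<Longrightarrow> w \<in> ?K \<Longrightarrow>
      kernel_pairing (sqmat n (smat f')) (\<phi> v) (\<phi> w) = kernel_pairing (sqmat n (smat f)) v w"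
    by (auto simp: pairing_iso_def kernel_group_simps)
  have bij: "bij_betw \<phi> ?K ?K'" using \<phi> by (simp add: iso_def kernel_group_simps)
  define h where "h v = hit_given_col n s f (SOME g. col_class n f g = v)" for v
  define h' where "h' v = hit_given_col n s f' (SOME g. col_class n f' g = v)" for v
  have some: "col_class n f (SOME g. col_class n f g = v) = v" if "v \<in> ?K" for v
    using someI_ex[OF col_class_onto[OF D that]] .
  have some': "col_class n f' (SOME g. col_class n f' g = v) = v" if "v \<in> ?K'" for v
    using someI_ex[OF col_class_onto[OF D' that]] .
  \<comment> \<open>\<open>hit_given_col_eq\<close> with the identity in place of \<phi> shows that
    the chosen representative column is irrelevant.\<close>
  have h: "hit_given_col n s f g = h (col_class n f g)" for g
    unfolding h_def by (rule hit_given_col_eq[OF s D D, where \<phi> = "\<lambda>v. v"])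
      (simp_all add: some col_class_in_kernel[OF D] iso_set_refl)
  have h': "hit_given_col n s f' g = h' (col_class n f' g)" for g
    unfolding h'_def by (rule hit_given_col_eq[OF s D' D', where \<phi> = "\<lambda>v. v"])
      (simp_all add: some' col_class_in_kernel[OF D'] iso_set_refl)
  have hh': "h' (\<phi> v) = h v" if "v \<in> ?K" for v
    unfolding h_def h'_def using bij_betw_apply[OF bij that]
    by (intro hit_given_col_eq[OF s D D' \<phi> pres, symmetric]) (simp_all add: some some' that)
  have card: "card ?K = card ?K'" by (rule bij_betw_same_card[OF bij])
  have "hit n s f' = (\<Sum>v\<in>?K'. h' v * ennreal (1 / card ?K'))" by (rule hit_eq_sum[OF s D' h'])
  also have "\<dots> = (\<Sum>v\<in>?K. h' (\<phi> v) * ennreal (1 / card ?K'))"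
    by (rule sum.reindex_bij_betw[OF bij, symmetric])
  also have "\<dots> = (\<Sum>v\<in>?K. h v * ennreal (1 / card ?K))" by (simp add: hh' card)
  also have "\<dots> = hit n s f" by (rule hit_eq_sum[OF s D h, symmetric])
  finally show ?thesis by simp
qed

text \<open>E stands for any event of the past contained in {class = s}. Conditionally on the old
  triangle the transition probability is \<open>hit\<close>, which is constant on E and leaves the
  integral.\<close>

lemma emeasure_step:
  assumes s: "s \<in> perfect_symmetric_p_groups" and s': "s' \<in> perfect_symmetric_p_groups"
    and E: "open_cylinder (tri n) E" and Es: "\<And>f. E f \<Longrightarrow> cls n f = s" and f: "cls n f = s"
  shows "emeasure M {\<omega> \<in> space M. E (ent \<omega>) \<and> cls (Suc n) (ent \<omega>) = s'} =
    hit n s' f * emeasure M {\<omega> \<in> space M. E (ent \<omega>)}"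
proof -
  have "open_cylinder (tri (Suc n)) (\<lambda>f. E f \<and> cls (Suc n) f = s')"
    by (intro open_cylinder_conj open_cylinder_cls s' open_cylinder_mono[OF E] tri_mono) simp
  then have Q: "open_cylinder (tri n \<union> (col n \<union> {(n, n)})) (\<lambda>f. E f \<and> cls (Suc n) f = s')"
    by (simp add: tri_Suc)
  have "emeasure M {\<omega> \<in> space M. E (ent \<omega>) \<and> cls (Suc n) (ent \<omega>) = s'} =
      (\<integral>\<^sup>+\<omega>. emeasure M {\<omega>' \<in> space M. E (override_on (ent \<omega>') (ent \<omega>) (tri n)) \<and>
        cls (Suc n) (override_on (ent \<omega>') (ent \<omega>) (tri n)) = s'} \<partial>M)"
    by (rule emeasure_decouple[OF indep_ent tri_disjoint(1) finite_tri _ Q])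
      (use tri_le finite_col in auto)
  also have "\<dots> = (\<integral>\<^sup>+\<omega>. hit n s' f * indicator {\<omega> \<in> space M. E (ent \<omega>)} \<omega> \<partial>M)"
  proof (rule nn_integral_cong)
    fix \<omega> assume \<omega>: "\<omega> \<in> space M"
    have E_iff: "E (override_on (ent \<omega>') (ent \<omega>) (tri n)) \<longleftrightarrow> E (ent \<omega>)" for \<omega>'
      by (rule open_cylinder_cong[OF E]) simp
    have "hit n s' f = hit n s' (ent \<omega>)" if "E (ent \<omega>)"
      using Es[OF that] f s by (intro hit_cong[OF s']) simp_all
    then show "emeasure M {\<omega>' \<in> space M. E (override_on (ent \<omega>') (ent \<omega>) (tri n)) \<and>
        cls (Suc n) (override_on (ent \<omega>') (ent \<omega>) (tri n)) = s'} =
        hit n s' f * indicator {\<omega> \<in> space M. E (ent \<omega>)} \<omega>"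
      using \<omega> by (cases "E (ent \<omega>)") (simp_all add: E_iff hit_def)
  qed
  also have "\<dots> = hit n s' f * emeasure M {\<omega> \<in> space M. E (ent \<omega>)}"
    by (rule nn_integral_cmult_indicator[OF sets_ent[OF E]])
  finally show ?thesis .
qed

text \<open>The right-hand side does not mention E, which is the Markov property: every past event
  compatible with the present class gives the same conditional probability.\<close>

lemma cond_prob_step:
  assumes s: "s \<in> perfect_symmetric_p_groups" and s': "s' \<in> perfect_symmetric_p_groups"
    and E: "open_cylinder (tri n) E" and Es: "\<And>f. E f \<Longrightarrow> cls n f = s" and f: "cls n f = s"
    and pos: "measure M {\<omega> \<in> space M. E (ent \<omega>)} > 0"
  shows "measure M {\<omega> \<in> space M. cls (Suc n) (ent \<omega>) = s' \<and> E (ent \<omega>)} / measure M {\<omega> \<in> space M. E (ent \<omega>)} =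
    enn2real (hit n s' f)"
proof -
  have "{\<omega> \<in> space M. cls (Suc n) (ent \<omega>) = s' \<and> E (ent \<omega>)} = {\<omega> \<in> space M. E (ent \<omega>) \<and> cls (Suc n) (ent \<omega>) = s'}"
    by auto
  then have "measure M {\<omega> \<in> space M. cls (Suc n) (ent \<omega>) = s' \<and> E (ent \<omega>)} =
      enn2real (hit n s' f) * measure M {\<omega> \<in> space M. E (ent \<omega>)}"
    using emeasure_step[OF s s' E Es f] by (simp add: measure_def enn2real_mult)
  then show ?thesis using pos by simp
qed

text \<open>Once the previous corner is non-singular and the column is given, at most one value of
  the last entry makes the new corner singular, and a Haar variable misses it almost surely.\<close>

lemma AE_sdet_neq_0: "AE \<omega> in M. sdet n (ent \<omega>) \<noteq> 0"
proof (induction n)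
  case 0
  show ?case by simp
next
  case (Suc n)
  let ?Q = "\<lambda>f :: nat \<times> nat \<Rightarrow> 'p padic_int. sdet n f \<noteq> 0 \<and> sdet (Suc n) f \<noteq> 0"
  let ?A = "tri n \<union> col n"
  have "open_cylinder (tri (Suc n)) ?Q"
    by (intro open_cylinder_conj open_cylinder_sdet open_cylinder_mono[OF open_cylinder_sdet] tri_mono) simp
  then have Q: "open_cylinder (?A \<union> {(n, n)}) ?Q" by (simp add: tri_Suc Un_assoc)
  have setsQ: "{\<omega> \<in> space M. ?Q (ent \<omega>)} \<in> sets M"
    by (rule sets_ent[where n = "Suc n"]) (use Q in \<open>simp add: tri_Suc Un_assoc\<close>)
  have "emeasure M {\<omega> \<in> space M. ?Q (ent \<omega>)} =
      (\<integral>\<^sup>+\<omega>. emeasure M {\<omega>' \<in> space M. ?Q (override_on (ent \<omega>') (ent \<omega>) ?A)} \<partial>M)"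
    by (rule emeasure_decouple[OF indep_ent _ _ _ Q])
      (use tri_le finite_col finite_tri tri_disjoint in auto)
  also have "\<dots> = (\<integral>\<^sup>+\<omega>. 1 \<partial>M)"
  proof (rule nn_integral_cong_AE, rule AE_mp[OF Suc.IH], rule AE_I2, rule impI)
    fix \<omega> assume D: "sdet n (ent \<omega>) \<noteq> 0"
    obtain x where x: "\<forall>i<n. lin n (smat (ent \<omega>)) x i = to_fract (ent \<omega> (i, n))"
      by (rule col_class_obtain[OF D])
    \<comment> \<open>If x^T A x is not integral, no corner entry is bad and any \<open>c0\<close>
      serves.\<close>
    have single: "\<exists>c0. \<forall>c. to_fract c = bil n (smat (ent \<omega>)) x x \<longrightarrow> c = c0"
      by (metis to_fract_eq_iff)
    then obtain c0 where c0: "\<And>c. to_fract c = bil n (smat (ent \<omega>)) x x \<Longrightarrow> c = c0" by blast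
    have meas: "(\<lambda>\<omega>'. ent \<omega>' (n, n)) \<in> measurable M borel"
      by (rule measurable_ent[of _ "Suc n"]) (simp add: tri_Suc)
    have "AE \<omega>' in M. ent \<omega>' (n, n) \<noteq> c0"
    proof (rule AE_I)
      show "{\<omega>' \<in> space M. \<not> ent \<omega>' (n, n) \<noteq> c0} \<subseteq> (\<lambda>\<omega>'. ent \<omega>' (n, n)) -` {c0} \<inter> space M" by auto
      show "(\<lambda>\<omega>'. ent \<omega>' (n, n)) -` {c0} \<inter> space M \<in> sets M"
        by (rule measurable_sets[OF meas sets_singleton_padic_int])
      have "haar_prob_measure (distr M borel (\<lambda>\<omega>'. ent \<omega>' (n, n)))"
        by (rule haar_ent[of _ "Suc n"]) (simp add: tri_Suc)
      then show "emeasure M ((\<lambda>\<omega>'. ent \<omega>' (n, n)) -` {c0} \<inter> space M) = 0"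
        using haar_prob_measure_singleton emeasure_distr[OF meas sets_singleton_padic_int] by metis
    qed
    then have "AE \<omega>' in M. ?Q (override_on (ent \<omega>') (ent \<omega>) ?A)"
    proof (rule AE_mp, intro AE_I2 impI)
      fix \<omega>' assume c: "ent \<omega>' (n, n) \<noteq> c0"
      define F where "F = override_on (ent \<omega>') (ent \<omega>) ?A"
      have tri: "F p = ent \<omega> p" if "p \<in> tri n" for p using that by (simp add: F_def)
      have col: "F (i, n) = ent \<omega> (i, n)" if "i < n" for i
        using that by (simp add: F_def override_on_def tri_def col_def)
      have last: "F (n, n) = ent \<omega>' (n, n)" by (simp add: F_def override_on_def tri_def col_def)
      have sq: "sqmat n (smat F) = sqmat n (smat (ent \<omega>))" by (rule sqmat_smat_cong) (rule tri)
      have DF: "sdet n F \<noteq> 0" using D unfolding sq .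
      have xF: "\<forall>i<n. lin n (smat F) x i = to_fract (F (i, n))"
      proof (intro allI impI)
        fix i assume i: "i < n"
        have "lin n (smat F) x i = lin n (smat (ent \<omega>)) x i" by (rule lin_smat_cong[OF tri i])
        then show "lin n (smat F) x i = to_fract (F (i, n))" using x i col[OF i] by simp
      qed
      have "bil n (smat F) x x = bil n (smat (ent \<omega>)) x x" by (rule bil_smat_cong) (rule tri)
      then have "sdet (Suc n) F \<noteq> 0"
        using sdet_Suc_eq_0[OF DF xF] c0[of "ent \<omega>' (n, n)"] c unfolding last by auto
      then show "?Q (override_on (ent \<omega>') (ent \<omega>) ?A)" using DF unfolding F_def by blast
    qed
    then have "AE \<omega>' in M. \<omega>' \<in> {\<omega>' \<in> space M. ?Q (override_on (ent \<omega>') (ent \<omega>) ?A)}"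
      using AE_space by eventually_elim simp
    moreover have "{\<omega>' \<in> space M. ?Q (override_on (ent \<omega>') (ent \<omega>) ?A)} \<in> sets M"
      by (rule sets_ent[where n = "Suc n" and Q = "\<lambda>h. ?Q (override_on h (ent \<omega>) ?A)"],
          rule open_cylinder_mono[OF open_cylinder_override_on[OF Q]]) (auto simp: tri_Suc)
    ultimately show "emeasure M {\<omega>' \<in> space M. ?Q (override_on (ent \<omega>') (ent \<omega>) ?A)} = 1"
      by (intro emeasure_eq_1_AE)
  qed
  also have "\<dots> = 1" by (simp add: emeasure_space_1)
  finally have "AE \<omega> in M. \<omega> \<in> {\<omega> \<in> space M. ?Q (ent \<omega>)}"
    using setsQ by (intro AE_in_set_eq_1[THEN iffD2]) (simp_all add: measure_def)
  then show ?case by eventually_elim simp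
qed

lemma markov_chain_cls: "markov_chain M perfect_symmetric_p_groups (\<lambda>n \<omega>. cls n (ent \<omega>))"
  unfolding markov_chain_def
proof (intro conjI allI ballI impI)
  show "prob_space M" by unfold_locales
  show "countable (perfect_symmetric_p_groups :: (nat, 'p) pairing_group set set)"
    by (rule countable_perfect_symmetric_p_groups)
  show "{\<omega> \<in> space M. cls n (ent \<omega>) = s} \<in> sets M" if "s \<in> perfect_symmetric_p_groups" for n s
    by (rule sets_ent[OF open_cylinder_cls[OF that]])
  show "AE \<omega> in M. cls n (ent \<omega>) \<in> perfect_symmetric_p_groups" for n
    using AE_sdet_neq_0[of n] by eventually_elim (rule cls_in)
  fix n s
  assume n: "1 \<le> n" and s: "\<forall>i\<in>{1..Suc n}. s i \<in> perfect_symmetric_p_groups"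
    and pos: "0 < \<P>(\<omega> in M. \<forall>i\<in>{1..n}. cls i (ent \<omega>) = s i)"
  let ?E = "\<lambda>f. \<forall>i\<in>{1..n}. cls i f = s i"
  have sn: "s n \<in> perfect_symmetric_p_groups" "s (Suc n) \<in> perfect_symmetric_p_groups" using n s by auto
  have E: "open_cylinder (tri n) ?E"
  proof (rule open_cylinder_ball_finite)
    show "open_cylinder (tri n) (\<lambda>f. cls i f = s i)" if "i \<in> {1..n}" for i
      by (rule open_cylinder_mono[OF open_cylinder_cls tri_mono]) (use s that in auto)
  qed simp
  have F: "open_cylinder (tri n) (\<lambda>f. cls n f = s n)" by (rule open_cylinder_cls[OF sn(1)])
  have E_n: "cls n f = s n" if "?E f" for f using that n by auto
  \<comment> \<open>The transition probability \<open>hit\<close> is attached to a matrix, so a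
    matrix of class \<open>s n\<close> is needed. Positivity of the conditioning event supplies
    one.\<close>
  have "{\<omega> \<in> space M. ?E (ent \<omega>)} \<noteq> {}"
  proof
    assume e: "{\<omega> \<in> space M. ?E (ent \<omega>)} = {}"
    show False using pos unfolding e by simp
  qed
  then obtain \<omega>0 where f: "cls n (ent \<omega>0) = s n" using E_n by blast
  have "measure M {\<omega> \<in> space M. ?E (ent \<omega>)} \<le> measure M {\<omega> \<in> space M. cls n (ent \<omega>) = s n}"
    by (rule finite_measure_mono[OF _ sets_ent[OF F]]) (use E_n in auto)
  then have pos': "measure M {\<omega> \<in> space M. cls n (ent \<omega>) = s n} > 0" using pos by simp
  show "\<P>(\<omega> in M. cls (Suc n) (ent \<omega>) = s (Suc n) \<bar> \<forall>i\<in>{1..n}. cls i (ent \<omega>) = s i) =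
      \<P>(\<omega> in M. cls (Suc n) (ent \<omega>) = s (Suc n) \<bar> cls n (ent \<omega>) = s n)"
    unfolding cond_prob_def
    \<comment> \<open>Both sides equal the transition probability out of
      \<open>ent \<omega>0\<close>, once with the whole history as past event and once with the
      present class alone.\<close>
    using cond_prob_step[OF sn E E_n f pos] cond_prob_step[OF sn F _ f pos'] by simp
qed

end

text \<open>The process of the theorem agrees with \<open>cls\<close> only on the sample space,
  since \<open>sym_haar\<close> grants symmetry of the matrix only there.\<close>

lemma markov_chain_cong:
  assumes "\<And>n \<omega>. \<omega> \<in> space M \<Longrightarrow> X n \<omega> = Y n \<omega>"
  shows "markov_chain M S X \<longleftrightarrow> markov_chain M S Y"
proof -
  have 1: "{\<omega> \<in> space M. X n \<omega> = s} = {\<omega> \<in> space M. Y n \<omega> = s}" for n s using assms by auto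
  have 2: "(AE \<omega> in M. X n \<omega> \<in> S) \<longleftrightarrow> (AE \<omega> in M. Y n \<omega> \<in> S)" for n
    by (rule AE_cong) (simp add: assms)
  have 3: "{\<omega> \<in> space M. \<forall>i\<in>{1..n}. X i \<omega> = s i} = {\<omega> \<in> space M. \<forall>i\<in>{1..n}. Y i \<omega> = s i}" for n s
    using assms by auto
  have 4: "{\<omega> \<in> space M. X (Suc n) \<omega> = t \<and> (\<forall>i\<in>{1..n}. X i \<omega> = s i)} =
      {\<omega> \<in> space M. Y (Suc n) \<omega> = t \<and> (\<forall>i\<in>{1..n}. Y i \<omega> = s i)}" for n s t
    using assms by auto
  have 5: "{\<omega> \<in> space M. X (Suc n) \<omega> = t \<and> X n \<omega> = u} = {\<omega> \<in> space M. Y (Suc n) \<omega> = t \<and> Y n \<omega> = u}" for n t u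
    using assms by auto
  show ?thesis unfolding markov_chain_def cond_prob_def 1 2 3 4 5 ..
qed

theorem theorem1:
  fixes M :: "'w measure"
    and a :: "nat \<Rightarrow> nat \<Rightarrow> 'w \<Rightarrow> 'p::prime_card padic_int"
  assumes "sym_haar M a"
  shows "markov_chain M perfect_symmetric_p_groups (\<lambda>n \<omega>. iso_class (kernel_group (corner a n \<omega>)))"
proof -
  interpret sym_haar_process M a
    using assms by (simp add: sym_haar_process_def sym_haar_process_axioms_def sym_haar_def)
  show ?thesis
    using markov_chain_cls markov_chain_cong[of M "\<lambda>n \<omega>. iso_class (kernel_group (corner a n \<omega>))", OF cls_ent] by blast
qed

end
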